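(* Let $S$ be a smooth manifold, let $\mathfrak g$ be a Lie algebra and let $\alpha:\mathfrak g\to\mathfrak g^*$ be a 1-cocycle on $\mathfrak g$ with values in $\mathfrak g^*$ (coadjoint action), with symmetric part $p\in S^2\mathfrak g^*$ and skew-symmetric part $\omega\in\Lambda^2\mathfrak g^*$, i.e. $\alpha(x)y=p(x,y)+\omega(x,y)$. Let $C_\alpha\mathfrak g$ be the associated two-dimensional central dgla extension of the cone $C\mathfrak g$. Then the Lie algebra $\mathcal{SA}(S,C_\alpha\mathfrak g)$ is isomorphic to the central Lie algebra extension of the current algebra $C^\infty(S,\mathfrak g)$ by $\Omega^1(S)$ defined with the cocycle $$\sigma_N(u,v)=p(u,dv)-p(du,v)+d(\omega(u,v))\in\Omega^1(S),\qquad u,v\in C^\infty(S,\mathfrak g).$$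
   Context: A dgla is a differential graded Lie algebra (differential of degree $+1$, bracket of degree $0$). The cone $C\mathfrak g$ of a Lie algebra $\mathfrak g$ is the dgla spanned by elements $L(x)$ of degree $0$ and $I(x)$ of degree $-1$ ($x\in\mathfrak g$, linear in $x$), with $[L(x),L(y)]=L([x,y])$, $[L(x),I(y)]=I([x,y])$, $[I(x),I(y)]=0$, $dI(x)=L(x)$, $dL(x)=0$. The 1-cocycle condition on $\alpha$ reads $\alpha([x,y])z=\alpha(x)[y,z]-\alpha(y)[x,z]$ for all $x,y,z\in\mathfrak g$; it is equivalent to $p([\cdot,\cdot],\cdot)=-d_{\mathfrak g}\omega$ ($d_{\mathfrak g}$ the Chevalley-Eilenberg differential), and it implies that $p$ is $\mathfrak g$-invariant. The dgla $C_\alpha\mathfrak g$ is, as a graded vector space, $C\mathfrak g\oplus\mathbb R c_1\oplus\mathbb R c_2$ with $c_1$ of degree $-1$ and $c_2$ of degree $-2$ both central. Its brackets are those of $C\mathfrak g$ modified by the 2-cocycle $(L(x)+I(y),L(x')+I(y'))\mapsto(\alpha(x)y'-\alpha(x')y)\,c_1+(\alpha(y)y'+\alpha(y')y)\,c_2$; that is, $[L(x),L(y)]=L([x,y])$, $[L(x),I(y)]=I([x,y])+(\alpha(x)y)c_1$, $[I(x),I(y)]=(\alpha(x)y+\alpha(y)x)c_2$. Its differential is $dI(x)=L(x)$, $dL(x)=0$, $dc_2=c_1$, $dc_1=0$. For a smooth manifold $S$ and a dgla $A$, $\mathcal{SA}(S,A)=(\Omega(S)\otimes A)^0_{closed}$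 is the Lie algebra of closed elements of total degree $0$ in the tensor product dgla $\Omega(S)\otimes A$, with bracket $[\varphi\otimes a,\psi\otimes b]=\varphi\psi\otimes[a,b]$ up to the usual Koszul sign $(-1)^{|a||\psi|}$, and differential $d(\varphi\otimes a)=d\varphi\otimes a+(-1)^{|\varphi|}\varphi\otimes da$. $C^\infty(S,\mathfrak g)$ carries the pointwise bracket and is identified with $C^\infty(S)\otimes\mathfrak g$. The central extension defined with a 2-cocycle $\sigma$ is $C^\infty(S,\mathfrak g)\oplus\Omega^1(S)$ with bracket $[(u,\beta),(v,\beta')]=([u,v],\sigma(u,v))$. For $u=f\otimes x$, $v=f'\otimes x'$: $p(u,dv)=p(x,x')f\,df'$, $p(du,v)=p(x,x')f'\,df$, $\omega(u,v)=\omega(x,x')ff'$. *)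

theory Defs
  imports "HOL-Analysis.Analysis" "HOL-Library.Function_Algebras"
begin

text \<open>Functions with values in a real vector space form a real vector space under the pointwise
  operations; sums and products of functions are those of
  \<^theory>\<open>HOL-Library.Function_Algebras\<close>.\<close>

instantiation "fun" :: (type, real_vector) real_vector
begin

definition scaleR_fun_def: "scaleR c f = (\<lambda>x. c *\<^sub>R f x)"

instance
  by standard (auto simp: scaleR_fun_def plus_fun_def fun_eq_iff algebra_simps)

end


section \<open>Smooth manifolds\<close>

text \<open>\<open>C_on n k U f\<close>: the function \<open>f\<close> is of class $C^k$ on the open set \<open>U\<close> of $\mathbb R^n$, i.e.
  all its iterated partial derivatives up to order \<open>k\<close> exist and are continuous on \<open>U\<close>. Here
  $\mathbb R^n$ is \<^const>\<open>Euclidean_space\<close>, the space of sequences vanishing from index \<open>n\<close> on, which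
  allows every dimension including 0.\<close>

primrec C_on :: "nat \<Rightarrow> nat \<Rightarrow> (nat \<Rightarrow> real) set \<Rightarrow> ((nat \<Rightarrow> real) \<Rightarrow> real) \<Rightarrow> bool" where
  "C_on n 0 U f \<longleftrightarrow> continuous_map (subtopology (Euclidean_space n) U) euclideanreal f"
| "C_on n (Suc k) U f \<longleftrightarrow>
     continuous_map (subtopology (Euclidean_space n) U) euclideanreal f \<and>
     (\<forall>i<n. \<exists>g. (\<forall>x\<in>U. ((\<lambda>t. f (x(i := t))) has_real_derivative g x) (at (x i))) \<and> C_on n k U g)"

definition smooth_on :: "nat \<Rightarrow> (nat \<Rightarrow> real) set \<Rightarrow> ((nat \<Rightarrow> real) \<Rightarrow> real) \<Rightarrow> bool" where
  "smooth_on n U f \<longleftrightarrow> (\<forall>k. C_on n k U f)"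

record 's manifold =
  mdim :: nat
  mtop :: "'s topology"
  atlas :: "('s set \<times> ('s \<Rightarrow> nat \<Rightarrow> real)) set"

definition smooth_manifold :: "'s manifold \<Rightarrow> bool" where
  "smooth_manifold S \<longleftrightarrow>
     Hausdorff_space (mtop S) \<and> second_countable (mtop S) \<and>
     (\<Union>(U, \<phi>)\<in>atlas S. U) = topspace (mtop S) \<and>
     (\<forall>(U, \<phi>)\<in>atlas S.
        openin (mtop S) U \<and> openin (Euclidean_space (mdim S)) (\<phi> ` U) \<and>
        homeomorphic_map (subtopology (mtop S) U)
          (subtopology (Euclidean_space (mdim S)) (\<phi> ` U)) \<phi>) \<and>
     (\<forall>(U, \<phi>)\<in>atlas S. \<forall>(V, \<psi>)\<in>atlas S. \<forall>i<mdim S.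
        smooth_on (mdim S) (\<phi> ` (U \<inter> V)) (\<lambda>x. \<psi> (inv_into U \<phi> x) i))"

text \<open>$C^\infty(S)$. A function on \<open>S\<close> is represented by its extension by 0 to the ambient type.\<close>

definition C_inf :: "'s manifold \<Rightarrow> ('s \<Rightarrow> real) set" where
  "C_inf S = {f. (\<forall>s. s \<notin> topspace (mtop S) \<longrightarrow> f s = 0) \<and>
     (\<forall>(U, \<phi>)\<in>atlas S. smooth_on (mdim S) (\<phi> ` U) (\<lambda>x. f (inv_into U \<phi> x)))}"

text \<open>$C^\infty(S,\mathfrak g)$. The Lie algebra may be infinite-dimensional; in that case these are the
  maps that take values in a finite-dimensional subspace and are smooth as maps into it, so that
  $C^\infty(S,\mathfrak g)=C^\infty(S)\otimes\mathfrak g$ always. If the dimension is finite, the first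
  condition is void and these are all smooth maps.\<close>

definition C_inf_map :: "'s manifold \<Rightarrow> ('s \<Rightarrow> 'g::real_vector) set" where
  "C_inf_map S = {u. (\<exists>B. finite B \<and> range u \<subseteq> span B) \<and>
     (\<forall>l::'g \<Rightarrow> real. linear l \<longrightarrow> (\<lambda>s. l (u s)) \<in> C_inf S)}"


section \<open>Vector fields and differential forms\<close>

text \<open>Vector fields are the derivations of $C^\infty(S)$, extended by 0 to functions that are not smooth.\<close>

type_synonym 's vf = "('s \<Rightarrow> real) \<Rightarrow> 's \<Rightarrow> real"

definition vfields :: "'s manifold \<Rightarrow> 's vf set" where
  "vfields S = {X. (\<forall>f\<in>C_inf S. X f \<in> C_inf S) \<and> (\<forall>f. f \<notin> C_inf S \<longrightarrow> X f = 0) \<and>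
     (\<forall>f\<in>C_inf S. \<forall>g\<in>C_inf S. X (f + g) = X f + X g \<and> X (f * g) = f * X g + g * X f) \<and>
     (\<forall>c. \<forall>f\<in>C_inf S. X (c *\<^sub>R f) = c *\<^sub>R X f)}"

definition vf_bracket :: "'s vf \<Rightarrow> 's vf \<Rightarrow> 's vf" where
  "vf_bracket X Y = (\<lambda>f. X (Y f) - Y (X f))"

text \<open>A differential form of degree \<open>k\<close> is an alternating $C^\infty(S)$-multilinear map from \<open>k\<close>-tuples of
  vector fields to $C^\infty(S)$. A form, possibly inhomogeneous, is represented by its values on lists
  of vector fields; the part of degree \<open>k\<close> lives on the lists of length \<open>k\<close>.\<close>

type_synonym 's form = "'s vf list \<Rightarrow> 's \<Rightarrow> real"

definition Omega :: "'s manifold \<Rightarrow> nat \<Rightarrow> 's form set" where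
  "Omega S k = {\<phi>.
     (\<forall>Xs. \<not> (length Xs = k \<and> set Xs \<subseteq> vfields S) \<longrightarrow> \<phi> Xs = 0) \<and>
     (\<forall>Xs. length Xs = k \<and> set Xs \<subseteq> vfields S \<longrightarrow>
        \<phi> Xs \<in> C_inf S \<and>
        (\<not> distinct Xs \<longrightarrow> \<phi> Xs = 0) \<and>
        (\<forall>i<k. \<forall>X\<in>vfields S. \<forall>Y\<in>vfields S. \<forall>f\<in>C_inf S.
           \<phi> (Xs[i := X + Y]) = \<phi> (Xs[i := X]) + \<phi> (Xs[i := Y]) \<and>
           \<phi> (Xs[i := (\<lambda>h. f * X h)]) = f * \<phi> (Xs[i := X])))}"

text \<open>The sum over all subsets \<open>I\<close> is the sum over all shuffles, of all types, with the sign of the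
  shuffle; the normalisation is $(\alpha\wedge\beta)(X,Y)=\alpha(X)\beta(Y)-\alpha(Y)\beta(X)$ for 1-forms.\<close>

definition wedge :: "'s form \<Rightarrow> 's form \<Rightarrow> 's form" where
  "wedge \<phi> \<psi> = (\<lambda>Xs s. \<Sum>I\<in>Pow {..<length Xs}.
     (-1) ^ card {(i, j). i \<in> I \<and> j \<notin> I \<and> j < i} * \<phi> (nths Xs I) s * \<psi> (nths Xs (- I)) s)"

text \<open>Koszul's formula
  $$d\phi(X_0,\dots,X_k)=\sum_i(-1)^iX_i\,\phi(\dots\widehat{X_i}\dots)
     +\sum_{i<j}(-1)^{i+j}\phi([X_i,X_j],\dots\widehat{X_i}\dots\widehat{X_j}\dots).$$\<close>

definition ext_d :: "'s manifold \<Rightarrow> 's form \<Rightarrow> 's form" where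
  "ext_d S \<phi> = (\<lambda>Xs s. if set Xs \<subseteq> vfields S then
       (\<Sum>i<length Xs. (-1) ^ i * (Xs ! i) (\<phi> (nths Xs (- {i}))) s) +
       (\<Sum>j<length Xs. \<Sum>i<j. (-1) ^ (i + j) *
          \<phi> (vf_bracket (Xs ! i) (Xs ! j) # nths Xs (- {i, j})) s)
     else 0)"

definition form0 :: "('s \<Rightarrow> real) \<Rightarrow> 's form" where
  "form0 f = (\<lambda>Xs. if Xs = [] then f else 0)"

definition form1 :: "'s manifold \<Rightarrow> ('s vf \<Rightarrow> 's \<Rightarrow> real) \<Rightarrow> 's form" where
  "form1 S \<beta> = (\<lambda>Xs. case Xs of [X] \<Rightarrow> if X \<in> vfields S then \<beta> X else 0 | _ \<Rightarrow> 0)"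


lemma wedge_form0: "wedge (form0 f) \<psi> Xs s = f s * \<psi> Xs s"
proof -
  have "wedge (form0 f) \<psi> Xs s = (\<Sum>I\<in>Pow {..<length Xs}. if I = {} then f s * \<psi> Xs s else 0)"
    unfolding wedge_def
  proof (rule sum.cong [OF refl])
    fix I assume "I \<in> Pow {..<length Xs}"
    moreover have "nths Xs UNIV = Xs"
      by (rule nths_all) simp
    moreover have "nths Xs I \<noteq> []" if "i \<in> I" "i < length Xs" for i
    proof -
      have "Xs ! i \<in> set (nths Xs I)" using that by (auto simp: set_nths)
      then show ?thesis by auto
    qed
    ultimately show "(-1) ^ card {(i, j). i \<in> I \<and> j \<notin> I \<and> j < i} * form0 f (nths Xs I) s * \<psi> (nths Xs (- I)) s =
      (if I = {} then f s * \<psi> Xs s else 0)"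
      by (auto simp: form0_def Compl_eq_Diff_UNIV)
  qed
  also have "\<dots> = f s * \<psi> Xs s"
    by (simp add: sum.delta)
  finally show ?thesis .
qed

lemma ext_d_form0:
  fixes S :: "'s manifold"
  shows "ext_d S (form0 f) = form1 S (\<lambda>X. X f)"
proof (rule ext, rule ext)
  fix Xs :: "'s vf list" and s
  consider "Xs = []" | X where "Xs = [X]" | X Y Zs where "Xs = X # Y # Zs"
    by (metis list.exhaust)
  then show "ext_d S (form0 f) Xs s = form1 S (\<lambda>X. X f) Xs s"
  proof cases
    case 3
    have "nths Xs (- {i}) \<noteq> []" for i
      by (cases i) (auto simp: 3 nths_Cons)
    moreover have "X' 0 = 0" if "X' \<in> vfields S" for X'
    proof -
      have "0 \<in> C_inf S \<or> 0 \<notin> C_inf S" by blast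
      moreover have "X' 0 = 0" if "0 \<in> C_inf S"
      proof -
        have "X' (0 *\<^sub>R 0) = 0 *\<^sub>R X' 0"
          using \<open>X' \<in> vfields S\<close> that unfolding vfields_def by blast
        then show ?thesis by simp
      qed
      ultimately show ?thesis using that unfolding vfields_def by blast
    qed
    ultimately have "(Xs ! i) (form0 f (nths Xs (- {i}))) s = 0"
      if "set Xs \<subseteq> vfields S" "i < length Xs" for i
    proof -
      have "Xs ! i \<in> vfields S"
        using that nth_mem by blast
      then show ?thesis
        using \<open>\<And>i. nths Xs (- {i}) \<noteq> []\<close> \<open>\<And>X'. X' \<in> vfields S \<Longrightarrow> X' 0 = 0\<close>
        by (simp add: form0_def)
    qed
    then have "ext_d S (form0 f) Xs s = 0"
      by (auto simp: ext_d_def form0_def intro!: sum.neutral)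
    then show ?thesis
      by (simp add: form1_def 3)
  qed (auto simp: ext_d_def form0_def form1_def nths_Cons)
qed


section \<open>Differential graded algebras and their tensor products\<close>

text \<open>A graded vector space with a product and a differential, used both for commutative dg algebras
  and for dg Lie algebras.\<close>

record 'v dg =
  part :: "int \<Rightarrow> 'v set"
  mult :: "'v \<Rightarrow> 'v \<Rightarrow> 'v"
  diff :: "'v \<Rightarrow> 'v"

definition ksign :: "int \<Rightarrow> real" where
  "ksign n = (if even n then 1 else - 1)"

definition dgla :: "('v::real_vector) dg \<Rightarrow> bool" where
  "dgla A \<longleftrightarrow>
     (\<forall>i. subspace (part A i)) \<and> span (\<Union>i. part A i) = UNIV \<and>
     (\<forall>K v. finite K \<and> (\<forall>i\<in>K. v i \<in> part A i) \<and> sum v K = 0 \<longrightarrow> (\<forall>i\<in>K. v i = 0)) \<and>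
     bilinear (mult A) \<and> linear (diff A) \<and> (\<forall>a. diff A (diff A a) = 0) \<and>
     (\<forall>i. \<forall>a\<in>part A i. diff A a \<in> part A (i + 1)) \<and>
     (\<forall>i j. \<forall>a\<in>part A i. \<forall>b\<in>part A j.
        mult A a b \<in> part A (i + j) \<and>
        mult A a b = - ksign (i * j) *\<^sub>R mult A b a \<and>
        diff A (mult A a b) = mult A (diff A a) b + ksign i *\<^sub>R mult A a (diff A b) \<and>
        (\<forall>c. mult A a (mult A b c) =
           mult A (mult A a b) c + ksign (i * j) *\<^sub>R mult A b (mult A a c)))"

definition de_Rham :: "'s manifold \<Rightarrow> 's form dg" where
  "de_Rham S = \<lparr>part = (\<lambda>i. if i < 0 then {0} else Omega S (nat i)),
     mult = wedge, diff = ext_d S\<rparr>"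

text \<open>The algebraic tensor product of two real vector spaces is realised as the span of the pure tensors
  inside the dual of the space of bilinear forms, where $a\otimes b$ is the evaluation of bilinear forms
  at $(a,b)$. Tensor products of subspaces are spans of the corresponding pure tensors.\<close>

type_synonym ('a, 'b) tensor = "('a \<Rightarrow> 'b \<Rightarrow> real) \<Rightarrow> real"

definition tensor :: "'a::real_vector \<Rightarrow> 'b::real_vector \<Rightarrow> ('a, 'b) tensor"  (infixr \<open>\<otimes>\<close> 72) where
  "a \<otimes> b = (\<lambda>B. if bilinear B then B a b else 0)"

text \<open>\<open>tensor_rep F A r t\<close>: \<open>t\<close> is the sum of the homogeneous pure tensors in the list \<open>r\<close>, which also
  records the degrees of the factors. The product and the differential of the tensor product are the
  linear extensions of the formulas on homogeneous pure tensors; they do not depend on the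
  representations chosen.\<close>

definition tensor_rep ::
  "('f::real_vector) dg \<Rightarrow> ('a::real_vector) dg \<Rightarrow> (int \<times> 'f \<times> int \<times> 'a) list \<Rightarrow> ('f, 'a) tensor \<Rightarrow> bool"
  where "tensor_rep F A r t \<longleftrightarrow>
     (\<forall>(i, \<phi>, j, a)\<in>set r. \<phi> \<in> part F i \<and> a \<in> part A j) \<and>
     t = (\<Sum>(i, \<phi>, j, a)\<leftarrow>r. \<phi> \<otimes> a)"

definition tensor_dg ::
  "('f::real_vector) dg \<Rightarrow> ('a::real_vector) dg \<Rightarrow> ('f, 'a) tensor dg" where
  "tensor_dg F A = \<lparr>
     part = (\<lambda>n. span {\<phi> \<otimes> a |\<phi> a i j. \<phi> \<in> part F i \<and> a \<in> part A j \<and> i + j = n}),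
     mult = (\<lambda>t t'. THE w. \<exists>r r'. tensor_rep F A r t \<and> tensor_rep F A r' t' \<and>
       w = (\<Sum>(i, \<phi>, j, a)\<leftarrow>r. \<Sum>(k, \<psi>, l, b)\<leftarrow>r'. ksign (j * k) *\<^sub>R (mult F \<phi> \<psi> \<otimes> mult A a b))),
     diff = (\<lambda>t. THE w. \<exists>r. tensor_rep F A r t \<and>
       w = (\<Sum>(i, \<phi>, j, a)\<leftarrow>r. diff F \<phi> \<otimes> a + ksign i *\<^sub>R (\<phi> \<otimes> diff A a)))\<rparr>"


section \<open>Lie algebras\<close>

definition lie_algebra :: "('v::real_vector) set \<Rightarrow> ('v \<Rightarrow> 'v \<Rightarrow> 'v) \<Rightarrow> bool" where
  "lie_algebra V br \<longleftrightarrow> subspace V \<and>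
     (\<forall>x\<in>V. \<forall>y\<in>V. br x y \<in> V) \<and>
     (\<forall>x\<in>V. \<forall>y\<in>V. \<forall>z\<in>V. br (x + y) z = br x z + br y z \<and> br z (x + y) = br z x + br z y) \<and>
     (\<forall>c. \<forall>x\<in>V. \<forall>y\<in>V. br (c *\<^sub>R x) y = c *\<^sub>R br x y \<and> br x (c *\<^sub>R y) = c *\<^sub>R br x y) \<and>
     (\<forall>x\<in>V. br x x = 0) \<and>
     (\<forall>x\<in>V. \<forall>y\<in>V. \<forall>z\<in>V. br x (br y z) + br y (br z x) + br z (br x y) = 0)"

definition lie_isomorphic ::
  "('v::real_vector) set \<Rightarrow> ('v \<Rightarrow> 'v \<Rightarrow> 'v) \<Rightarrow> ('w::real_vector) set \<Rightarrow> ('w \<Rightarrow> 'w \<Rightarrow> 'w) \<Rightarrow> bool" where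
  "lie_isomorphic V br W br' \<longleftrightarrow> lie_algebra V br \<and> lie_algebra W br' \<and>
     (\<exists>F. bij_betw F V W \<and>
        (\<forall>x\<in>V. \<forall>y\<in>V. F (x + y) = F x + F y) \<and>
        (\<forall>c. \<forall>x\<in>V. F (c *\<^sub>R x) = c *\<^sub>R F x) \<and>
        (\<forall>x\<in>V. \<forall>y\<in>V. F (br x y) = br' (F x) (F y)))"

text \<open>Cocycles with values in the dual, with the coadjoint action $(x\cdot\xi)(z)=-\xi([x,z])$.\<close>

definition coadjoint_cocycle :: "('g::real_vector \<Rightarrow> 'g \<Rightarrow> 'g) \<Rightarrow> ('g \<Rightarrow> 'g \<Rightarrow> real) \<Rightarrow> bool" where
  "coadjoint_cocycle br \<alpha> \<longleftrightarrow> bilinear \<alpha> \<and>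
     (\<forall>x y z. \<alpha> (br x y) z = \<alpha> x (br y z) - \<alpha> y (br x z))"

text \<open>The dgla $C_\alpha\mathfrak g$; the quadruple $(x,y,s,t)$ stands for
  $L(x)+I(y)+s\,c_1+t\,c_2$.\<close>

definition cone_ext ::
  "('g::real_vector \<Rightarrow> 'g \<Rightarrow> 'g) \<Rightarrow> ('g \<Rightarrow> 'g \<Rightarrow> real) \<Rightarrow> ('g \<times> 'g \<times> real \<times> real) dg" where
  "cone_ext br \<alpha> = \<lparr>
     part = (\<lambda>i. if i = 0 then {(x, 0, 0, 0) |x. True}
       else if i = - 1 then {(0, y, s, 0) |y s. True}
       else if i = - 2 then {(0, 0, 0, t) |t. True}
       else {0}),
     mult = (\<lambda>(x, y, _, _) (x', y', _, _).
       (br x x', br x y' + br y x', \<alpha> x y' - \<alpha> x' y, \<alpha> y y' + \<alpha> y' y)),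
     diff = (\<lambda>(x, y, s, t). (y, 0, t, 0))\<rparr>"

lemma dgla_cone_ext:
  fixes br :: "'g::real_vector \<Rightarrow> 'g \<Rightarrow> 'g"
  assumes L: "lie_algebra UNIV br" and c: "coadjoint_cocycle br \<alpha>"
  shows "dgla (cone_ext br \<alpha>)"
proof -
  let ?A = "cone_ext br \<alpha>"
  have bil: "bilinear br" and sq: "br x x = 0"
    and J: "br x (br y z) + br y (br z x) + br z (br x y) = 0" for x y z
    using L by (auto simp: lie_algebra_def bilinear_def linear_iff)
  have ab: "bilinear \<alpha>" and cc: "\<alpha> (br x y) z = \<alpha> x (br y z) - \<alpha> y (br x z)" for x y z
    using c by (auto simp: coadjoint_cocycle_def)
  note bi = bilinear_ladd bilinear_radd bilinear_lmul bilinear_rmul bilinear_lneg bilinear_rneg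
    bilinear_lzero bilinear_rzero
  note bb = bi [OF bil] bi [OF ab]
  have sk: "br y x = - br x y" for x y
  proof -
    have "br x y + br y x = 0"
      using sq [of x] sq [of y] sq [of "x + y"] by (simp add: bb add.commute)
    then show ?thesis
      by (simp add: add_eq_0_iff)
  qed
  have J': "br x (br y z) = br (br x y) z + br y (br x z)" for x y z
    using J [of x y z] sk [of z x] sk [of z "br x y"] by (simp add: bb algebra_simps)
  note d = cone_ext_def
  have sub: "subspace (part ?A i)" for i
    by (auto simp: subspace_def d zero_prod_def)
  have spn: "span (\<Union>i. part ?A i) = UNIV"
  proof -
    have "(x, y, s, t) \<in> span (\<Union>i. part ?A i)" for x y s t
    proof -
      have "(x, 0, 0, 0) \<in> part ?A 0" "(0, y, s, 0) \<in> part ?A (- 1)"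
        "(0, 0, 0, t) \<in> part ?A (- 2)"
        by (auto simp: d)
      then have "(x, 0, 0, 0) + (0, y, s, 0) + (0, 0, 0, t) \<in> span (\<Union>i. part ?A i)"
        by (intro span_add span_base) blast+
      then show ?thesis by simp
    qed
    then show ?thesis by auto
  qed
  have ind: "\<forall>i\<in>K. v i = 0"
    if K: "finite K" "\<forall>i\<in>K. v i \<in> part ?A i" "sum v K = 0" for K v
  proof
    fix i assume i: "i \<in> K"
    have "(\<Sum>i\<in>K. fst (v i)) = 0" "(\<Sum>i\<in>K. fst (snd (v i))) = 0"
      "(\<Sum>i\<in>K. fst (snd (snd (v i)))) = 0" "(\<Sum>i\<in>K. snd (snd (snd (v i)))) = 0"
      using K(3) by (simp_all flip: fst_sum snd_sum)
    moreover have z: "i \<noteq> 0 \<longrightarrow> fst (v i) = 0" "i \<noteq> - 1 \<longrightarrow> fst (snd (v i)) = 0"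
      "i \<noteq> - 1 \<longrightarrow> fst (snd (snd (v i))) = 0" "i \<noteq> - 2 \<longrightarrow> snd (snd (snd (v i))) = 0" if "i \<in> K" for i
      using bspec [OF K(2) that] by (auto simp: d split: if_splits)
    moreover have "(\<Sum>i\<in>K. fst (v i)) = (\<Sum>i\<in>K. if i = 0 then fst (v 0) else 0)"
      "(\<Sum>i\<in>K. fst (snd (v i))) = (\<Sum>i\<in>K. if i = - 1 then fst (snd (v (- 1))) else 0)"
      "(\<Sum>i\<in>K. fst (snd (snd (v i)))) = (\<Sum>i\<in>K. if i = - 1 then fst (snd (snd (v (- 1)))) else 0)"
      "(\<Sum>i\<in>K. snd (snd (snd (v i)))) = (\<Sum>i\<in>K. if i = - 2 then snd (snd (snd (v (- 2)))) else 0)"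
      using z by (auto intro!: sum.cong)
    ultimately show "v i = 0"
      using K(1) i by (cases "i = 0"; cases "i = - 1"; cases "i = - 2") (auto simp: prod_eq_iff)
  qed
  have bm: "bilinear (mult ?A)"
    by (auto simp: bilinear_def linear_iff d bb algebra_simps)
  have ld: "linear (diff ?A)" and dd: "diff ?A (diff ?A a) = 0" for a
    by (auto simp: linear_iff d zero_prod_def split: prod.splits)
  have dg: "diff ?A a \<in> part ?A (i + 1)" if "a \<in> part ?A i" for a i
    using that by (auto simp: d zero_prod_def split: if_splits)
  have "mult ?A a b \<in> part ?A (i + j) \<and>
        mult ?A a b = - ksign (i * j) *\<^sub>R mult ?A b a \<and>
        diff ?A (mult ?A a b) = mult ?A (diff ?A a) b + ksign i *\<^sub>R mult ?A a (diff ?A b) \<and>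
        (\<forall>c. mult ?A a (mult ?A b c) =
           mult ?A (mult ?A a b) c + ksign (i * j) *\<^sub>R mult ?A b (mult ?A a c))"
    if "a \<in> part ?A i" "b \<in> part ?A j" for a b i j
  proof -
    have inv: "\<alpha> x (br y z) + \<alpha> (br y z) x - \<alpha> (br x y) z - \<alpha> z (br x y) = 0" for x y z
      using sk[of x z] sk[of y x] sk[of z y]
      by (simp add: cc bb)
    have inv': "\<alpha> y (br x z) + \<alpha> (br x z) y = - \<alpha> (br x y) z - \<alpha> z (br x y)" for x y z
      using inv [of y x z] sk [of y x] by (simp add: bb)
    have hom: "a = 0 \<or> i = 0 \<and> (\<exists>x. a = (x, 0, 0, 0)) \<or> i = - 1 \<and> (\<exists>y s. a = (0, y, s, 0)) \<or>
        i = - 2 \<and> (\<exists>t. a = (0, 0, 0, t))" if "a \<in> part ?A i" for a i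
      using that by (auto simp: d split: if_splits)
    show ?thesis
    proof (cases "a = 0 \<or> b = 0")
      case True
      then show ?thesis
        using subspace_0 [OF sub] by (auto simp: bi [OF bm] linear_0 [OF ld])
    next
      case False
      have F1: "\<alpha> x (br y z) = - \<alpha> z (br x y) - \<alpha> (br x z) y" for x y z
        using sk [of z y] by (simp add: cc bb)
      have F2: "\<alpha> (br x y) z + \<alpha> z (br x y) + (\<alpha> y (br x z) + \<alpha> (br x z) y) = 0" for x y z
        using inv' [of y x z] by simp
      have F3: "- \<alpha> (br x z) y = \<alpha> x (br y z) - \<alpha> z (br y x)" for x y z
        using F1 [of x y z] sk [of y x] by (simp add: bb)
      have F4: "\<alpha> y (br x z) + \<alpha> (br x z) y = \<alpha> (br y x) z + \<alpha> z (br y x)" for x y z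
        using inv' [of y x z] sk [of y x] by (simp add: bb)
      have F5: "\<alpha> y (br x z) + \<alpha> (br x z) y = - \<alpha> x (br y z) - \<alpha> (br y z) x" for x y z
        using F4 [of y x z] inv' [of x y z] by simp
      have F6: "\<alpha> x (br y z) = \<alpha> (br x y) z + \<alpha> y (br x z)" for x y z
        by (simp add: cc)
      have sg: "ksign 0 = 1" "ksign (- 1) = - 1" "ksign 1 = - 1" "ksign 2 = 1" "ksign (- 2) = 1" "ksign 4 = 1"
        by (auto simp: ksign_def)
      show ?thesis
        using hom [OF that(1)] hom [OF that(2)] False
        apply (elim disjE conjE exE; simp add: d sg bb zero_prod_def)
           apply (intro conjI allI J' sk F1 F2 F3 F4 F5 F6)+
        done
    qed
  qed
  note main = this
  show ?thesis
    unfolding dgla_def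
    apply (intro conjI allI ballI impI)
    subgoal by (rule sub)
    subgoal by (rule spn)
    subgoal for K v i using ind [of K v] by simp
    subgoal by (rule bm)
    subgoal by (rule ld)
    subgoal by (rule dd)
    subgoal by (erule dg)
    subgoal by (rule main [THEN conjunct1])
    subgoal by (rule main [THEN conjunct2, THEN conjunct1])
    subgoal by (rule main [THEN conjunct2, THEN conjunct2, THEN conjunct1])
    subgoal by (rule main [THEN conjunct2, THEN conjunct2, THEN conjunct2, rule_format])
    done
qed

text \<open>$\mathcal{SA}(S,A)$, with the bracket of $\Omega(S)\otimes A$\<close>

abbreviation SA_bracket ::
  "'s manifold \<Rightarrow> ('a::real_vector) dg \<Rightarrow> ('s form, 'a) tensor \<Rightarrow> ('s form, 'a) tensor \<Rightarrow> ('s form, 'a) tensor"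
  where "SA_bracket S A \<equiv> mult (tensor_dg (de_Rham S) A)"

definition SA :: "'s manifold \<Rightarrow> ('a::real_vector) dg \<Rightarrow> ('s form, 'a) tensor set" where
  "SA S A = {t \<in> part (tensor_dg (de_Rham S) A) 0. diff (tensor_dg (de_Rham S) A) t = 0}"


section \<open>The cocycle and the central extension\<close>

text \<open>The 1-forms $p(u,dv)$ and $p(du,v)$: their values on \<open>X\<close> at the point \<open>s\<close> are $p(u(s),(Xv)(s))$ and
  $p((Xu)(s),v(s))$, where \<open>X\<close> differentiates the functions $p(u(s),v(\cdot))$ and $p(u(\cdot),v(s))$.
  The lemmas below give the formulas $p(x,y)\,f\,df'$ and $p(x,y)\,f'\,df$ for $u=f\otimes x$, $v=f'\otimes y$.\<close>

definition pair_d_right ::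
  "'s manifold \<Rightarrow> ('g \<Rightarrow> 'g \<Rightarrow> real) \<Rightarrow> ('s \<Rightarrow> 'g) \<Rightarrow> ('s \<Rightarrow> 'g) \<Rightarrow> 's form" where
  "pair_d_right S p u v = form1 S (\<lambda>X s. X (\<lambda>s'. p (u s) (v s')) s)"

definition pair_d_left ::
  "'s manifold \<Rightarrow> ('g \<Rightarrow> 'g \<Rightarrow> real) \<Rightarrow> ('s \<Rightarrow> 'g) \<Rightarrow> ('s \<Rightarrow> 'g) \<Rightarrow> 's form" where
  "pair_d_left S p u v = form1 S (\<lambda>X s. X (\<lambda>s'. p (u s') (v s)) s)"

lemma pair_d_right_pure:
  assumes "bilinear p" "f \<in> C_inf S" "f' \<in> C_inf S"
  shows "pair_d_right S p (\<lambda>s. f s *\<^sub>R x) (\<lambda>s. f' s *\<^sub>R y)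
     = p x y *\<^sub>R wedge (form0 f) (ext_d S (form0 f'))"
proof (intro ext)
  fix Xs s
  have "(\<lambda>s'. p (f s *\<^sub>R x) (f' s' *\<^sub>R y)) = (f s * p x y) *\<^sub>R f'"
    using assms(1) by (auto simp: bilinear_lmul bilinear_rmul scaleR_fun_def)
  moreover have "X ((f s * p x y) *\<^sub>R f') = (f s * p x y) *\<^sub>R X f'" if "X \<in> vfields S" for X
    using that assms(3) unfolding vfields_def by blast
  ultimately show "pair_d_right S p (\<lambda>s. f s *\<^sub>R x) (\<lambda>s. f' s *\<^sub>R y) Xs s
     = (p x y *\<^sub>R wedge (form0 f) (ext_d S (form0 f'))) Xs s"
    by (auto simp: scaleR_fun_def wedge_form0 ext_d_form0 pair_d_right_def form1_def split: list.split)
qed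

lemma pair_d_left_pure:
  assumes "bilinear p" "f \<in> C_inf S" "f' \<in> C_inf S"
  shows "pair_d_left S p (\<lambda>s. f s *\<^sub>R x) (\<lambda>s. f' s *\<^sub>R y)
     = p x y *\<^sub>R wedge (form0 f') (ext_d S (form0 f))"
proof (intro ext)
  fix Xs s
  have "(\<lambda>s'. p (f s' *\<^sub>R x) (f' s *\<^sub>R y)) = (f' s * p x y) *\<^sub>R f"
    using assms(1) by (auto simp: bilinear_lmul bilinear_rmul scaleR_fun_def)
  moreover have "X ((f' s * p x y) *\<^sub>R f) = (f' s * p x y) *\<^sub>R X f" if "X \<in> vfields S" for X
    using that assms(2) unfolding vfields_def by blast
  ultimately show "pair_d_left S p (\<lambda>s. f s *\<^sub>R x) (\<lambda>s. f' s *\<^sub>R y) Xs s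
     = (p x y *\<^sub>R wedge (form0 f') (ext_d S (form0 f))) Xs s"
    by (auto simp: scaleR_fun_def wedge_form0 ext_d_form0 pair_d_left_def form1_def split: list.split)
qed

definition sigma_N :: "'s manifold \<Rightarrow> ('g \<Rightarrow> 'g \<Rightarrow> real) \<Rightarrow> ('g \<Rightarrow> 'g \<Rightarrow> real) \<Rightarrow>
    ('s \<Rightarrow> 'g) \<Rightarrow> ('s \<Rightarrow> 'g) \<Rightarrow> 's form" where
  "sigma_N S p \<omega> u v =
     pair_d_right S p u v - pair_d_left S p u v + ext_d S (form0 (\<lambda>s. \<omega> (u s) (v s)))"

definition current_ext_space :: "'s manifold \<Rightarrow> (('s \<Rightarrow> 'g::real_vector) \<times> 's form) set" where
  "current_ext_space S = C_inf_map S \<times> Omega S 1"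

definition current_ext_bracket ::
  "('g \<Rightarrow> 'g \<Rightarrow> 'g) \<Rightarrow> (('s \<Rightarrow> 'g) \<Rightarrow> ('s \<Rightarrow> 'g) \<Rightarrow> 's form) \<Rightarrow>
    ('s \<Rightarrow> 'g) \<times> 's form \<Rightarrow> ('s \<Rightarrow> 'g) \<times> 's form \<Rightarrow> ('s \<Rightarrow> 'g) \<times> 's form" where
  "current_ext_bracket br \<sigma> = (\<lambda>(u, \<beta>) (v, \<beta>'). (\<lambda>s. br (u s) (v s), \<sigma> u v))"

end

theory Submission
  imports Defs
begin

text \<open>Write \<open>L(x)\<close>, \<open>I(y)\<close>, \<open>c\<^sub>1\<close>, \<open>c\<^sub>2\<close> for the elements of the cone extension. An element of total degree 0
is a sum of terms \<open>f \<otimes> L(x)\<close>, \<open>\<phi> \<otimes> I(y)\<close>, \<open>\<beta> \<otimes> c\<^sub>1\<close>, \<open>\<gamma> \<otimes> c\<^sub>2\<close> with \<open>f\<close>, \<open>\<phi>\<close> and \<open>\<beta>\<close>, \<open>\<gamma>\<close> of degree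
0, 1, 1, 2. The \<open>L\<close>-component of \<open>dt = 0\<close> says that the \<open>I\<close>-part of \<open>t\<close> is the differential of its
\<open>L\<close>-part, the \<open>c\<^sub>1\<close>-component says \<open>\<gamma> = - d\<beta>\<close>, and the other two components follow because \<open>d d = 0\<close>.
Hence a closed \<open>t\<close> is the same as a pair of an element of \<open>C\<^sup>\<infinity>(S) \<otimes> g\<close> and a 1-form \<open>\<beta>\<close>, and the closed
elements are spanned by
\<open>f \<otimes> L(x) + df \<otimes> I(x)\<close> (\<open>current_tensor\<close>) and \<open>\<beta> \<otimes> c\<^sub>1 - d\<beta> \<otimes> c\<^sub>2\<close> (\<open>central_tensor\<close>).
The latter are central. In the bracket of two of the former, with \<open>f, x\<close> and \<open>g, y\<close>, the \<open>L\<close>-part is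
\<open>f g \<otimes> [x, y]\<close> and the coefficient of \<open>c\<^sub>1\<close> is
\<open>\<alpha>(x) y f dg - \<alpha>(y) x g df = p(x, y) (f dg - g df) + \<omega>(x, y) d(f g)\<close>, which is the cocycle \<open>\<sigma>\<^sub>N\<close>
(\<open>mult_current_current\<close>, \<open>sigma_N_current\<close>).

Three points carry this computation over to the algebraic tensor product.

\<^item> Bracket and differential are given by formulas on representations as sums of homogeneous pure tensors.
  They are independent of the representation because the formulas, Koszul signs included, are the
  restrictions of maps bilinear in the factors, and a tensor is a functional on bilinear forms
  (locale \<open>dg_tensor\<close>).

\<^item> The equation \<open>dt = 0\<close> is solved without coordinates: a map \<open>h\<close> of degree -1 is exhibited for which
  \<open>t - h(dt)\<close> lies in the span of the generators for all \<open>t\<close> of degree 0. For closed \<open>t\<close> this element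
  is \<open>t\<close> itself (\<open>SA_eq_span\<close>).

\<^item> The isomorphism is described by its graph, the span of the pairs of corresponding generators. That
  this relation is injective in both directions follows from the value of a tensor on the bilinear
  forms of rank one: these values can be read off from the function and the 1-form, and they
  determine the tensor (\<open>rank_one_form_on_graph\<close>, \<open>rank_one_forms_separate_tensors\<close>).

The Lie algebra axioms are verified in the central extension, where the Jacobi identity is the cocycle
identity of \<open>\<sigma>\<^sub>N\<close> (\<open>sigma_N_cocycle\<close>), and transported along the bijection.\<close>

section \<open>Linear algebra in spaces without a chosen basis\<close>

text \<open>A choice of basis of the subspace, extended to the whole space. It serves to replace the exterior
derivative, which is linear only on forms with smooth values, by a map that is linear everywhere.\<close>

lemma linear_extension_from_subspace:
  fixes f :: "'a::real_vector \<Rightarrow> 'b::real_vector"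
  assumes W: "subspace W"
    and add: "\<And>x y. x \<in> W \<Longrightarrow> y \<in> W \<Longrightarrow> f (x + y) = f x + f y"
    and scale: "\<And>c x. x \<in> W \<Longrightarrow> f (c *\<^sub>R x) = c *\<^sub>R f x"
  obtains g where "linear g" "\<And>x. x \<in> W \<Longrightarrow> g x = f x"
proof -
  obtain B where B: "B \<subseteq> W" "independent B" "W \<subseteq> span B"
    using basis_exists [of W] by metis
  obtain g where g: "linear g" "\<And>x. x \<in> B \<Longrightarrow> g x = f x"
    using linear_independent_extend [OF B(2), of f] by metis
  have f0: "f 0 = 0"
    using scale [OF subspace_0 [OF W], of 0] by simp
  have "x \<in> W \<and> g x = f x" if "x \<in> span B" for x
    using that
  proof (induction rule: span_induct_alt)
    case base
    then show ?case
      using f0 linear_0 [OF g(1)] subspace_0 [OF W] by simp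
  next
    case (step c x y)
    then have x: "x \<in> W" "c *\<^sub>R x \<in> W" and y: "y \<in> W"
      using B(1) subspace_scale [OF W] by blast+
    have "f (c *\<^sub>R x + y) = c *\<^sub>R f x + f y"
      by (simp only: add [OF x(2) y] scale [OF x(1)])
    moreover have "g (c *\<^sub>R x + y) = c *\<^sub>R f x + f y"
      using step g(2) by (simp only: linear_add [OF g(1)] linear_scale [OF g(1)])
    ultimately show ?case
      using subspace_add [OF W x(2) y] by simp
  qed
  then show thesis
    using B(3) by (intro that [OF g(1)]) blast
qed

text \<open>The coordinate functionals of a fixed Hamel basis. They are linear on the whole space, so that
no choice of complements is needed when finite-dimensional subspaces vary.\<close>

definition coord :: "'a::real_vector \<Rightarrow> 'a \<Rightarrow> real" where
  "coord b x = representation (extend_basis {}) x b"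

lemma linear_coord: "linear (coord b)"
proof -
  have "independent (extend_basis {} :: 'a set)" "\<And>x. x \<in> span (extend_basis {} :: 'a set)"
    by (simp_all add: independent_extend_basis independent_empty)
  from representation_add [OF this(1) this(2) this(2)] representation_scale [OF this(1) this(2)]
  show ?thesis
    by (intro linearI) (simp_all only: coord_def real_scaleR_def)
qed

lemma finite_coord: "finite {b. coord b x \<noteq> 0}"
  unfolding coord_def by (rule finite_representation)

lemma coord_expansion:
  assumes "finite D" "{b. coord b x \<noteq> 0} \<subseteq> D"
  shows "(\<Sum>b\<in>D. coord b x *\<^sub>R b) = x"
proof -
  have "(\<Sum>b\<in>D. coord b x *\<^sub>R b) = (\<Sum>b | coord b x \<noteq> 0. coord b x *\<^sub>R b)"
    using assms by (intro sum.mono_neutral_right) auto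
  also have "\<dots> = x"
    unfolding coord_def
    by (rule sum_nonzero_representation_eq) (simp_all add: independent_extend_basis independent_empty)
  finally show ?thesis .
qed

lemma linear_functionals_separate:
  fixes x :: "'a::real_vector"
  assumes "\<And>l :: 'a \<Rightarrow> real. linear l \<Longrightarrow> l x = 0"
  shows "x = 0"
proof -
  have "{b. coord b x \<noteq> 0} \<subseteq> {}"
    using assms [OF linear_coord] by simp
  from coord_expansion [OF _ this] show ?thesis by simp
qed

text \<open>When two spaces are spanned by corresponding generators, the span of the pairs of generators is a more
convenient description of an isomorphism than a function, which would have to be shown well defined.
The axioms of a Lie algebra for \<open>V\<close> are those of \<open>W\<close>, read through the bijection.\<close>

lemma lie_isomorphic_if_graph:
  assumes W: "lie_algebra W br'"
    and R: "subspace R" "V = fst ` R" "W = snd ` R"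
    and inj: "\<And>w. (0, w) \<in> R \<Longrightarrow> w = 0" "\<And>t. (t, 0) \<in> R \<Longrightarrow> t = 0"
    and br: "\<And>t w t' w'. (t, w) \<in> R \<Longrightarrow> (t', w') \<in> R \<Longrightarrow> (br t t', br' w w') \<in> R"
  shows "lie_isomorphic V br W br'"
proof -
  have add: "(t + t', w + w') \<in> R" if "(t, w) \<in> R" "(t', w') \<in> R" for t w t' w'
    using subspace_add [OF R(1) that] by simp
  have scale: "(c *\<^sub>R t, c *\<^sub>R w) \<in> R" if "(t, w) \<in> R" for c t w
    using subspace_scale [OF R(1) that] by simp
  have diff: "(t - t', w - w') \<in> R" if "(t, w) \<in> R" "(t', w') \<in> R" for t w t' w'
    using subspace_diff [OF R(1) that] by simp
  have uniq: "w = w'" if "(t, w) \<in> R" "(t, w') \<in> R" for t w w'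
    using diff [OF that] inj(1) by (metis diff_self eq_iff_diff_eq_0)
  have uniq': "t = t'" if "(t, w) \<in> R" "(t', w) \<in> R" for t t' w
    using diff [OF that] inj(2) by (metis diff_self eq_iff_diff_eq_0)
  define F where "F t = (THE w. (t, w) \<in> R)" for t
  have F: "F t = w" if "(t, w) \<in> R" for t w
    unfolding F_def using uniq that by blast
  have FR: "(t, F t) \<in> R" if "t \<in> V" for t
    using that F R(2) by force
  have V: "t \<in> V" if "(t, w) \<in> R" for t w
    using that R(2) by force
  have FW: "F t \<in> W" if "t \<in> V" for t
    using FR [OF that] R(3) by force
  have injF: "t = t'" if "t \<in> V" "t' \<in> V" "F t = F t'" for t t'
    using FR [OF that(1)] FR [OF that(2)] that(3) uniq' by metis
  have Fadd: "t + t' \<in> V" "F (t + t') = F t + F t'" if "t \<in> V" "t' \<in> V" for t t'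
    using add [OF FR FR] that F V by blast+
  have Fscale: "c *\<^sub>R t \<in> V" "F (c *\<^sub>R t) = c *\<^sub>R F t" if "t \<in> V" for c t
    using scale [OF FR] that F V by blast+
  have Fbr: "br t t' \<in> V" "F (br t t') = br' (F t) (F t')" if "t \<in> V" "t' \<in> V" for t t'
    using br [OF FR FR] that F V by blast+
  have bij: "bij_betw F V W"
    unfolding bij_betw_def
  proof (intro conjI inj_onI injF)
    show "F ` V = W"
      using FW F V R(3) by (fastforce simp: image_iff)
  qed
  have R0: "(0, 0) \<in> R"
    using subspace_0 [OF R(1)] by (simp add: zero_prod_def)
  have "lie_algebra V br"
    unfolding lie_algebra_def
  proof (intro conjI ballI allI)
    show "subspace V"
      using V R0 Fadd(1) Fscale(1) by (auto simp: subspace_def)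
    show "br x y \<in> V" if "x \<in> V" "y \<in> V" for x y
      using that by (rule Fbr)
    show "br (x + y) z = br x z + br y z" "br z (x + y) = br z x + br z y"
      if "x \<in> V" "y \<in> V" "z \<in> V" for x y z
      using W that FW
      by (intro injF; simp add: Fbr Fadd lie_algebra_def)+
    show "br (c *\<^sub>R x) y = c *\<^sub>R br x y" "br x (c *\<^sub>R y) = c *\<^sub>R br x y"
      if "x \<in> V" "y \<in> V" for c x y
      using W that FW
      by (intro injF; simp add: Fbr Fscale lie_algebra_def)+
    have F0: "0 \<in> V" "F 0 = 0"
      using V R0 F by blast+
    show "br x x = 0" if "x \<in> V" for x
      using W that FW F0 by (intro injF; simp add: Fbr lie_algebra_def)
    show "br x (br y z) + br y (br z x) + br z (br x y) = 0"
      if "x \<in> V" "y \<in> V" "z \<in> V" for x y z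
      using W that FW F0 by (intro injF; simp add: Fbr Fadd lie_algebra_def)
  qed
  with W bij show ?thesis
    unfolding lie_isomorphic_def
    by (intro conjI exI [of _ F] ballI allI) (assumption | rule Fadd Fscale Fbr)+
qed


section \<open>The tensor product\<close>

lemma bilinear_tensor: "bilinear ((\<otimes>) :: 'a::real_vector \<Rightarrow> 'b::real_vector \<Rightarrow> _)"
  unfolding bilinear_def
  by (intro conjI allI linearI ext)
    (simp_all add: tensor_def scaleR_fun_def bilinear_ladd bilinear_radd bilinear_lmul bilinear_rmul)

lemmas tensor_add_left = bilinear_ladd [OF bilinear_tensor]
  and tensor_add_right = bilinear_radd [OF bilinear_tensor]
  and tensor_scale_left = bilinear_lmul [OF bilinear_tensor]
  and tensor_scale_right = bilinear_rmul [OF bilinear_tensor]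
  and tensor_zero_left [simp] = bilinear_lzero [OF bilinear_tensor]
  and tensor_zero_right [simp] = bilinear_rzero [OF bilinear_tensor]
  and tensor_neg_right = bilinear_rneg [OF bilinear_tensor]
  and tensor_diff_left = bilinear_lsub [OF bilinear_tensor]

text \<open>Expanding the second factor in a Hamel basis turns \<open>t B\<close> into a finite sum of the values of \<open>t\<close> at the
rank one forms \<open>B(_, b) \<cdot> coord b\<close>. The expansion holds over all sufficiently large finite sets of basis
vectors, and in this form it is stable under sums of tensors.\<close>

lemma rank_one_forms_separate_tensors:
  fixes t :: "('f::real_vector, 'a::real_vector) tensor"
  assumes t: "t \<in> span {\<phi> \<otimes> a |\<phi> a. True}"
    and zero: "\<And>m l. linear m \<Longrightarrow> linear l \<Longrightarrow> t (\<lambda>\<phi> a. m \<phi> * l a) = 0"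
  shows "t = 0"
proof -
  have rank1: "bilinear (\<lambda>\<phi> a. B \<phi> b * coord c a)" if "bilinear B" for B :: "'f \<Rightarrow> 'a \<Rightarrow> real" and b c
    unfolding bilinear_def
    by (intro conjI allI linearI)
      (simp_all add: linear_add [OF linear_coord] linear_scale [OF linear_coord]
        bilinear_ladd [OF that] bilinear_lmul [OF that] distrib_left distrib_right)
  have "\<exists>D. finite D \<and> (\<forall>D'. finite D' \<and> D \<subseteq> D' \<longrightarrow>
      (\<forall>B. bilinear B \<longrightarrow> t B = (\<Sum>b\<in>D'. t (\<lambda>\<phi> a. B \<phi> b * coord b a))))"
    using t
  proof (induction rule: span_induct_alt)
    case base
    show ?case by (intro exI [of _ "{}"]) simp
  next
    case (step c x y)
    from step(1) obtain \<phi> a where x: "x = \<phi> \<otimes> a"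
      by auto
    from step(2) obtain D where D: "finite D"
      and y: "\<And>D' B. finite D' \<Longrightarrow> D \<subseteq> D' \<Longrightarrow> bilinear B \<Longrightarrow> y B = (\<Sum>b\<in>D'. y (\<lambda>\<phi> a. B \<phi> b * coord b a))"
      by auto
    have "(c *\<^sub>R x + y) B = (\<Sum>b\<in>D'. (c *\<^sub>R x + y) (\<lambda>\<phi> a. B \<phi> b * coord b a))"
      if D': "finite D'" "D \<union> {b. coord b a \<noteq> 0} \<subseteq> D'" and B: "bilinear B" for D' B
    proof -
      have "B \<phi> a = B \<phi> (\<Sum>b\<in>D'. coord b a *\<^sub>R b)"
        using D' by (simp add: coord_expansion)
      also have "\<dots> = (\<Sum>b\<in>D'. coord b a * B \<phi> b)"
        using B by (simp add: bilinear_def linear_sum linear_scale)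
      finally have "B \<phi> a = (\<Sum>b\<in>D'. coord b a * B \<phi> b)" .
      moreover have pure: "(\<phi> \<otimes> a) B = B \<phi> a" "\<And>b. (\<phi> \<otimes> a) (\<lambda>\<phi> a. B \<phi> b * coord b a) = B \<phi> b * coord b a"
        unfolding tensor_def by (simp_all only: B rank1 [OF B] if_True)
      moreover have "y B = (\<Sum>b\<in>D'. y (\<lambda>\<phi> a. B \<phi> b * coord b a))"
        using D' B by (intro y) auto
      ultimately show ?thesis
        by (simp add: x pure scaleR_fun_def sum.distrib sum_distrib_left mult.commute)
    qed
    then show ?case
      using D finite_coord by (intro exI [of _ "D \<union> {b. coord b a \<noteq> 0}"] conjI allI impI) auto
  qed
  then obtain D where D: "\<And>B. bilinear B \<Longrightarrow> t B = (\<Sum>b\<in>D. t (\<lambda>\<phi> a. B \<phi> b * coord b a))"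
    by auto
  have "t B = 0" if "bilinear B" for B
  proof -
    have "t (\<lambda>\<phi> a. B \<phi> b * coord b a) = 0" for b
      using that by (intro zero linear_coord) (simp add: bilinear_def)
    then show ?thesis
      by (subst D [OF that]) simp
  qed
  moreover have "t B = 0" if "\<not> bilinear B" for B
    using t
  proof (induction rule: span_induct_alt)
    case (step c x y)
    from step(1) obtain \<phi> a where "x = \<phi> \<otimes> a" by auto
    with step(2) that show ?case
      by (simp add: tensor_def scaleR_fun_def)
  qed simp
  ultimately show ?thesis
    by (auto simp: fun_eq_iff)
qed

text \<open>The universal property: \<open>tlift N\<close> is the linear map on tensors that a bilinear map \<open>N\<close> with values in a
function space induces. It is defined by evaluating the tensor at the components of \<open>N\<close>, so it does not
refer to a representation of the tensor.\<close>

definition tlift :: "('f \<Rightarrow> 'a \<Rightarrow> 'z \<Rightarrow> real) \<Rightarrow> ('f, 'a) tensor \<Rightarrow> 'z \<Rightarrow> real" where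
  "tlift N t = (\<lambda>z. t (\<lambda>\<phi> a. N \<phi> a z))"

lemma linear_tlift: "linear (tlift N)"
  by (simp add: linear_iff tlift_def scaleR_fun_def plus_fun_def)

lemma tlift_tensor:
  assumes "bilinear N"
  shows "tlift N (\<phi> \<otimes> a) = N \<phi> a"
proof -
  have "bilinear (\<lambda>\<phi> a. N \<phi> a z)" for z
    using assms by (simp add: bilinear_def linear_iff scaleR_fun_def)
  then show ?thesis
    by (simp add: tlift_def tensor_def)
qed

lemma linear_sum_list:
  assumes "linear L"
  shows "L (sum_list (map f xs)) = (\<Sum>x\<leftarrow>xs. L (f x))"
  by (induction xs) (simp_all add: linear_0 [OF assms] linear_add [OF assms])

lemma linear_sum_list_parametric:
  fixes h :: "'v::real_vector \<Rightarrow> 'x \<Rightarrow> 'w::real_vector"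
  assumes "\<And>x. linear (\<lambda>v. h v x)"
  shows "linear (\<lambda>v. \<Sum>x\<leftarrow>xs. h v x)"
proof (induction xs)
  case Nil
  show ?case by (simp add: linear_iff)
next
  case (Cons x xs)
  then show ?case
    using linear_compose_add [OF assms [of x] Cons] by simp
qed

lemma tlift_sum_list:
  assumes "bilinear N"
  shows "tlift N (\<Sum>(i, \<phi>, j, a)\<leftarrow>r. \<phi> \<otimes> a) = (\<Sum>(i, \<phi>, j, a)\<leftarrow>r. N \<phi> a)"
  unfolding linear_sum_list [OF linear_tlift] by (simp add: split_def tlift_tensor [OF assms])

section \<open>Differential and product on a tensor product\<close>

definition homogeneous_tensors :: "('f::real_vector) dg \<Rightarrow> ('a::real_vector) dg \<Rightarrow> ('f, 'a) tensor set" where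
  "homogeneous_tensors F A = {\<phi> \<otimes> a |\<phi> a i j. \<phi> \<in> part F i \<and> a \<in> part A j}"

lemma the_value_of_representations:
  assumes "\<And>r. P r \<Longrightarrow> f r = w" "P r\<^sub>0"
  shows "(THE w. \<exists>r. P r \<and> w = f r) = w"
  using assms by (intro the_equality) auto

lemma the_value_of_representations2:
  assumes "\<And>r r'. P r \<Longrightarrow> Q r' \<Longrightarrow> f r r' = w" "P r\<^sub>0" "Q r\<^sub>0'"
  shows "(THE w. \<exists>r r'. P r \<and> Q r' \<and> w = f r r') = w"
  using assms by (intro the_equality) auto

lemma sum_list_cong_set: "(\<And>x. x \<in> set xs \<Longrightarrow> f x = g x) \<Longrightarrow> sum_list (map f xs) = sum_list (map g xs)"
  by (metis map_eq_conv)

text \<open>The map \<open>D\<close> is a linear extension of the differential of \<open>F\<close> from homogeneous elements to the ambient type,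
and \<open>sF\<close>, \<open>sA\<close> are linear maps that multiply elements of degree \<open>i\<close> by \<open>(-1)\<^sup>i\<close>. With these maps the
Koszul signs, which refer to the degrees in a representation, become bilinear operations on the
factors.\<close>

locale dg_tensor =
  fixes F :: "('f::real_vector) dg" and A :: "('a::real_vector) dg"
    and D sF :: "'f \<Rightarrow> 'f" and sA :: "'a \<Rightarrow> 'a"
  assumes subspace_part: "\<And>i. subspace (part F i)"
    and linear: "linear D" "linear sF" "linear sA" "linear (diff A)"
    and bilinear: "bilinear (mult F)" "bilinear (mult A)"
    and D: "\<And>i \<phi>. \<phi> \<in> part F i \<Longrightarrow> diff F \<phi> = D \<phi>"
    and sF: "\<And>i \<phi>. \<phi> \<in> part F i \<Longrightarrow> sF \<phi> = ksign i *\<^sub>R \<phi>"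
    and sA: "\<And>j a. a \<in> part A j \<Longrightarrow> sA a = ksign j *\<^sub>R a"
begin

abbreviation "tensors \<equiv> span (homogeneous_tensors F A)"

lemma tensor_rep_exists:
  assumes "t \<in> tensors"
  obtains r where "tensor_rep F A r t"
proof -
  have "\<exists>r. tensor_rep F A r t"
    using assms
  proof (induction rule: span_induct_alt)
    case base
    have "tensor_rep F A [] 0" by (simp add: tensor_rep_def)
    then show ?case by blast
  next
    case (step c x y)
    then obtain r \<phi> a i j where "tensor_rep F A r y" "x = \<phi> \<otimes> a" "\<phi> \<in> part F i" "a \<in> part A j"
      unfolding homogeneous_tensors_def by blast
    then have "tensor_rep F A ((i, c *\<^sub>R \<phi>, j, a) # r) (c *\<^sub>R x + y)"
      using subspace_part by (auto simp: tensor_rep_def tensor_scale_left subspace_scale)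
    then show ?case by blast
  qed
  then show thesis using that by blast
qed

lemma pure_in_H: "\<phi> \<in> part F i \<Longrightarrow> a \<in> part A j \<Longrightarrow> \<phi> \<otimes> a \<in> tensors"
  by (intro span_base) (auto simp: homogeneous_tensors_def)

definition diff_kernel :: "'f \<Rightarrow> 'a \<Rightarrow> ('f, 'a) tensor" where
  "diff_kernel \<phi> a = D \<phi> \<otimes> a + sF \<phi> \<otimes> diff A a"

lemma bilinear_diff_kernel: "bilinear diff_kernel"
  unfolding bilinear_def diff_kernel_def
  by (intro conjI allI linearI)
    (simp_all add: linear_add [OF linear(1)] linear_add [OF linear(2)] linear_add [OF linear(4)]
      linear_scale [OF linear(1)] linear_scale [OF linear(2)] linear_scale [OF linear(4)]
      tensor_add_left tensor_add_right tensor_scale_left tensor_scale_right algebra_simps)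

lemma diff_eq_tlift:
  assumes t: "t \<in> tensors"
  shows "diff (tensor_dg F A) t = tlift diff_kernel t"
proof -
  have "(\<Sum>(i, \<phi>, j, a)\<leftarrow>r. diff F \<phi> \<otimes> a + ksign i *\<^sub>R (\<phi> \<otimes> diff A a)) = tlift diff_kernel t"
    if r: "tensor_rep F A r t" for r
  proof -
    have "(\<Sum>(i, \<phi>, j, a)\<leftarrow>r. diff F \<phi> \<otimes> a + ksign i *\<^sub>R (\<phi> \<otimes> diff A a)) = (\<Sum>(i, \<phi>, j, a)\<leftarrow>r. diff_kernel \<phi> a)"
    proof (rule sum_list_cong_set, clarify)
      fix i \<phi> j a assume "(i, \<phi>, j, a) \<in> set r"
      then have "\<phi> \<in> part F i"
        using r by (auto simp: tensor_rep_def)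
      then show "diff F \<phi> \<otimes> a + ksign i *\<^sub>R (\<phi> \<otimes> diff A a) = diff_kernel \<phi> a"
        by (simp add: diff_kernel_def D sF tensor_scale_left)
    qed
    moreover have "t = (\<Sum>(i, \<phi>, j, a)\<leftarrow>r. \<phi> \<otimes> a)"
      using r by (simp only: tensor_rep_def)
    ultimately show ?thesis
      using tlift_sum_list [OF bilinear_diff_kernel, of r] by (simp only:)
  qed
  moreover obtain r where "tensor_rep F A r t"
    using tensor_rep_exists [OF t] .
  ultimately show ?thesis
    unfolding tensor_dg_def dg.simps by (rule the_value_of_representations)
qed

lemma diff_linear_comb:
  assumes "t \<in> tensors" "t' \<in> tensors"
  shows "diff (tensor_dg F A) (c *\<^sub>R t + t') = c *\<^sub>R diff (tensor_dg F A) t + diff (tensor_dg F A) t'"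
proof -
  have "c *\<^sub>R t + t' \<in> tensors"
    using assms by (intro span_add span_scale)
  then show ?thesis
    by (simp only: diff_eq_tlift assms linear_add [OF linear_tlift] linear_scale [OF linear_tlift])
qed

lemma diff_pure:
  assumes "\<phi> \<in> part F i" "a \<in> part A j"
  shows "diff (tensor_dg F A) (\<phi> \<otimes> a) = diff F \<phi> \<otimes> a + ksign i *\<^sub>R (\<phi> \<otimes> diff A a)"
  by (simp only: diff_eq_tlift [OF pure_in_H [OF assms]] tlift_tensor [OF bilinear_diff_kernel]
      diff_kernel_def D [OF assms(1)] sF [OF assms(1)] tensor_scale_left)

text \<open>The elements \<open>(\<psi> + sF \<psi>) / 2\<close> and \<open>(\<psi> - sF \<psi>) / 2\<close> are the parts of \<open>\<psi>\<close> of even and odd degree; the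
sign \<open>(-1)\<^bsup>|a| |\<psi>|\<^esup>\<close> is trivial on the first and equals the sign of \<open>a\<close> on the second.\<close>

definition mult_kernel :: "'f \<Rightarrow> 'a \<Rightarrow> 'f \<Rightarrow> 'a \<Rightarrow> ('f, 'a) tensor" where
  "mult_kernel \<phi> a \<psi> b = (1/2) *\<^sub>R (mult F \<phi> (\<psi> + sF \<psi>) \<otimes> mult A a b + mult F \<phi> (\<psi> - sF \<psi>) \<otimes> mult A (sA a) b)"

lemmas mult_kernel_simps = mult_kernel_def
  bilinear_ladd [OF bilinear(1)] bilinear_radd [OF bilinear(1)] bilinear_lmul [OF bilinear(1)] bilinear_rmul [OF bilinear(1)]
  bilinear_ladd [OF bilinear(2)] bilinear_radd [OF bilinear(2)] bilinear_lmul [OF bilinear(2)] bilinear_rmul [OF bilinear(2)]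
  bilinear_rsub [OF bilinear(1)]
  linear_add [OF linear(2)] linear_scale [OF linear(2)] linear_add [OF linear(3)] linear_scale [OF linear(3)]
  tensor_add_left tensor_add_right tensor_scale_left tensor_scale_right tensor_diff_left algebra_simps

lemma linear_mult_kernel:
  "linear (\<lambda>\<phi>. mult_kernel \<phi> a \<psi> b)" "linear (\<lambda>a. mult_kernel \<phi> a \<psi> b)"
  "linear (\<lambda>\<psi>. mult_kernel \<phi> a \<psi> b)" "linear (\<lambda>b. mult_kernel \<phi> a \<psi> b)"
  by (intro linearI; simp add: mult_kernel_simps)+

lemma bilinear_mult_kernel:
  "bilinear (mult_kernel \<phi> a)" "bilinear (\<lambda>\<phi> a. mult_kernel \<phi> a \<psi> b)"
  unfolding bilinear_def by (intro conjI allI linear_mult_kernel)+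

lemma mult_kernel_pure:
  assumes "\<psi> \<in> part F k" "a \<in> part A j"
  shows "mult_kernel \<phi> a \<psi> b = ksign (j * k) *\<^sub>R (mult F \<phi> \<psi> \<otimes> mult A a b)"
proof (cases "even k")
  case True
  then have "sF \<psi> = \<psi>" "ksign (j * k) = 1"
    using sF [OF assms(1)] by (simp_all add: ksign_def)
  then show ?thesis
    by (simp add: mult_kernel_def bilinear_rzero [OF bilinear(1)] bilinear_rmul [OF bilinear(1)]
        tensor_scale_left flip: scaleR_2)
next
  case False
  then have "sF \<psi> = - \<psi>" "ksign (j * k) = ksign j"
    using sF [OF assms(1)] by (simp_all add: ksign_def)
  then show ?thesis
    by (simp add: mult_kernel_def bilinear_rzero [OF bilinear(1)] bilinear_rmul [OF bilinear(1)]
        tensor_scale_left sA [OF assms(2)] bilinear_lmul [OF bilinear(2)] tensor_scale_right flip: scaleR_2)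
qed

text \<open>On sums of pure tensors \<open>tlift N t'\<close> is linear in \<open>N\<close>; an arbitrary functional \<open>t'\<close> on bilinear forms
would not have this property.\<close>

lemma bilinear_tlift_mult_kernel:
  assumes "t' \<in> tensors"
  shows "bilinear (\<lambda>\<phi> a. tlift (mult_kernel \<phi> a) t')"
proof -
  obtain r where "tensor_rep F A r t'"
    using tensor_rep_exists [OF assms] .
  then have "tlift (mult_kernel \<phi> a) t' = (\<Sum>(i, \<psi>, j, b)\<leftarrow>r. mult_kernel \<phi> a \<psi> b)" for \<phi> a
    by (simp only: tensor_rep_def tlift_sum_list [OF bilinear_mult_kernel(1)])
  then show ?thesis
    unfolding bilinear_def by (simp only: split_def linear_sum_list_parametric linear_mult_kernel simp_thms)
qed

lemma mult_eq_tlift: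
  assumes t: "t \<in> tensors" and t': "t' \<in> tensors"
  shows "mult (tensor_dg F A) t t' = tlift (\<lambda>\<phi> a. tlift (mult_kernel \<phi> a) t') t"
proof -
  have "(\<Sum>(i, \<phi>, j, a)\<leftarrow>r. \<Sum>(k, \<psi>, l, b)\<leftarrow>r'. ksign (j * k) *\<^sub>R (mult F \<phi> \<psi> \<otimes> mult A a b))
      = tlift (\<lambda>\<phi> a. tlift (mult_kernel \<phi> a) t') t"
    if r: "tensor_rep F A r t" "tensor_rep F A r' t'" for r r'
  proof -
    have "(\<Sum>(i, \<phi>, j, a)\<leftarrow>r. \<Sum>(k, \<psi>, l, b)\<leftarrow>r'. ksign (j * k) *\<^sub>R (mult F \<phi> \<psi> \<otimes> mult A a b))
      = (\<Sum>(i, \<phi>, j, a)\<leftarrow>r. \<Sum>(k, \<psi>, l, b)\<leftarrow>r'. mult_kernel \<phi> a \<psi> b)"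
    proof (rule sum_list_cong_set, clarify)
      fix i \<phi> j a
      assume "(i, \<phi>, j, a) \<in> set r"
      then have a: "a \<in> part A j"
        using r(1) by (auto simp: tensor_rep_def)
      show "(\<Sum>(k, \<psi>, l, b)\<leftarrow>r'. ksign (j * k) *\<^sub>R (mult F \<phi> \<psi> \<otimes> mult A a b))
          = (\<Sum>(k, \<psi>, l, b)\<leftarrow>r'. mult_kernel \<phi> a \<psi> b)"
      proof (rule sum_list_cong_set, clarify)
        fix k \<psi> l b
        assume "(k, \<psi>, l, b) \<in> set r'"
        then have "\<psi> \<in> part F k"
          using r(2) by (auto simp: tensor_rep_def)
        then show "ksign (j * k) *\<^sub>R (mult F \<phi> \<psi> \<otimes> mult A a b) = mult_kernel \<phi> a \<psi> b"
          using a by (rule mult_kernel_pure [symmetric])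
      qed
    qed
    also have "\<dots> = tlift (\<lambda>\<phi> a. tlift (mult_kernel \<phi> a) t') t"
    proof -
      have "t = (\<Sum>(i, \<phi>, j, a)\<leftarrow>r. \<phi> \<otimes> a)" "t' = (\<Sum>(k, \<psi>, l, b)\<leftarrow>r'. \<psi> \<otimes> b)"
        using r by (simp_all only: tensor_rep_def)
      then show ?thesis
        using tlift_sum_list [OF bilinear_tlift_mult_kernel [OF t'], of r]
        by (simp only: tlift_sum_list [OF bilinear_mult_kernel(1)])
    qed
    finally show ?thesis .
  qed
  moreover obtain r r' where "tensor_rep F A r t" "tensor_rep F A r' t'"
    using tensor_rep_exists [OF t] tensor_rep_exists [OF t'] by metis
  ultimately show ?thesis
    unfolding tensor_dg_def dg.simps by (rule the_value_of_representations2)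
qed

lemma mult_linear_comb_left:
  assumes "t \<in> tensors" "t' \<in> tensors" "t'' \<in> tensors"
  shows "mult (tensor_dg F A) (c *\<^sub>R t + t') t''
    = c *\<^sub>R mult (tensor_dg F A) t t'' + mult (tensor_dg F A) t' t''"
proof -
  have "c *\<^sub>R t + t' \<in> tensors"
    using assms by (intro span_add span_scale)
  then show ?thesis
    by (simp only: mult_eq_tlift assms linear_add [OF linear_tlift] linear_scale [OF linear_tlift])
qed

text \<open>The formula \<open>mult_eq_tlift\<close> exhibits linearity in the left factor only; for the right factor a
representation of the left one is fixed.\<close>

lemma mult_linear_comb_right:
  assumes "t \<in> tensors" "t' \<in> tensors" "t'' \<in> tensors"
  shows "mult (tensor_dg F A) t'' (c *\<^sub>R t + t')
    = c *\<^sub>R mult (tensor_dg F A) t'' t + mult (tensor_dg F A) t'' t'"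
proof -
  obtain r where "tensor_rep F A r t''"
    using tensor_rep_exists [OF assms(3)] .
  then have r: "t'' = (\<Sum>(i, \<phi>, j, a)\<leftarrow>r. \<phi> \<otimes> a)"
    by (simp only: tensor_rep_def)
  define K where "K = (\<lambda>t. \<Sum>(i, \<phi>, j, a)\<leftarrow>r. tlift (mult_kernel \<phi> a) t)"
  have K: "mult (tensor_dg F A) t'' t = K t" if "t \<in> tensors" for t
    unfolding mult_eq_tlift [OF assms(3) that] K_def
    using tlift_sum_list [OF bilinear_tlift_mult_kernel [OF that], of r] by (simp only: r)
  have lin: "linear K"
    unfolding K_def split_def by (intro linear_sum_list_parametric linear_tlift)
  have "c *\<^sub>R t + t' \<in> tensors"
    using assms by (intro span_add span_scale)
  then show ?thesis
    by (simp only: K assms linear_add [OF lin] linear_scale [OF lin])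
qed

lemma mult_pure:
  assumes "\<phi> \<in> part F i" "a \<in> part A j" "\<psi> \<in> part F k" "b \<in> part A l"
  shows "mult (tensor_dg F A) (\<phi> \<otimes> a) (\<psi> \<otimes> b) = ksign (j * k) *\<^sub>R (mult F \<phi> \<psi> \<otimes> mult A a b)"
  by (simp only: mult_eq_tlift pure_in_H [OF assms(1,2)] pure_in_H [OF assms(3,4)]
      tlift_tensor [OF bilinear_tlift_mult_kernel] tlift_tensor [OF bilinear_mult_kernel(1)]
      tlift_tensor [OF bilinear_mult_kernel(2)]
      mult_kernel_pure [OF assms(3,2)])

end

section \<open>The algebra of smooth functions and its derivations\<close>

text \<open>A vector field maps functions to functions, and the rules for derivations match its arguments as
sums and products of functions. Automatic evaluation of these operations at points would destroy the
pattern, so it is requested explicitly where an equation is checked pointwise.\<close>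

lemmas fun_apply = plus_fun_apply times_fun_apply zero_fun_apply minus_apply uminus_apply
declare fun_apply [simp del]

lemma C_on_Suc_imp: "C_on n (Suc k) U f \<Longrightarrow> C_on n k U f"
proof (induction k arbitrary: f)
  case (Suc k)
  then show ?case by (metis C_on.simps(2))
qed simp

lemma C_on_const: "C_on n k U (\<lambda>x. c)"
proof (induction k arbitrary: c)
  case (Suc k)
  then show ?case
    by (auto intro!: exI [of _ "\<lambda>x. 0"])
qed simp

lemma C_on_SucE:
  assumes "C_on n (Suc k) U f" "i < n"
  obtains f' where "\<forall>x\<in>U. ((\<lambda>t. f (x(i := t))) has_real_derivative f' x) (at (x i))" "C_on n k U f'"
proof -
  from assms have "\<exists>f'. (\<forall>x\<in>U. ((\<lambda>t. f (x(i := t))) has_real_derivative f' x) (at (x i))) \<and> C_on n k U f'"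
    by simp
  then show thesis
    by (elim exE conjE) (rule that)
qed

lemma C_on_add: "C_on n k U f \<Longrightarrow> C_on n k U g \<Longrightarrow> C_on n k U (\<lambda>x. f x + g x)"
proof (induction k arbitrary: f g)
  case 0
  then show ?case by (simp add: continuous_map_add)
next
  case (Suc k)
  have "\<exists>h. (\<forall>x\<in>U. ((\<lambda>t. f (x(i := t)) + g (x(i := t))) has_real_derivative h x) (at (x i))) \<and> C_on n k U h"
    if i: "i < n" for i
  proof -
    obtain f' where f':
      "\<forall>x\<in>U. ((\<lambda>t. f (x(i := t))) has_real_derivative f' x) (at (x i))" "C_on n k U f'"
      by (rule C_on_SucE [OF Suc.prems(1) i]) (rule that)
    obtain g' where g':
      "\<forall>x\<in>U. ((\<lambda>t. g (x(i := t))) has_real_derivative g' x) (at (x i))" "C_on n k U g'"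
      by (rule C_on_SucE [OF Suc.prems(2) i]) (rule that)
    have "((\<lambda>t. f (x(i := t)) + g (x(i := t))) has_real_derivative f' x + g' x) (at (x i))"
      if "x \<in> U" for x
      using DERIV_add [OF bspec [OF f'(1) that] bspec [OF g'(1) that]] by simp
    moreover have "C_on n k U (\<lambda>x. f' x + g' x)"
      using f'(2) g'(2) by (rule Suc.IH)
    ultimately show ?thesis
      by (intro exI [of _ "\<lambda>x. f' x + g' x"] conjI ballI)
  qed
  with Suc.prems show ?case by (simp add: continuous_map_add)
qed

lemma C_on_mult: "C_on n k U f \<Longrightarrow> C_on n k U g \<Longrightarrow> C_on n k U (\<lambda>x. f x * g x)"
proof (induction k arbitrary: f g)
  case 0
  then show ?case by (simp add: continuous_map_real_mult)
next
  case (Suc k)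
  have "\<exists>h. (\<forall>x\<in>U. ((\<lambda>t. f (x(i := t)) * g (x(i := t))) has_real_derivative h x) (at (x i))) \<and> C_on n k U h"
    if i: "i < n" for i
  proof -
    obtain f' where f':
      "\<forall>x\<in>U. ((\<lambda>t. f (x(i := t))) has_real_derivative f' x) (at (x i))" "C_on n k U f'"
      by (rule C_on_SucE [OF Suc.prems(1) i]) (rule that)
    obtain g' where g':
      "\<forall>x\<in>U. ((\<lambda>t. g (x(i := t))) has_real_derivative g' x) (at (x i))" "C_on n k U g'"
      by (rule C_on_SucE [OF Suc.prems(2) i]) (rule that)
    have "((\<lambda>t. f (x(i := t)) * g (x(i := t))) has_real_derivative f' x * g x + g' x * f x) (at (x i))"
      if "x \<in> U" for x
      using DERIV_mult [OF bspec [OF f'(1) that] bspec [OF g'(1) that]] by simp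
    moreover have "C_on n k U (\<lambda>x. f' x * g x + g' x * f x)"
      by (intro C_on_add Suc.IH f'(2) g'(2) C_on_Suc_imp [OF Suc.prems(1)] C_on_Suc_imp [OF Suc.prems(2)])
    ultimately show ?thesis
      by (intro exI [of _ "\<lambda>x. f' x * g x + g' x * f x"] conjI ballI)
  qed
  with Suc.prems show ?case by (simp add: continuous_map_real_mult)
qed

lemma subspace_C_inf: "subspace (C_inf S)"
  unfolding subspace_def C_inf_def smooth_on_def
  by (auto simp: scaleR_fun_def fun_apply intro!: C_on_add C_on_mult C_on_const)

lemmas C_inf_0 = subspace_0 [OF subspace_C_inf]
  and C_inf_add = subspace_add [OF subspace_C_inf]
  and C_inf_diff = subspace_diff [OF subspace_C_inf]
  and C_inf_scale = subspace_scale [OF subspace_C_inf]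

lemma C_inf_mult: "f \<in> C_inf S \<Longrightarrow> g \<in> C_inf S \<Longrightarrow> f * g \<in> C_inf S"
  unfolding C_inf_def smooth_on_def by (auto simp: fun_apply intro!: C_on_mult)

lemma vf_C_inf: "X \<in> vfields S \<Longrightarrow> f \<in> C_inf S \<Longrightarrow> X f \<in> C_inf S"
  and vf_outside: "X \<in> vfields S \<Longrightarrow> f \<notin> C_inf S \<Longrightarrow> X f = 0"
  and vf_add: "X \<in> vfields S \<Longrightarrow> f \<in> C_inf S \<Longrightarrow> g \<in> C_inf S \<Longrightarrow> X (f + g) = X f + X g"
  and vf_mult: "X \<in> vfields S \<Longrightarrow> f \<in> C_inf S \<Longrightarrow> g \<in> C_inf S \<Longrightarrow> X (f * g) = f * X g + g * X f"
  and vf_scale: "X \<in> vfields S \<Longrightarrow> f \<in> C_inf S \<Longrightarrow> X (c *\<^sub>R f) = c *\<^sub>R X f"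
  unfolding vfields_def by blast+

lemma vf_0 [simp]: "X \<in> vfields S \<Longrightarrow> X 0 = 0"
  using vf_scale [OF _ C_inf_0, of X S 0] by simp

lemma vf_diff:
  assumes "X \<in> vfields S" "f \<in> C_inf S" "g \<in> C_inf S"
  shows "X (f - g) = X f - X g"
  using vf_add [OF assms(1) C_inf_diff [OF assms(2,3)] assms(3)] by (simp add: algebra_simps)

lemma vfieldsI:
  assumes "\<And>f. f \<in> C_inf S \<Longrightarrow> X f \<in> C_inf S" "\<And>f. f \<notin> C_inf S \<Longrightarrow> X f = 0"
    "\<And>f g. f \<in> C_inf S \<Longrightarrow> g \<in> C_inf S \<Longrightarrow> X (f + g) = X f + X g"
    "\<And>f g. f \<in> C_inf S \<Longrightarrow> g \<in> C_inf S \<Longrightarrow> X (f * g) = f * X g + g * X f"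
    "\<And>c f. f \<in> C_inf S \<Longrightarrow> X (c *\<^sub>R f) = c *\<^sub>R X f"
  shows "X \<in> vfields S"
  unfolding vfields_def using assms by blast

lemma scaleR_mult_fun: "c *\<^sub>R (f * g) = f * (c *\<^sub>R g :: 's \<Rightarrow> real)"
  by (simp add: fun_eq_iff scaleR_fun_def fun_apply)

lemma vfields_add: "X \<in> vfields S \<Longrightarrow> Y \<in> vfields S \<Longrightarrow> X + Y \<in> vfields S"
  by (rule vfieldsI) (simp_all add: plus_fun_apply [of X Y] scaleR_add_right vf_C_inf vf_outside vf_add vf_mult vf_scale C_inf_add algebra_simps)

lemma vfields_mult: "f \<in> C_inf S \<Longrightarrow> X \<in> vfields S \<Longrightarrow> (\<lambda>h. f * X h) \<in> vfields S"
  by (rule vfieldsI)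
    (simp_all add: vf_C_inf vf_outside vf_add vf_mult vf_scale C_inf_mult scaleR_mult_fun algebra_simps)

lemma vfields_bracket:
  assumes X: "X \<in> vfields S" and Y: "Y \<in> vfields S"
  shows "vf_bracket X Y \<in> vfields S"
proof (rule vfieldsI)
  fix f g assume f: "f \<in> C_inf S" and g: "g \<in> C_inf S"
  note [simp] = X Y f g vf_C_inf vf_add vf_mult C_inf_mult C_inf_add
  show "vf_bracket X Y (f * g) = f * vf_bracket X Y g + g * vf_bracket X Y f"
    unfolding vf_bracket_def vf_mult [OF X f g] vf_mult [OF Y f g]
    by (simp add: vf_add [OF X] vf_add [OF Y] vf_mult [OF X] vf_mult [OF Y] algebra_simps)
qed (use X Y in \<open>simp_all add: vf_bracket_def vf_C_inf vf_outside vf_add vf_scale C_inf_diff scaleR_diff_right\<close>)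

lemma vf_bracket_self: "vf_bracket X X = 0"
  by (simp add: vf_bracket_def fun_eq_iff fun_apply)


section \<open>Differential forms of low degree\<close>

lemma Omega_degree: "\<phi> \<in> Omega S k \<Longrightarrow> length Xs \<noteq> k \<Longrightarrow> \<phi> Xs = 0"
  and Omega_vfields: "\<phi> \<in> Omega S k \<Longrightarrow> \<not> set Xs \<subseteq> vfields S \<Longrightarrow> \<phi> Xs = 0"
  unfolding Omega_def by blast+

lemma Omega_C_inf: "\<phi> \<in> Omega S k \<Longrightarrow> \<phi> Xs \<in> C_inf S"
  by (cases "length Xs = k \<and> set Xs \<subseteq> vfields S") (auto simp: Omega_def C_inf_0)

lemma subspace_Omega: "subspace (Omega S k)"
proof -
  have "c *\<^sub>R \<phi> \<in> Omega S k" if "\<phi> \<in> Omega S k" for c \<phi>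
  proof -
    have [simp]: "(c *\<^sub>R \<phi>) Xs = c *\<^sub>R \<phi> Xs" for Xs
      by (simp add: scaleR_fun_def)
    show ?thesis
      using that by (simp add: Omega_def C_inf_scale scaleR_add_right scaleR_mult_fun)
  qed
  moreover have "\<phi> + \<psi> \<in> Omega S k" if "\<phi> \<in> Omega S k" "\<psi> \<in> Omega S k" for \<phi> \<psi>
    using that by (simp add: Omega_def C_inf_add plus_fun_apply algebra_simps)
  moreover have "0 \<in> Omega S k"
    by (simp add: Omega_def C_inf_0 zero_fun_apply)
  ultimately show ?thesis
    by (simp add: subspace_def)
qed

lemmas Omega_0 = subspace_0 [OF subspace_Omega]
  and Omega_add = subspace_add [OF subspace_Omega]
  and Omega_diff = subspace_diff [OF subspace_Omega]
  and Omega_scale = subspace_scale [OF subspace_Omega]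

lemma form0_in_Omega: "f \<in> C_inf S \<Longrightarrow> form0 f \<in> Omega S 0"
  by (auto simp: Omega_def form0_def)

lemma Omega0_eq: "\<phi> \<in> Omega S 0 \<Longrightarrow> \<phi> = form0 (\<phi> [])"
  using Omega_degree [of \<phi> S 0] by (fastforce simp: form0_def fun_eq_iff)

lemma form0_add: "form0 (f + g) = form0 f + form0 g"
  and form0_scale: "form0 (c *\<^sub>R f) = c *\<^sub>R form0 f"
  by (auto simp: form0_def fun_eq_iff scaleR_fun_def fun_apply)

lemma Omega1_add: "\<beta> \<in> Omega S 1 \<Longrightarrow> X \<in> vfields S \<Longrightarrow> Y \<in> vfields S \<Longrightarrow> \<beta> [X + Y] = \<beta> [X] + \<beta> [Y]"
  and Omega1_mult: "\<beta> \<in> Omega S 1 \<Longrightarrow> X \<in> vfields S \<Longrightarrow> f \<in> C_inf S \<Longrightarrow> \<beta> [\<lambda>h. f * X h] = f * \<beta> [X]"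
proof -
  assume \<beta>: "\<beta> \<in> Omega S 1" and X: "X \<in> vfields S"
  have *: "\<beta> ([X][0 := X' + Y]) = \<beta> ([X][0 := X']) + \<beta> ([X][0 := Y]) \<and>
      \<beta> ([X][0 := (\<lambda>h. f * X' h)]) = f * \<beta> ([X][0 := X'])"
    if "X' \<in> vfields S" "Y \<in> vfields S" "f \<in> C_inf S" for X' Y f
  proof -
    have "length [X] = 1 \<and> set [X] \<subseteq> vfields S"
      using X by simp
    with \<beta> that show ?thesis
      unfolding Omega_def by blast
  qed
  show "Y \<in> vfields S \<Longrightarrow> \<beta> [X + Y] = \<beta> [X] + \<beta> [Y]"
    using * [OF X _ C_inf_0] by simp
  show "f \<in> C_inf S \<Longrightarrow> \<beta> [\<lambda>h. f * X h] = f * \<beta> [X]"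
    using * [OF X X] by simp
qed

lemma Omega1_0:
  assumes "\<beta> \<in> Omega S 1" "X \<in> vfields S"
  shows "\<beta> [0] = 0"
proof -
  have "(\<lambda>h. 0 * X h) = 0"
    by (simp add: fun_eq_iff fun_apply)
  then show ?thesis
    using Omega1_mult [OF assms C_inf_0] by simp
qed

lemma form1_in_Omega:
  assumes "\<And>X. X \<in> vfields S \<Longrightarrow> \<beta> X \<in> C_inf S"
    "\<And>X Y. X \<in> vfields S \<Longrightarrow> Y \<in> vfields S \<Longrightarrow> \<beta> (X + Y) = \<beta> X + \<beta> Y"
    "\<And>X f. X \<in> vfields S \<Longrightarrow> f \<in> C_inf S \<Longrightarrow> \<beta> (\<lambda>h. f * X h) = f * \<beta> X"
  shows "form1 S \<beta> \<in> Omega S 1"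
  using assms
  by (auto simp: Omega_def form1_def length_Suc_conv vfields_add vfields_mult split: list.splits)

lemma form1_apply: "form1 S \<beta> [X] = (if X \<in> vfields S then \<beta> X else 0)"
  by (simp add: form1_def)

lemma d_form0_in_Omega: "f \<in> C_inf S \<Longrightarrow> ext_d S (form0 f) \<in> Omega S 1"
  unfolding ext_d_form0 by (rule form1_in_Omega) (simp_all add: vf_C_inf plus_fun_apply)

lemma Omega1_eqI:
  assumes "\<beta> \<in> Omega S 1" "\<beta>' \<in> Omega S 1" "\<And>X. X \<in> vfields S \<Longrightarrow> \<beta> [X] = \<beta>' [X]"
  shows "\<beta> = \<beta>'"
proof
  fix Xs
  show "\<beta> Xs = \<beta>' Xs"
  proof (cases "length Xs = 1 \<and> set Xs \<subseteq> vfields S")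
    case True
    then obtain X where "Xs = [X]" by (auto simp: length_Suc_conv)
    with True assms(3) show ?thesis by simp
  next
    case False
    then show ?thesis
      using assms(1,2) by (metis Omega_degree Omega_vfields)
  qed
qed

text \<open>All lists at which Koszul's formula evaluates \<open>\<phi>\<close> are shorter by one than the given list: the first
sum drops one vector field, the second replaces two by their bracket.\<close>

lemma ext_d_degree:
  fixes \<phi> :: "'s form"
  assumes "\<And>Xs. length Xs \<noteq> k \<Longrightarrow> \<phi> Xs = 0" and "length Xs \<noteq> Suc k"
  shows "ext_d S \<phi> Xs = 0"
proof -
  have 1: "\<phi> (nths Xs (- {i})) = 0" if "i < length Xs" for i
  proof (rule assms(1))
    have "{j. j < length Xs \<and> j \<in> - {i}} = {..<length Xs} - {i}" by auto
    then have "length (nths Xs (- {i})) = length Xs - 1"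
      using that by (simp add: length_nths)
    then show "length (nths Xs (- {i})) \<noteq> k"
      using that assms(2) by simp
  qed
  have 2: "\<phi> (Z # nths Xs (- {i, j})) = 0" if "i < j" "j < length Xs" for Z i j
  proof (rule assms(1))
    have "{l. l < length Xs \<and> l \<in> - {i, j}} = {..<length Xs} - {i, j}" by auto
    moreover have "card ({..<length Xs} - {i, j}) = length Xs - 2"
      using that by (subst card_Diff_subset) auto
    ultimately have "length (nths Xs (- {i, j})) = length Xs - 2"
      by (simp add: length_nths)
    then show "length (Z # nths Xs (- {i, j})) \<noteq> k"
      using that assms(2) by simp
  qed
  have "(\<Sum>i<length Xs. (-1) ^ i * (Xs ! i) (\<phi> (nths Xs (- {i}))) s) = 0"
    if "set Xs \<subseteq> vfields S" for s
  proof (rule sum.neutral, rule ballI)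
    fix i assume i: "i \<in> {..<length Xs}"
    then have "Xs ! i \<in> vfields S"
      using that nth_mem by blast
    then show "(-1) ^ i * (Xs ! i) (\<phi> (nths Xs (- {i}))) s = 0"
      using 1 i by (simp add: fun_apply)
  qed
  moreover have "(\<Sum>j<length Xs. \<Sum>i<j. (-1) ^ (i + j) *
          \<phi> (vf_bracket (Xs ! i) (Xs ! j) # nths Xs (- {i, j})) s) = 0" for s
    by (intro sum.neutral ballI) (use 2 in \<open>simp add: fun_apply\<close>)
  ultimately show ?thesis
    by (auto simp: ext_d_def fun_eq_iff fun_apply)
qed

lemma nths_Compl_simps:
  "nths [X, Y] (- {0}) = [Y]" "nths [X, Y] (- {Suc 0}) = [X]" "nths [X, Y] (- {0, Suc 0}) = []"
  "nths [X, Y, Z] (- {0}) = [Y, Z]" "nths [X, Y, Z] (- {Suc 0}) = [X, Z]" "nths [X, Y, Z] (- {Suc (Suc 0)}) = [X, Y]"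
  "nths [X, Y, Z] (- {0, Suc 0}) = [Z]" "nths [X, Y, Z] (- {0, Suc (Suc 0)}) = [Y]" "nths [X, Y, Z] (- {Suc 0, Suc (Suc 0)}) = [X]"
  by (simp_all add: nths_Cons)

lemma ext_d_two:
  assumes "X \<in> vfields S" "Y \<in> vfields S"
  shows "ext_d S \<beta> [X, Y] = X (\<beta> [Y]) - Y (\<beta> [X]) - \<beta> [vf_bracket X Y]"
  using assms
  by (simp add: ext_d_def fun_eq_iff fun_apply numeral_2_eq_2 lessThan_Suc nths_Compl_simps)

lemma ext_d_three:
  assumes "X \<in> vfields S" "Y \<in> vfields S" "Z \<in> vfields S"
  shows "ext_d S \<gamma> [X, Y, Z] = X (\<gamma> [Y, Z]) - Y (\<gamma> [X, Z]) + Z (\<gamma> [X, Y])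
    - \<gamma> [vf_bracket X Y, Z] + \<gamma> [vf_bracket X Z, Y] - \<gamma> [vf_bracket Y Z, X]"
proof -
  have "{..<3} = {0, 1, 2 :: nat}" "{..<2} = {0, 1 :: nat}" "{..<Suc 0} = {0}" by auto
  then show ?thesis
    using assms
    by (simp add: ext_d_def fun_eq_iff fun_apply nths_Compl_simps del: One_nat_def)
qed

lemma ext_d_outside: "\<not> set Xs \<subseteq> vfields S \<Longrightarrow> ext_d S \<phi> Xs = 0"
  by (simp add: ext_d_def fun_eq_iff fun_apply)

lemma two_vfields_cases:
  assumes "length Xs = 2" "set Xs \<subseteq> vfields S"
  obtains X Y where "Xs = [X, Y]" "X \<in> vfields S" "Y \<in> vfields S"
  using assms by (auto simp: length_Suc_conv numeral_2_eq_2)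

text \<open>Linearity over functions holds because \<open>[f X, Y] = f [X, Y] - (Y f) X\<close>, and the term \<open>(Y f) \<beta>(X)\<close> that
this produces is the one coming from \<open>Y (f \<beta>(X))\<close>. Antisymmetry reduces the second argument to the first.\<close>

lemma d_Omega1_in_Omega2:
  assumes \<beta>: "\<beta> \<in> Omega S 1"
  shows "ext_d S \<beta> \<in> Omega S 2"
proof -
  let ?d = "\<lambda>X Y. ext_d S \<beta> [X, Y]"
  note [simp] = vf_C_inf Omega_C_inf [OF \<beta>] vfields_bracket vfields_add vfields_mult C_inf_mult
    C_inf_diff ext_d_two
  have anti: "?d X Y = - ?d Y X" if [simp]: "X \<in> vfields S" "Y \<in> vfields S" for X Y
  proof -
    have "\<beta> [vf_bracket X Y + vf_bracket Y X] = 0"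
    proof -
      have "vf_bracket X Y + vf_bracket Y X = 0"
        by (simp add: vf_bracket_def fun_eq_iff fun_apply)
      then show ?thesis
        using Omega1_0 [OF \<beta>, of X] by simp
    qed
    then have "\<beta> [vf_bracket X Y] + \<beta> [vf_bracket Y X] = 0"
      by (simp add: Omega1_add [OF \<beta>])
    then have "\<beta> [vf_bracket X Y] = - \<beta> [vf_bracket Y X]"
      by (simp add: add_eq_0_iff2)
    then show ?thesis by simp
  qed
  have add: "?d (X + X') Y = ?d X Y + ?d X' Y"
    if [simp]: "X \<in> vfields S" "X' \<in> vfields S" "Y \<in> vfields S" for X X' Y
  proof -
    have "vf_bracket (X + X') Y f = (vf_bracket X Y + vf_bracket X' Y) f" for f
      by (cases "f \<in> C_inf S")
        (simp_all add: vf_bracket_def plus_fun_apply [where 'b = "'a \<Rightarrow> real"] vf_add [of Y S]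
          vf_outside [of _ S] vf_0 [of _ S] algebra_simps)
    then have "vf_bracket (X + X') Y = vf_bracket X Y + vf_bracket X' Y"
      by (rule ext)
    then show ?thesis
      by (simp add: Omega1_add [OF \<beta>] vf_add [of Y S] plus_fun_apply [of X X'] plus_fun_apply [of X' X] algebra_simps)
  qed
  have mult: "?d (\<lambda>h. f * X h) Y = f * ?d X Y"
    if [simp]: "X \<in> vfields S" "Y \<in> vfields S" "f \<in> C_inf S" for X Y f
  proof -
    have "(vf_bracket (\<lambda>h. f * X h) Y + (\<lambda>h. Y f * X h)) g = f * vf_bracket X Y g" for g
      by (cases "g \<in> C_inf S")
        (simp_all add: vf_bracket_def plus_fun_apply [where 'b = "'a \<Rightarrow> real"] vf_mult [of Y S]
          vf_outside [of _ S] vf_0 [of _ S] algebra_simps)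
    then have "vf_bracket (\<lambda>h. f * X h) Y + (\<lambda>h. Y f * X h) = (\<lambda>h. f * vf_bracket X Y h)"
      by (rule ext)
    then have "\<beta> [vf_bracket (\<lambda>h. f * X h) Y + (\<lambda>h. Y f * X h)] = \<beta> [\<lambda>h. f * vf_bracket X Y h]"
      by (simp only:)
    then have "\<beta> [vf_bracket (\<lambda>h. f * X h) Y] + Y f * \<beta> [X] = f * \<beta> [vf_bracket X Y]"
      by (simp only: Omega1_add [OF \<beta>] Omega1_mult [OF \<beta>] that vf_C_inf vfields_bracket vfields_mult)
    then have "\<beta> [vf_bracket (\<lambda>h. f * X h) Y] = f * \<beta> [vf_bracket X Y] - Y f * \<beta> [X]"
      by (simp add: algebra_simps)
    then show ?thesis
      by (simp add: Omega1_mult [OF \<beta>] vf_mult [of Y S] algebra_simps)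
  qed
  have add2: "?d Y (X + X') = ?d Y X + ?d Y X'"
    if X: "X \<in> vfields S" "X' \<in> vfields S" and Y: "Y \<in> vfields S" for X X' Y
    by (simp only: anti [OF Y vfields_add [OF X]] anti [OF Y X(1)] anti [OF Y X(2)] add [OF X Y] minus_add_distrib)
  have mult2: "?d Y (\<lambda>h. f * X h) = f * ?d Y X"
    if X: "X \<in> vfields S" and Y: "Y \<in> vfields S" and f: "f \<in> C_inf S" for X Y f
    by (simp only: anti [OF Y vfields_mult [OF f X]] anti [OF Y X] mult [OF X Y f] mult_minus_right)
  show ?thesis
    unfolding Omega_def
  proof (intro CollectI conjI allI impI ballI)
    show "ext_d S \<beta> Xs = 0" if "\<not> (length Xs = 2 \<and> set Xs \<subseteq> vfields S)" for Xs
      using that ext_d_degree [of 1 \<beta> Xs S] Omega_degree [OF \<beta>] ext_d_outside by (metis Suc_1)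
    fix Xs assume Xs: "length Xs = 2 \<and> set Xs \<subseteq> vfields S"
    then obtain X Y where XY: "Xs = [X, Y]" "X \<in> vfields S" "Y \<in> vfields S"
      using two_vfields_cases [of Xs S] by blast
    show "ext_d S \<beta> Xs \<in> C_inf S"
      using XY by simp
    show "ext_d S \<beta> Xs = 0" if "\<not> distinct Xs"
      using XY that by (simp add: vf_bracket_self Omega1_0 [OF \<beta> XY(2)])
    fix i :: nat and Z Z' f assume *: "i < 2" "Z \<in> vfields S" "Z' \<in> vfields S" "f \<in> C_inf S"
    then consider "i = 0" | "i = 1" by linarith
    then have "ext_d S \<beta> (Xs[i := Z + Z']) = ext_d S \<beta> (Xs[i := Z]) + ext_d S \<beta> (Xs[i := Z']) \<and>
      ext_d S \<beta> (Xs[i := \<lambda>h. f * Z h]) = f * ext_d S \<beta> (Xs[i := Z])"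
      by cases (simp_all only: XY list_update.simps nat.case One_nat_def, simp_all only: add add2 mult mult2 * XY)
    then show "ext_d S \<beta> (Xs[i := Z + Z']) = ext_d S \<beta> (Xs[i := Z]) + ext_d S \<beta> (Xs[i := Z'])"
      "ext_d S \<beta> (Xs[i := \<lambda>h. f * Z h]) = f * ext_d S \<beta> (Xs[i := Z])"
      by simp_all
  qed
qed

lemma Omega2_eqI:
  assumes "\<gamma> \<in> Omega S 2" "\<gamma>' \<in> Omega S 2"
    "\<And>X Y. X \<in> vfields S \<Longrightarrow> Y \<in> vfields S \<Longrightarrow> \<gamma> [X, Y] = \<gamma>' [X, Y]"
  shows "\<gamma> = \<gamma>'"
proof
  fix Xs
  show "\<gamma> Xs = \<gamma>' Xs"
  proof (cases "length Xs = 2 \<and> set Xs \<subseteq> vfields S")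
    case True
    with assms(3) show ?thesis by (metis two_vfields_cases)
  next
    case False
    then show ?thesis
      using assms(1,2) by (metis Omega_degree Omega_vfields)
  qed
qed

lemma d_d_form0:
  assumes f: "f \<in> C_inf S"
  shows "ext_d S (ext_d S (form0 f)) = 0"
proof (rule Omega2_eqI [OF d_Omega1_in_Omega2 [OF d_form0_in_Omega [OF f]] Omega_0])
  show "ext_d S (ext_d S (form0 f)) [X, Y] = 0 [X, Y]" if "X \<in> vfields S" "Y \<in> vfields S" for X Y
    unfolding ext_d_two [OF that]
    using that by (simp add: ext_d_form0 form1_apply vfields_bracket fun_apply) (simp add: vf_bracket_def)
qed

text \<open>The terms with two derivatives cancel by the definition of the bracket of vector fields, and the terms
with iterated brackets by the Jacobi identity.\<close>

lemma d_d_Omega1: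
  assumes \<beta>: "\<beta> \<in> Omega S 1"
  shows "ext_d S (ext_d S \<beta>) = 0"
proof
  fix Xs
  note d\<beta> = d_Omega1_in_Omega2 [OF \<beta>]
  show "ext_d S (ext_d S \<beta>) Xs = 0 Xs"
  proof (cases "length Xs = 3 \<and> set Xs \<subseteq> vfields S")
    case False
    then show ?thesis
      using ext_d_degree [of 2 "ext_d S \<beta>" Xs S] Omega_degree [OF d\<beta>] ext_d_outside
      by (metis eval_nat_numeral(3) zero_fun_apply)
  next
    case True
    then obtain X Y Z where Xs: "Xs = [X, Y, Z]" and [simp]: "X \<in> vfields S" "Y \<in> vfields S" "Z \<in> vfields S"
      by (auto simp: length_Suc_conv numeral_3_eq_3)
    note [simp] = vf_C_inf Omega_C_inf [OF \<beta>] vfields_bracket C_inf_diff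
    have "(vf_bracket (vf_bracket X Y) Z + vf_bracket (vf_bracket Y Z) X) f = vf_bracket (vf_bracket X Z) Y f" for f
      by (cases "f \<in> C_inf S")
        (simp_all add: vf_bracket_def plus_fun_apply [where 'b = "'a \<Rightarrow> real"] vf_diff [of _ S]
          vf_outside [of _ S] vf_0 [of _ S] algebra_simps)
    then have "vf_bracket (vf_bracket X Y) Z + vf_bracket (vf_bracket Y Z) X = vf_bracket (vf_bracket X Z) Y"
      by (rule ext)
    then have J: "\<beta> [vf_bracket (vf_bracket X Z) Y]
        = \<beta> [vf_bracket (vf_bracket X Y) Z] + \<beta> [vf_bracket (vf_bracket Y Z) X]"
      by (simp flip: Omega1_add [OF \<beta>])
    have "ext_d S (ext_d S \<beta>) [X, Y, Z] = 0"
      by (simp add: ext_d_three ext_d_two J vf_diff [of _ S])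
        (simp add: vf_bracket_def algebra_simps)
    then show ?thesis by (simp add: Xs zero_fun_apply)
  qed
qed

text \<open>A subspace that contains the forms of all degrees and on which the exterior derivative is linear. It
is not linear on arbitrary functions on lists of vector fields, since a vector field is not linear on
functions that are not smooth.\<close>

definition smooth_valued :: "'s manifold \<Rightarrow> 's form set" where
  "smooth_valued S = {\<phi>. \<forall>Xs. \<phi> Xs \<in> C_inf S}"

lemma subspace_smooth_valued: "subspace (smooth_valued S)"
  unfolding subspace_def smooth_valued_def
  by (simp add: C_inf_0 C_inf_add fun_apply) (simp add: scaleR_fun_def [where 'b = "'a \<Rightarrow> real"] C_inf_scale)

lemma Omega_smooth_valued: "\<phi> \<in> Omega S k \<Longrightarrow> \<phi> \<in> smooth_valued S"
  by (simp add: smooth_valued_def Omega_C_inf)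

lemma ext_d_add:
  assumes "\<phi> \<in> smooth_valued S" "\<psi> \<in> smooth_valued S"
  shows "ext_d S (\<phi> + \<psi>) = ext_d S \<phi> + ext_d S \<psi>"
proof (intro ext)
  fix Xs s
  show "ext_d S (\<phi> + \<psi>) Xs s = (ext_d S \<phi> + ext_d S \<psi>) Xs s"
  proof (cases "set Xs \<subseteq> vfields S")
    case True
    then have "Xs ! i \<in> vfields S" if "i < length Xs" for i
      using that nth_mem by blast
    then have "(Xs ! i) ((\<phi> + \<psi>) Ys) s = (Xs ! i) (\<phi> Ys) s + (Xs ! i) (\<psi> Ys) s" if "i < length Xs" for i Ys
      using that assms by (simp add: smooth_valued_def vf_add [of _ S] fun_apply)
    with True show ?thesis
      by (simp add: ext_d_def distrib_left sum.distrib fun_apply)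
  qed (simp add: ext_d_def fun_apply)
qed

lemma ext_d_scale:
  assumes "\<phi> \<in> smooth_valued S"
  shows "ext_d S (c *\<^sub>R \<phi>) = c *\<^sub>R ext_d S \<phi>"
proof (intro ext)
  fix Xs s
  have sc: "(c *\<^sub>R \<phi>) Ys = c *\<^sub>R \<phi> Ys" "(c *\<^sub>R f) s = c * f s" for Ys s f and \<phi> :: "'a form"
    by (simp_all add: scaleR_fun_def)
  show "ext_d S (c *\<^sub>R \<phi>) Xs s = (c *\<^sub>R ext_d S \<phi>) Xs s"
  proof (cases "set Xs \<subseteq> vfields S")
    case True
    then have "Xs ! i \<in> vfields S" if "i < length Xs" for i
      using that nth_mem by blast
    then have "(Xs ! i) (c *\<^sub>R \<phi> Ys) s = c * (Xs ! i) (\<phi> Ys) s" if "i < length Xs" for i Ys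
      using that assms by (simp add: smooth_valued_def vf_scale [of _ S] sc)
    with True show ?thesis
      by (simp add: ext_d_def sc distrib_left sum_distrib_left mult.left_commute)
  qed (simp add: ext_d_def scaleR_fun_def)
qed

lemma ext_d_linear_extension:
  obtains D where "linear D" "\<And>k \<phi>. \<phi> \<in> Omega S k \<Longrightarrow> D \<phi> = ext_d S \<phi>"
  by (rule linear_extension_from_subspace [OF subspace_smooth_valued, of S "ext_d S"])
    (use ext_d_add ext_d_scale Omega_smooth_valued in blast)+

lemma bilinear_wedge: "bilinear wedge"
  unfolding bilinear_def wedge_def
  by (intro conjI allI linearI ext)
    (simp_all add: scaleR_fun_def fun_apply sum.distrib sum_distrib_left algebra_simps)

text \<open>Only the shuffle that assigns all arguments to \<open>\<phi>\<close> contributes, and it has no inversions.\<close>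

lemma wedge_form0_right: "wedge \<phi> (form0 f) = wedge (form0 f) \<phi>"
proof (intro ext)
  fix Xs s
  have "wedge \<phi> (form0 f) Xs s = (\<Sum>I\<in>Pow {..<length Xs}. if I = {..<length Xs} then \<phi> Xs s * f s else 0)"
    unfolding wedge_def
  proof (rule sum.cong [OF refl])
    fix I assume I: "I \<in> Pow {..<length Xs}"
    show "(-1) ^ card {(i, j). i \<in> I \<and> j \<notin> I \<and> j < i} * \<phi> (nths Xs I) s * form0 f (nths Xs (- I)) s =
      (if I = {..<length Xs} then \<phi> Xs s * f s else 0)"
    proof (cases "I = {..<length Xs}")
      case True
      have "nths Xs I = Xs"
        using True by (intro nths_all) auto
      moreover have "nths Xs (- I) = []"
        using True by (auto simp: set_nths simp flip: set_empty2)
      moreover have "{(i, j). i \<in> I \<and> j \<notin> I \<and> j < i} = {}"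
        using True by auto
      ultimately show ?thesis
        by (simp only: True form0_def) simp
    next
      case False
      then obtain i where "i < length Xs" "i \<notin> I"
        using I by auto
      then have "Xs ! i \<in> set (nths Xs (- I))"
        by (auto simp: set_nths)
      then have "nths Xs (- I) \<noteq> []" by auto
      with False show ?thesis
        by (simp add: form0_def fun_apply)
    qed
  qed
  also have "\<dots> = \<phi> Xs s * f s"
    by (simp add: sum.delta)
  finally show "wedge \<phi> (form0 f) Xs s = wedge (form0 f) \<phi> Xs s"
    by (simp add: wedge_form0)
qed

lemma wedge_form0_form0: "wedge (form0 f) (form0 g) = form0 (f * g)"
  by (simp add: fun_eq_iff wedge_form0) (simp add: form0_def fun_apply)

lemma wedge_form0_in_Omega:
  assumes f: "f \<in> C_inf S" and \<beta>: "\<beta> \<in> Omega S 1"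
  shows "wedge (form0 f) \<beta> \<in> Omega S 1"
proof -
  have "form1 S (\<lambda>X. f * \<beta> [X]) \<in> Omega S 1"
    using f Omega_C_inf [OF \<beta>] Omega1_add [OF \<beta>] Omega1_mult [OF \<beta>]
    by (intro form1_in_Omega) (simp_all add: C_inf_mult algebra_simps)
  moreover have "form1 S (\<lambda>X. f * \<beta> [X]) Xs = wedge (form0 f) \<beta> Xs" for Xs
    using Omega_degree [OF \<beta>, of Xs] Omega_vfields [OF \<beta>, of Xs]
    by (auto simp: fun_eq_iff wedge_form0 form1_def fun_apply split: list.split)
  then have "form1 S (\<lambda>X. f * \<beta> [X]) = wedge (form0 f) \<beta>"
    by (rule ext)
  ultimately show ?thesis by simp
qed

lemma wedge_two:
  assumes "\<beta> \<in> Omega S 1" "\<beta>' \<in> Omega S 1"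
  shows "wedge \<beta> \<beta>' [X, Y] = \<beta> [X] * \<beta>' [Y] - \<beta> [Y] * \<beta>' [X]"
proof
  fix s
  \<comment> \<open>The two 1-shuffles are \<open>{0}\<close> and \<open>{1}\<close>; the second has one inversion.\<close>
  have P: "Pow {..<length [X, Y]} = {{}, {0}, {1}, {0, 1}}"
    by (auto simp: lessThan_Suc Pow_insert numeral_2_eq_2)
  have 0: "\<beta> [] = 0" "\<beta>' [] = 0"
    using assms Omega_degree by fastforce+
  have "{(i, j). i = Suc 0 \<and> j \<noteq> Suc 0 \<and> j < i} = {(Suc 0, 0)}" by auto
  then have 1: "card {(i, j). i = Suc 0 \<and> j \<noteq> Suc 0 \<and> j < i} = Suc 0"
    by simp
  have "{(i, j). i = 0 \<and> 0 < j \<and> j < i} = ({} :: (nat \<times> nat) set)" by auto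
  then have 2: "card {(i :: nat, j). i = 0 \<and> 0 < j \<and> j < i} = 0"
    by (simp only: card.empty)
  show "wedge \<beta> \<beta>' [X, Y] s = (\<beta> [X] * \<beta>' [Y] - \<beta> [Y] * \<beta>' [X]) s"
    unfolding wedge_def P
    by (simp add: 0 1 2 nths_Cons fun_apply)
qed

lemma wedge_degree_2:
  assumes "\<beta> \<in> Omega S 1" "\<beta>' \<in> Omega S 1" "length Xs \<noteq> 2"
  shows "wedge \<beta> \<beta>' Xs = 0"
proof
  fix s
  have "\<beta> (nths Xs I) s * \<beta>' (nths Xs (- I)) s = 0" for I
  proof -
    have "{..<length Xs} = {i. i < length Xs \<and> i \<in> I} \<union> {i. i < length Xs \<and> i \<in> - I}"
      by auto
    moreover have "card ({i. i < length Xs \<and> i \<in> I} \<union> {i. i < length Xs \<and> i \<in> - I})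
        = length (nths Xs I) + length (nths Xs (- I))"
      unfolding length_nths by (rule card_Un_disjoint) auto
    ultimately have "length Xs = length (nths Xs I) + length (nths Xs (- I))"
      by (metis card_lessThan)
    with assms(3) have "length (nths Xs I) \<noteq> 1 \<or> length (nths Xs (- I)) \<noteq> 1"
      by auto
    then have "\<beta> (nths Xs I) = 0 \<or> \<beta>' (nths Xs (- I)) = 0"
      using Omega_degree [OF assms(1)] Omega_degree [OF assms(2)] by blast
    then show ?thesis
      by (auto simp: zero_fun_apply)
  qed
  then have "(-1) ^ n * \<beta> (nths Xs I) s * \<beta>' (nths Xs (- I)) s = 0" for n I
    by (simp only: mult.assoc mult_zero_right)
  then show "wedge \<beta> \<beta>' Xs s = 0 s"
    unfolding wedge_def zero_fun_apply by (intro sum.neutral ballI)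
qed

lemma d_wedge_form0:
  assumes f: "f \<in> C_inf S" and g: "g \<in> C_inf S"
  shows "ext_d S (wedge (form0 f) (ext_d S (form0 g))) = wedge (ext_d S (form0 f)) (ext_d S (form0 g))"
    (is "?l = ?r")
proof
  fix Xs
  note df = d_form0_in_Omega [OF f] and dg = d_form0_in_Omega [OF g]
  note fdg = wedge_form0_in_Omega [OF f dg]
  note l = d_Omega1_in_Omega2 [OF fdg]
  have w: "wedge (form0 f) \<beta> [X] = f * \<beta> [X]" for \<beta> and X :: "'a vf"
    by (simp add: fun_eq_iff wedge_form0 fun_apply)
  show "?l Xs = ?r Xs"
  proof (cases "length Xs = 2")
    case False
    then show ?thesis
      using Omega_degree [OF l] wedge_degree_2 [OF df dg] by simp
  next
    case True
    then obtain X Y where Xs: "Xs = [X, Y]"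
      by (auto simp: length_Suc_conv numeral_2_eq_2)
    show ?thesis
    proof (cases "X \<in> vfields S \<and> Y \<in> vfields S")
      case True
      moreover from this have "vf_bracket X Y \<in> vfields S"
        by (simp add: vfields_bracket)
      ultimately show ?thesis
        using f g
        by (simp add: Xs ext_d_two w wedge_two [OF df dg])
          (simp add: ext_d_form0 form1_apply vf_mult [of _ S] vf_C_inf, simp add: vf_bracket_def algebra_simps)
    next
      case False
      then show ?thesis
        using Omega_vfields [OF l, of Xs]
        by (auto simp: Xs wedge_two [OF df dg] ext_d_outside)
    qed
  qed
qed

lemma d_form0_mult:
  assumes "f \<in> C_inf S" "g \<in> C_inf S"
  shows "ext_d S (form0 (f * g)) = wedge (form0 f) (ext_d S (form0 g)) + wedge (form0 g) (ext_d S (form0 f))"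
proof (rule Omega1_eqI)
  show "ext_d S (form0 (f * g)) \<in> Omega S 1"
    using assms by (intro d_form0_in_Omega C_inf_mult)
  show "wedge (form0 f) (ext_d S (form0 g)) + wedge (form0 g) (ext_d S (form0 f)) \<in> Omega S 1"
    using assms by (intro Omega_add wedge_form0_in_Omega d_form0_in_Omega)
  show "ext_d S (form0 (f * g)) [X]
      = (wedge (form0 f) (ext_d S (form0 g)) + wedge (form0 g) (ext_d S (form0 f))) [X]"
    if "X \<in> vfields S" for X
    using assms that
    by (simp add: fun_eq_iff wedge_form0 ext_d_form0 form1_apply vf_mult [of _ S] fun_apply)
qed

lemma wedge_d_form0_anti:
  assumes "f \<in> C_inf S" "g \<in> C_inf S"
  shows "wedge (ext_d S (form0 g)) (ext_d S (form0 f)) = - wedge (ext_d S (form0 f)) (ext_d S (form0 g))"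
proof
  fix Xs
  note df = d_form0_in_Omega [OF assms(1)] and dg = d_form0_in_Omega [OF assms(2)]
  show "wedge (ext_d S (form0 g)) (ext_d S (form0 f)) Xs = (- wedge (ext_d S (form0 f)) (ext_d S (form0 g))) Xs"
  proof (cases "length Xs = 2")
    case True
    then obtain X Y where "Xs = [X, Y]"
      by (auto simp: length_Suc_conv numeral_2_eq_2)
    then show ?thesis
      by (simp add: wedge_two [OF df dg] wedge_two [OF dg df] uminus_apply algebra_simps)
  qed (simp add: wedge_degree_2 [OF df dg] wedge_degree_2 [OF dg df] uminus_apply)
qed

section \<open>The central extension of the current algebra\<close>

lemma C_inf_map_functional: "u \<in> C_inf_map S \<Longrightarrow> linear l \<Longrightarrow> (\<lambda>s. l (u s)) \<in> C_inf S"
  unfolding C_inf_map_def by blast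

lemma subspace_C_inf_map: "subspace (C_inf_map S :: ('s \<Rightarrow> 'g::real_vector) set)"
proof -
  have add: "u + v \<in> C_inf_map S" if u: "u \<in> C_inf_map S" and v: "v \<in> C_inf_map S" for u v :: "'s \<Rightarrow> 'g"
  proof -
    obtain B where B: "finite B" "range u \<subseteq> span B" using u unfolding C_inf_map_def by blast
    obtain B' where B': "finite B'" "range v \<subseteq> span B'" using v unfolding C_inf_map_def by blast
    have "u s + v s \<in> span (B \<union> B')" for s
      using B(2) B'(2) span_mono [of B "B \<union> B'"] span_mono [of B' "B \<union> B'"]
      by (intro span_add) blast+
    then have "range (u + v) \<subseteq> span (B \<union> B')"
      by (auto simp: plus_fun_apply)
    moreover have "(\<lambda>s. l ((u + v) s)) \<in> C_inf S" if l: "linear l" for l :: "'g \<Rightarrow> real"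
    proof -
      have "(\<lambda>s. l ((u + v) s)) = (\<lambda>s. l (u s)) + (\<lambda>s. l (v s))"
        by (simp add: fun_eq_iff fun_apply linear_add [OF l])
      then show ?thesis
        using C_inf_add [OF C_inf_map_functional [OF u l] C_inf_map_functional [OF v l]] by simp
    qed
    ultimately show ?thesis
      using B(1) B'(1) unfolding C_inf_map_def by blast
  qed
  have scale: "c *\<^sub>R u \<in> C_inf_map S" if u: "u \<in> C_inf_map S" for c and u :: "'s \<Rightarrow> 'g"
  proof -
    obtain B where B: "finite B" "range u \<subseteq> span B" using u unfolding C_inf_map_def by blast
    then have "range (c *\<^sub>R u) \<subseteq> span B"
      by (auto simp: scaleR_fun_def intro: span_scale)
    moreover have "(\<lambda>s. l ((c *\<^sub>R u) s)) \<in> C_inf S" if l: "linear l" for l :: "'g \<Rightarrow> real"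
    proof -
      have "(\<lambda>s. l ((c *\<^sub>R u) s)) = c *\<^sub>R (\<lambda>s. l (u s))"
        by (simp add: fun_eq_iff scaleR_fun_def linear_scale [OF l])
      then show ?thesis
        using C_inf_scale [OF C_inf_map_functional [OF u l]] by simp
    qed
    ultimately show ?thesis
      using B(1) unfolding C_inf_map_def by blast
  qed
  have "0 \<in> (C_inf_map S :: ('s \<Rightarrow> 'g) set)"
  proof -
    have "range (0 :: 's \<Rightarrow> 'g) \<subseteq> span {}" by (auto simp: zero_fun_apply)
    moreover have "(\<lambda>s. l ((0 :: 's \<Rightarrow> 'g) s)) \<in> C_inf S" if l: "linear l" for l :: "'g \<Rightarrow> real"
    proof -
      have "(\<lambda>s. l ((0 :: 's \<Rightarrow> 'g) s)) = 0"
        by (simp add: fun_eq_iff zero_fun_apply linear_0 [OF l])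
      then show ?thesis using C_inf_0 by metis
    qed
    ultimately show ?thesis
      unfolding C_inf_map_def by blast
  qed
  with add scale show ?thesis
    unfolding subspace_def by blast
qed

lemmas C_inf_map_0 = subspace_0 [OF subspace_C_inf_map]
  and C_inf_map_add = subspace_add [OF subspace_C_inf_map]
  and C_inf_map_scale = subspace_scale [OF subspace_C_inf_map]

text \<open>The element of \<open>C\<^sup>\<infinity>(S, g)\<close> that corresponds to \<open>f \<otimes> x\<close> in \<open>C\<^sup>\<infinity>(S) \<otimes> g\<close>.\<close>

definition current :: "('s \<Rightarrow> real) \<Rightarrow> 'g::real_vector \<Rightarrow> 's \<Rightarrow> 'g" where
  "current f x = (\<lambda>s. f s *\<^sub>R x)"

lemma current_in_C_inf_map:
  fixes x :: "'g::real_vector"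
  assumes "f \<in> C_inf S"
  shows "current f x \<in> C_inf_map S"
proof -
  have "(\<lambda>s. l (f s *\<^sub>R x)) \<in> C_inf S" if l: "linear l" for l :: "'g \<Rightarrow> real"
  proof -
    have "(\<lambda>s. l (f s *\<^sub>R x)) = l x *\<^sub>R f"
      by (simp add: fun_eq_iff scaleR_fun_def linear_scale [OF l])
    then show ?thesis using C_inf_scale [OF assms] by simp
  qed
  moreover have "range (\<lambda>s. f s *\<^sub>R x) \<subseteq> span {x}"
    by (auto intro: span_scale span_base)
  ultimately show ?thesis
    unfolding C_inf_map_def current_def by blast
qed

lemma current_scale: "c *\<^sub>R current f x = current (c *\<^sub>R f) x"
  by (simp add: current_def scaleR_fun_def)

lemma sum_fun_apply: "(\<Sum>b\<in>D. F b) s = (\<Sum>b\<in>D. F b s :: 'a::real_vector)"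
  by (induction D rule: infinite_finite_induct) (simp_all add: fun_apply)

text \<open>The points of a finite-dimensional subspace involve only finitely many vectors of the Hamel basis, so
the expansion of \<open>u s\<close> in this basis is a finite sum whose coefficients are smooth functions of \<open>s\<close>.\<close>

lemma C_inf_map_subset_span: "C_inf_map S \<subseteq> span {current f x |f x. f \<in> C_inf S}"
proof
  fix u :: "'a \<Rightarrow> 'b" assume u: "u \<in> C_inf_map S"
  then obtain B where B: "finite B" "range u \<subseteq> span B"
    unfolding C_inf_map_def by blast
  define D where "D = (\<Union>x\<in>B. {b. coord b x \<noteq> 0})"
  have D: "finite D"
    unfolding D_def by (intro finite_UN_I B(1) finite_coord)
  have coord_0: "coord b v = 0" if "b \<notin> D" "v \<in> span B" for b v
    using that(2)
  proof (induction rule: span_induct_alt)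
    case base
    show ?case by (rule linear_0 [OF linear_coord])
  next
    case (step c x y)
    then show ?case
      using that(1) by (simp add: D_def linear_add [OF linear_coord] linear_scale [OF linear_coord])
  qed
  have "u s = (\<Sum>b\<in>D. coord b (u s) *\<^sub>R b)" for s
    using coord_0 B(2) by (intro coord_expansion [symmetric] D) blast
  then have "u = (\<Sum>b\<in>D. current (\<lambda>s. coord b (u s)) b)"
    by (simp add: fun_eq_iff sum_fun_apply current_def)
  moreover have "(\<lambda>s. coord b (u s)) \<in> C_inf S" for b
    by (rule C_inf_map_functional [OF u linear_coord])
  ultimately show "u \<in> span {current f x |f x. f \<in> C_inf S}"
    by (metis (mono_tags, lifting) span_sum span_base mem_Collect_eq)
qed

lemma C_inf_map_induct [consumes 1, case_names zero add]:
  assumes u: "u \<in> C_inf_map S"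
    and zero: "P 0"
    and add: "\<And>f x u. f \<in> C_inf S \<Longrightarrow> u \<in> C_inf_map S \<Longrightarrow> P u \<Longrightarrow> P (current f x + u)"
  shows "P u"
proof -
  have "u \<in> span {current f x |f x. f \<in> C_inf S}"
    using u C_inf_map_subset_span by blast
  then have "u \<in> C_inf_map S \<and> P u"
  proof (induction rule: span_induct_alt)
    case base
    show ?case using zero C_inf_map_0 by blast
  next
    case (step c y v)
    then obtain f x where "y = current f x" "f \<in> C_inf S" by blast
    then have y: "c *\<^sub>R y = current (c *\<^sub>R f) x" and cf: "c *\<^sub>R f \<in> C_inf S"
      by (simp_all add: current_scale C_inf_scale)
    show ?case
      unfolding y using add [OF cf] step(2) C_inf_map_add [OF current_in_C_inf_map [OF cf]] by blast
  qed
  then show ?thesis ..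
qed

lemma C_inf_bilinear:
  fixes b :: "'g::real_vector \<Rightarrow> 'g \<Rightarrow> real"
  assumes b: "bilinear b" and u: "u \<in> C_inf_map S" and v: "v \<in> C_inf_map S"
  shows "(\<lambda>s. b (u s) (v s)) \<in> C_inf S"
  using u
proof (induction rule: C_inf_map_induct)
  case zero
  have "(\<lambda>s. b (0 s) (v s)) = 0"
    by (simp add: fun_eq_iff fun_apply bilinear_lzero [OF b])
  then show ?case using C_inf_0 by metis
next
  case (add f x u)
  have "(\<lambda>s. b ((current f x + u) s) (v s)) = f * (\<lambda>s. b x (v s)) + (\<lambda>s. b (u s) (v s))"
    by (simp add: fun_eq_iff fun_apply current_def bilinear_ladd [OF b] bilinear_lmul [OF b])
  moreover have "linear (b x)"
    using b by (simp add: bilinear_def)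
  ultimately show ?case
    using add by (simp only: C_inf_add C_inf_mult C_inf_map_functional [OF v])
qed

definition pointwise :: "('g \<Rightarrow> 'g \<Rightarrow> 'g) \<Rightarrow> ('s \<Rightarrow> 'g) \<Rightarrow> ('s \<Rightarrow> 'g) \<Rightarrow> 's \<Rightarrow> 'g" where
  "pointwise br u v = (\<lambda>s. br (u s) (v s))"

lemma bilinear_pointwise:
  assumes "bilinear (br :: 'g::real_vector \<Rightarrow> _)"
  shows "bilinear (pointwise br)"
  unfolding bilinear_def
  by (intro conjI allI linearI ext)
    (simp_all add: pointwise_def scaleR_fun_def fun_apply bilinear_ladd [OF assms] bilinear_radd [OF assms]
      bilinear_lmul [OF assms] bilinear_rmul [OF assms])

lemma pointwise_current:
  assumes "bilinear br"
  shows "pointwise br (current f x) (current g y) = current (f * g) (br x y)"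
  by (simp add: fun_eq_iff fun_apply pointwise_def current_def bilinear_lmul [OF assms] bilinear_rmul [OF assms] mult.commute)

lemma pointwise_in_C_inf_map:
  assumes br: "bilinear br" and u: "u \<in> C_inf_map S" and v: "v \<in> C_inf_map S"
  shows "pointwise br u v \<in> C_inf_map S"
  using u
proof (induction rule: C_inf_map_induct)
  case zero
  then show ?case by (simp add: bilinear_lzero [OF bilinear_pointwise [OF br]] C_inf_map_0)
next
  case (add f x u)
  have "pointwise br (current f x) v \<in> C_inf_map S"
    using v
  proof (induction rule: C_inf_map_induct)
    case zero
    then show ?case by (simp add: bilinear_rzero [OF bilinear_pointwise [OF br]] C_inf_map_0)
  next
    case (add g y v)
    then show ?case
      using \<open>f \<in> C_inf S\<close>
      by (simp add: bilinear_radd [OF bilinear_pointwise [OF br]] pointwise_current [OF br]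
          C_inf_map_add current_in_C_inf_map C_inf_mult)
  qed
  then show ?case
    using add by (simp add: bilinear_ladd [OF bilinear_pointwise [OF br]] C_inf_map_add)
qed

lemma sigma_N_apply:
  "X \<in> vfields S \<Longrightarrow> sigma_N S p \<omega> u v [X] s =
    X (\<lambda>s'. p (u s) (v s')) s - X (\<lambda>s'. p (u s') (v s)) s + X (\<lambda>s'. \<omega> (u s') (v s')) s"
  by (simp add: sigma_N_def pair_d_right_def pair_d_left_def ext_d_form0 form1_def fun_apply)

lemma form1_outside:
  assumes "\<not> (\<exists>X\<in>vfields S. Xs = [X])"
  shows "form1 S \<beta> Xs = 0"
  using assms by (auto simp: form1_def split: list.split)

lemma sigma_N_outside:
  assumes "\<not> (\<exists>X\<in>vfields S. Xs = [X])"
  shows "sigma_N S p \<omega> u v Xs = 0"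
  unfolding sigma_N_def pair_d_right_def pair_d_left_def ext_d_form0 plus_fun_apply minus_apply
    form1_outside [OF assms] by (simp only: diff_self add_0)

lemma sigma_N_eqI:
  assumes "\<And>Xs. \<not> (\<exists>X\<in>vfields S. Xs = [X]) \<Longrightarrow> \<beta> Xs = 0"
    and "\<And>X s. X \<in> vfields S \<Longrightarrow> sigma_N S p \<omega> u v [X] s = \<beta> [X] s"
  shows "sigma_N S p \<omega> u v = \<beta>"
proof
  fix Xs
  show "sigma_N S p \<omega> u v Xs = \<beta> Xs"
  proof (cases "\<exists>X\<in>vfields S. Xs = [X]")
    case True
    then obtain X where "X \<in> vfields S" "Xs = [X]" by blast
    with assms(2) show ?thesis
      by (simp add: fun_eq_iff)
  next
    case False
    then show ?thesis
      by (simp only: assms(1) [OF False] sigma_N_outside [OF False])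
  qed
qed

text \<open>Linearity in the first argument only, since \<open>sigma_N_anti\<close> gives the second. The forms \<open>p(u, dv)\<close> and
\<open>p(du, v)\<close> are linear because, at a fixed point \<open>s\<close>, the vector field acts on functions of the form
\<open>p (u s) \<circ> v\<close> and these are smooth.\<close>

lemma sigma_N_linear_left:
  fixes u u' v :: "'s \<Rightarrow> 'g::real_vector"
  assumes p: "bilinear p" and w: "bilinear \<omega>"
    and u: "u \<in> C_inf_map S" and u': "u' \<in> C_inf_map S" and v: "v \<in> C_inf_map S"
  shows "sigma_N S p \<omega> (c *\<^sub>R u + u') v = c *\<^sub>R sigma_N S p \<omega> u v + sigma_N S p \<omega> u' v"
proof (rule sigma_N_eqI)
  fix Xs assume no: "\<not> (\<exists>X\<in>vfields S. Xs = [X])"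
  have "(c *\<^sub>R \<beta>) Xs = c *\<^sub>R \<beta> Xs" for \<beta> :: "'s form"
    by (simp add: scaleR_fun_def)
  then show "(c *\<^sub>R sigma_N S p \<omega> u v + sigma_N S p \<omega> u' v) Xs = 0"
    by (simp only: plus_fun_apply sigma_N_outside [OF no] scaleR_zero_right add_0)
next
  fix X s assume X: "X \<in> vfields S"
  have sc: "(c *\<^sub>R f) s = c * f s" "(c *\<^sub>R f') s = c *\<^sub>R f' s" "(c *\<^sub>R \<beta>) Xs s = c * \<beta> Xs s"
    for f :: "'s \<Rightarrow> real" and f' :: "'s \<Rightarrow> 'g" and \<beta> :: "'s form" and Xs s
    by (simp_all add: scaleR_fun_def)
  have X2: "X (c *\<^sub>R f + g) s = c * X f s + X g s" if "f \<in> C_inf S" "g \<in> C_inf S" for f g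
    using that by (simp add: vf_add [OF X] vf_scale [OF X] C_inf_scale sc fun_apply)
  have lin: "linear (p a)" "linear (\<lambda>a'. p a' a)" for a
    using p by (simp_all add: bilinear_def)
  note bi = bilinear_ladd bilinear_lmul
  have 1: "(\<lambda>s'. p ((c *\<^sub>R u + u') s) (v s')) = c *\<^sub>R (\<lambda>s'. p (u s) (v s')) + (\<lambda>s'. p (u' s) (v s'))"
    "(\<lambda>s'. p ((c *\<^sub>R u + u') s') (v s)) = c *\<^sub>R (\<lambda>s'. p (u s') (v s)) + (\<lambda>s'. p (u' s') (v s))"
    "(\<lambda>s'. \<omega> ((c *\<^sub>R u + u') s') (v s')) = c *\<^sub>R (\<lambda>s'. \<omega> (u s') (v s')) + (\<lambda>s'. \<omega> (u' s') (v s'))"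
    by (simp_all add: fun_eq_iff fun_apply sc bi [OF p] bi [OF w])
  have m: "(\<lambda>s'. p a (v s')) \<in> C_inf S" "(\<lambda>s'. p (u s') a) \<in> C_inf S" "(\<lambda>s'. p (u' s') a) \<in> C_inf S"
    "(\<lambda>s'. \<omega> (u s') (v s')) \<in> C_inf S" "(\<lambda>s'. \<omega> (u' s') (v s')) \<in> C_inf S" for a
    using C_inf_map_functional [OF v lin(1)] C_inf_map_functional [OF u lin(2)]
      C_inf_map_functional [OF u' lin(2)] C_inf_bilinear [OF w] u u' v by blast+
  show "sigma_N S p \<omega> (c *\<^sub>R u + u') v [X] s = (c *\<^sub>R sigma_N S p \<omega> u v + sigma_N S p \<omega> u' v) [X] s"
  proof -
    have "(c *\<^sub>R \<beta> + \<beta>') [X] s = c * \<beta> [X] s + \<beta>' [X] s" for \<beta> \<beta>' :: "'s form"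
      by (simp add: fun_apply sc)
    then show ?thesis
      unfolding sigma_N_apply [OF X] 1 X2 [OF m(1) m(1)] X2 [OF m(2) m(3)] X2 [OF m(4,5)]
      by (simp add: sigma_N_apply [OF X] algebra_simps)
  qed
qed

lemma sigma_N_anti:
  assumes p: "\<And>x y. p x y = p y x" and w: "bilinear \<omega>" "\<And>x y. \<omega> x y = - \<omega> y x"
    and u: "u \<in> C_inf_map S" and v: "v \<in> C_inf_map S"
  shows "sigma_N S p \<omega> v u = - sigma_N S p \<omega> u v"
proof (rule sigma_N_eqI)
  fix Xs assume "\<not> (\<exists>X\<in>vfields S. Xs = [X])"
  from sigma_N_outside [OF this] show "(- sigma_N S p \<omega> u v) Xs = 0"
    by (simp add: uminus_apply)
next
  fix X s assume X: "X \<in> vfields S"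
  have "(\<lambda>s'. \<omega> (v s') (u s')) = (-1) *\<^sub>R (\<lambda>s'. \<omega> (u s') (v s'))"
  proof
    show "\<omega> (v s') (u s') = ((-1) *\<^sub>R (\<lambda>s'. \<omega> (u s') (v s'))) s'" for s'
      using w(2) [of "v s'" "u s'"] by (simp add: scaleR_fun_def)
  qed
  then have "X (\<lambda>s'. \<omega> (v s') (u s')) = (-1) *\<^sub>R X (\<lambda>s'. \<omega> (u s') (v s'))"
    using vf_scale [OF X C_inf_bilinear [OF w(1) u v], of "-1"] by simp
  moreover have "(\<lambda>s'. p (v s) (u s')) = (\<lambda>s'. p (u s') (v s))" "(\<lambda>s'. p (v s') (u s)) = (\<lambda>s'. p (u s) (v s'))"
    by (rule ext, rule p)+
  ultimately show "sigma_N S p \<omega> v u [X] s = (- sigma_N S p \<omega> u v) [X] s"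
    by (simp add: fun_apply sigma_N_apply [OF X] scaleR_fun_def)
qed

lemma sigma_N_zero_left:
  assumes "bilinear p" "bilinear \<omega>" "v \<in> C_inf_map S"
  shows "sigma_N S p \<omega> 0 v = 0"
  using sigma_N_linear_left [OF assms(1,2) C_inf_map_0 C_inf_map_0 assms(3), of 1] by simp

lemma sigma_N_add_left:
  assumes "bilinear p" "bilinear \<omega>" "u \<in> C_inf_map S" "u' \<in> C_inf_map S" "v \<in> C_inf_map S"
  shows "sigma_N S p \<omega> (u + u') v = sigma_N S p \<omega> u v + sigma_N S p \<omega> u' v"
  using sigma_N_linear_left [OF assms, of 1] by simp

lemma sigma_N_scale_left:
  assumes "bilinear p" "bilinear \<omega>" "u \<in> C_inf_map S" "v \<in> C_inf_map S"
  shows "sigma_N S p \<omega> (c *\<^sub>R u) v = c *\<^sub>R sigma_N S p \<omega> u v"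
  using sigma_N_linear_left [OF assms(1-3) C_inf_map_0 assms(4), of c] sigma_N_zero_left [OF assms(1,2,4)]
  by simp

text \<open>The Leibniz rule \<open>d(f g) = f dg + g df\<close> merges the symmetric and the skew-symmetric contribution into \<open>\<alpha>\<close>.\<close>

lemma sigma_N_current:
  fixes p \<omega> :: "'g::real_vector \<Rightarrow> 'g \<Rightarrow> real"
  assumes p: "bilinear p" "\<And>x y. p x y = p y x" and w: "bilinear \<omega>" "\<And>x y. \<omega> x y = - \<omega> y x"
    and a: "\<And>x y. \<alpha> x y = p x y + \<omega> x y"
    and f: "f \<in> C_inf S" and g: "g \<in> C_inf S"
  shows "sigma_N S p \<omega> (current f x) (current g y) =
    \<alpha> x y *\<^sub>R wedge (form0 f) (ext_d S (form0 g)) - \<alpha> y x *\<^sub>R wedge (form0 g) (ext_d S (form0 f))"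
proof -
  have "(\<lambda>s. \<omega> (current f x s) (current g y s)) = \<omega> x y *\<^sub>R (f * g)"
    by (simp add: fun_eq_iff fun_apply current_def scaleR_fun_def bilinear_lmul [OF w(1)]
        bilinear_rmul [OF w(1)] mult_ac)
  then have "ext_d S (form0 (\<lambda>s. \<omega> (current f x s) (current g y s))) = \<omega> x y *\<^sub>R ext_d S (form0 (f * g))"
    using ext_d_scale [OF Omega_smooth_valued [OF form0_in_Omega [OF C_inf_mult [OF f g]]]]
    by (simp add: form0_scale)
  then show ?thesis
    unfolding sigma_N_def current_def
    using pair_d_right_pure [OF p(1) f g] pair_d_left_pure [OF p(1) f g] w(2) [of y x]
    by (simp add: a p(2) [of y x] d_form0_mult [OF f g] algebra_simps)
qed

lemma sigma_N_in_Omega: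
  fixes p \<omega> :: "'g::real_vector \<Rightarrow> 'g \<Rightarrow> real"
  assumes p: "bilinear p" "\<And>x y. p x y = p y x" and w: "bilinear \<omega>" "\<And>x y. \<omega> x y = - \<omega> y x"
    and u: "u \<in> C_inf_map S" and v: "v \<in> C_inf_map S"
  shows "sigma_N S p \<omega> u v \<in> Omega S 1"
  using u
proof (induction rule: C_inf_map_induct)
  case zero
  then show ?case
    using sigma_N_zero_left [OF p(1) w(1) v] Omega_0 by metis
next
  case (add f x u)
  note fx = current_in_C_inf_map [OF add(1)]
  have "sigma_N S p \<omega> v (current f x) \<in> Omega S 1"
    using v
  proof (induction rule: C_inf_map_induct)
    case zero
    then show ?case
      using sigma_N_zero_left [OF p(1) w(1) fx] Omega_0 by metis
  next
    case (add g y v)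
    note gy = current_in_C_inf_map [OF add(1)]
    show ?case
      unfolding sigma_N_add_left [OF p(1) w(1) gy add(2) fx]
      unfolding sigma_N_current [where \<alpha> = "\<lambda>x y. p x y + \<omega> x y", OF p w refl add(1) \<open>f \<in> C_inf S\<close>]
      by (intro Omega_add Omega_diff Omega_scale wedge_form0_in_Omega d_form0_in_Omega add \<open>f \<in> C_inf S\<close>)
  qed
  then have "sigma_N S p \<omega> (current f x) v \<in> Omega S 1"
    unfolding sigma_N_anti [OF p(2) w v fx] by (rule subspace_neg [OF subspace_Omega])
  then show ?case
    unfolding sigma_N_add_left [OF p(1) w(1) fx add(2) v] using add(3) by (rule Omega_add)
qed

text \<open>The cyclic sum \<open>J\<close> is additive in each argument, so it is enough to evaluate it on maps \<open>f \<otimes> x\<close>,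
\<open>g \<otimes> y\<close>, \<open>h \<otimes> q\<close>. Put \<open>a = \<alpha>(x) [y, q]\<close>, \<open>b = \<alpha>(y) [q, x]\<close>, \<open>c = \<alpha>(q) [x, y]\<close>. The 1-cocycle
condition gives \<open>\<alpha>([x, y]) q = a + b\<close> and its cyclic permutations. With \<open>d(g h) = g dh + h dg\<close> the
coefficient of \<open>f g dh\<close> in the sum is \<open>a + b - (a + b) = 0\<close>, and cyclically for the other two.\<close>

lemma sigma_N_cocycle:
  fixes p \<omega> :: "'g::real_vector \<Rightarrow> 'g \<Rightarrow> real"
  assumes br: "bilinear br" "\<And>x. br x x = 0" and c: "coadjoint_cocycle br \<alpha>"
    and p: "bilinear p" "\<And>x y. p x y = p y x" and w: "bilinear \<omega>" "\<And>x y. \<omega> x y = - \<omega> y x"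
    and a: "\<And>x y. \<alpha> x y = p x y + \<omega> x y"
    and u: "u \<in> C_inf_map S" and v: "v \<in> C_inf_map S" and z: "z \<in> C_inf_map S"
  shows "sigma_N S p \<omega> u (pointwise br v z) + sigma_N S p \<omega> v (pointwise br z u)
    + sigma_N S p \<omega> z (pointwise br u v) = 0"
proof -
  let ?\<sigma> = "sigma_N S p \<omega>" and ?B = "pointwise br"
  define J where "J u v z = ?\<sigma> u (?B v z) + ?\<sigma> v (?B z u) + ?\<sigma> z (?B u v)" for u v z
  note B = pointwise_in_C_inf_map [OF br(1)]
  note biB = bilinear_ladd [OF bilinear_pointwise [OF br(1)]] bilinear_radd [OF bilinear_pointwise [OF br(1)]]
    bilinear_lzero [OF bilinear_pointwise [OF br(1)]] bilinear_rzero [OF bilinear_pointwise [OF br(1)]]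
  have add_right: "?\<sigma> u (v + v') = ?\<sigma> u v + ?\<sigma> u v'"
    if "u \<in> C_inf_map S" "v \<in> C_inf_map S" "v' \<in> C_inf_map S" for u v v'
    using that sigma_N_add_left [OF p(1) w(1) that(2,3,1)] sigma_N_anti [OF p(2) w _ that(1)]
    by (simp add: C_inf_map_add)
  have zero_right: "?\<sigma> u 0 = 0" if "u \<in> C_inf_map S" for u
    using sigma_N_zero_left [OF p(1) w(1) that] sigma_N_anti [OF p(2) w C_inf_map_0 that] by simp
  \<comment> \<open>By cyclicity induction in the first argument reduces each argument in turn to generators.\<close>
  have J_cyc: "J v z u = J u v z" for u v z
    by (simp add: J_def algebra_simps)
  have J_induct: "J u v z = 0"
    if v: "v \<in> C_inf_map S" and z: "z \<in> C_inf_map S" and u: "u \<in> C_inf_map S"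
      and J: "\<And>f x. f \<in> C_inf S \<Longrightarrow> J (current f x) v z = 0" for u v z
    using u
  proof (induction rule: C_inf_map_induct)
    case zero
    show ?case
      using v z by (simp add: J_def biB zero_right sigma_N_zero_left [OF p(1) w(1) B [OF v z]])
  next
    case (add f x u)
    note fx = current_in_C_inf_map [OF add(1), of x]
    have "J (current f x + u) v z = J (current f x) v z + J u v z"
      unfolding J_def biB sigma_N_add_left [OF p(1) w(1) fx add(2) B [OF v z]]
        add_right [OF v B [OF z fx] B [OF z add(2)]] add_right [OF z B [OF fx v] B [OF add(2) v]]
      by (simp add: algebra_simps)
    then show ?case
      using add J by simp
  qed
  have J_current: "J (current f x) (current g y) (current h q) = 0"
    if f: "f \<in> C_inf S" and g: "g \<in> C_inf S" and h: "h \<in> C_inf S" for f g h x y q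
  proof -
    have cc: "\<alpha> (br x y) q = \<alpha> x (br y q) - \<alpha> y (br x q)" for x y q
      using c by (simp add: coadjoint_cocycle_def)
    have ab: "bilinear \<alpha>"
      using c by (simp add: coadjoint_cocycle_def)
    have sk: "br y x = - br x y" for x y
    proof -
      have "br x y + br y x = 0"
        using br(2) [of x] br(2) [of y] br(2) [of "x + y"]
        by (simp add: bilinear_ladd [OF br(1)] bilinear_radd [OF br(1)] add.commute)
      then show ?thesis
        by (simp add: add_eq_0_iff)
    qed
    have cc': "\<alpha> (br x y) q = \<alpha> x (br y q) + \<alpha> y (br q x)" for x y q
      using cc [of x y q] sk [of q x] by (simp add: bilinear_rneg [OF ab])
    note S = sigma_N_current [OF p w a]
    note fg = C_inf_mult [OF f g] and gh = C_inf_mult [OF g h] and hf = C_inf_mult [OF h f]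
    have J1: "J (current f x) (current g y) (current h q) =
        (\<alpha> x (br y q) *\<^sub>R wedge (form0 f) (ext_d S (form0 (g * h))) - \<alpha> (br y q) x *\<^sub>R wedge (form0 (g * h)) (ext_d S (form0 f)))
      + (\<alpha> y (br q x) *\<^sub>R wedge (form0 g) (ext_d S (form0 (h * f))) - \<alpha> (br q x) y *\<^sub>R wedge (form0 (h * f)) (ext_d S (form0 g)))
      + (\<alpha> q (br x y) *\<^sub>R wedge (form0 h) (ext_d S (form0 (f * g))) - \<alpha> (br x y) q *\<^sub>R wedge (form0 (f * g)) (ext_d S (form0 h)))"
      (is "_ = ?r")
      unfolding J_def pointwise_current [OF br(1)] S [OF f gh] S [OF g hf] S [OF h fg] ..
    also have "?r = 0"
    proof (rule Omega1_eqI [OF _ Omega_0])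
      show "?r \<in> Omega S 1"
        by (intro Omega_add Omega_diff Omega_scale wedge_form0_in_Omega d_form0_in_Omega f g h fg gh hf)
      fix X assume X: "X \<in> vfields S"
      have sc: "(c *\<^sub>R \<beta>) Xs s = c * \<beta> Xs s" for c and \<beta> :: "'a form" and Xs s
        by (simp add: scaleR_fun_def)
      have "?r [X] s = 0" for s
        by (simp add: fun_apply sc wedge_form0 ext_d_form0 form1_apply X vf_mult [OF X] f g h cc' [of y q x]
            cc' [of q x y] cc' [of x y q]) (simp add: algebra_simps)
      then show "?r [X] = 0 [X]"
        by (simp add: fun_eq_iff zero_fun_apply)
    qed
    finally show ?thesis .
  qed
  note cur = current_in_C_inf_map
  have J2: "J z (current f x) (current g y) = 0"
    if "f \<in> C_inf S" "g \<in> C_inf S" "z \<in> C_inf_map S" for f g x y z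
    using J_induct [OF cur [OF that(1)] cur [OF that(2)] that(3)] J_current that(1,2) by blast
  have J1: "J v z (current f x) = 0"
    if "f \<in> C_inf S" "v \<in> C_inf_map S" "z \<in> C_inf_map S" for f x v z
  proof (rule J_induct [OF that(3) cur [OF that(1)] that(2)])
    fix g y assume "g \<in> C_inf S"
    then show "J (current g y) z (current f x) = 0"
      using J2 [OF that(1) _ that(3)] J_cyc [of z "current f x" "current g y"] by simp
  qed
  have "J u v z = 0"
  proof (rule J_induct [OF v z u])
    show "J (current f x) v z = 0" if "f \<in> C_inf S" for f x
      using J1 [OF that v z] J_cyc [of v z "current f x"] by simp
  qed
  then show ?thesis
    by (simp add: J_def)
qed

lemma lie_algebra_current_ext:
  fixes S :: "'s manifold" and br :: "'g::real_vector \<Rightarrow> 'g \<Rightarrow> 'g"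
  assumes L: "lie_algebra UNIV br" and c: "coadjoint_cocycle br \<alpha>"
    and p: "bilinear p" "\<And>x y. p x y = p y x" and w: "bilinear \<omega>" "\<And>x y. \<omega> x y = - \<omega> y x"
    and a: "\<And>x y. \<alpha> x y = p x y + \<omega> x y"
  shows "lie_algebra (current_ext_space S) (current_ext_bracket br (sigma_N S p \<omega>))"
proof -
  let ?\<sigma> = "sigma_N S p \<omega>" and ?B = "pointwise br"
    and ?V = "current_ext_space S :: (('s \<Rightarrow> 'g) \<times> 's form) set"
  have bil: "bilinear br" and sq: "br x x = 0"
    and J: "br x (br y z) + br y (br z x) + br z (br x y) = 0" for x y z
    using L by (auto simp: lie_algebra_def bilinear_def linear_iff)
  have E: "current_ext_bracket br ?\<sigma> (u, \<beta>) (v, \<beta>') = (?B u v, ?\<sigma> u v)" for u v \<beta> \<beta>'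
    by (simp add: current_ext_bracket_def pointwise_def)
  note bB = bilinear_ladd [OF bilinear_pointwise [OF bil]] bilinear_radd [OF bilinear_pointwise [OF bil]]
    bilinear_lmul [OF bilinear_pointwise [OF bil]] bilinear_rmul [OF bilinear_pointwise [OF bil]]
  note \<sigma>1 = sigma_N_add_left [OF p(1) w(1)] and \<sigma>2 = sigma_N_scale_left [OF p(1) w(1)]
    and anti = sigma_N_anti [OF p(2) w]
  have \<sigma>3: "?\<sigma> u (v + v') = ?\<sigma> u v + ?\<sigma> u v'"
    if "u \<in> C_inf_map S" "v \<in> C_inf_map S" "v' \<in> C_inf_map S" for u v v'
    using \<sigma>1 [OF that(2,3,1)] anti [OF _ that(1)] that by (simp add: C_inf_map_add)
  have \<sigma>4: "?\<sigma> u (k *\<^sub>R v) = k *\<^sub>R ?\<sigma> u v" if "u \<in> C_inf_map S" "v \<in> C_inf_map S" for u v k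
    using \<sigma>2 [OF that(2,1)] anti [OF _ that(1)] that by (simp add: C_inf_map_scale)
  have \<sigma>0: "?\<sigma> u u = 0" if "u \<in> C_inf_map S" for u
  proof -
    have "?\<sigma> u u = - ?\<sigma> u u" using anti [OF that that] .
    then show ?thesis
      by (metis add.right_inverse real_vector.scale_right_distrib scaleR_2 scaleR_eq_0_iff zero_neq_numeral)
  qed
  have B0: "?B u u = 0" for u
    by (simp add: fun_eq_iff pointwise_def sq zero_fun_apply)
  have BJ: "?B u (?B v z) + ?B v (?B z u) + ?B z (?B u v) = 0" for u v z
    by (simp add: fun_eq_iff pointwise_def J fun_apply)
  have space: "(u, \<beta>) \<in> current_ext_space S \<longleftrightarrow> u \<in> C_inf_map S \<and> \<beta> \<in> Omega S 1" for u \<beta>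
    by (simp add: current_ext_space_def)
  note simps = E space bB \<sigma>1 \<sigma>2 \<sigma>3 \<sigma>4
  show ?thesis
    unfolding lie_algebra_def
  proof (intro conjI ballI allI)
    show "subspace ?V"
      unfolding current_ext_space_def by (intro subspace_Times subspace_C_inf_map subspace_Omega)
  next
    fix P Q assume "P \<in> ?V" "Q \<in> ?V"
    then show "current_ext_bracket br ?\<sigma> P Q \<in> ?V"
      by (cases P; cases Q)
        (simp add: E space sigma_N_in_Omega [OF p w] pointwise_in_C_inf_map [OF bil] del: One_nat_def)
  next
    fix P Q R assume "P \<in> ?V" "Q \<in> ?V" "R \<in> ?V"
    then show "current_ext_bracket br ?\<sigma> (P + Q) R = current_ext_bracket br ?\<sigma> P R + current_ext_bracket br ?\<sigma> Q R"
      "current_ext_bracket br ?\<sigma> R (P + Q) = current_ext_bracket br ?\<sigma> R P + current_ext_bracket br ?\<sigma> R Q"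
      by (cases P; cases Q; cases R; simp only: simps add_Pair)+
  next
    fix k P Q assume "P \<in> ?V" "Q \<in> ?V"
    then show "current_ext_bracket br ?\<sigma> (k *\<^sub>R P) Q = k *\<^sub>R current_ext_bracket br ?\<sigma> P Q"
      "current_ext_bracket br ?\<sigma> P (k *\<^sub>R Q) = k *\<^sub>R current_ext_bracket br ?\<sigma> P Q"
      by (cases P; cases Q; simp only: simps scaleR_Pair)+
  next
    fix P assume "P \<in> ?V"
    then show "current_ext_bracket br ?\<sigma> P P = 0"
      by (cases P) (simp only: E space B0 \<sigma>0 zero_prod_def)
  next
    fix P Q R assume "P \<in> ?V" "Q \<in> ?V" "R \<in> ?V"
    then show "current_ext_bracket br ?\<sigma> P (current_ext_bracket br ?\<sigma> Q R)
      + current_ext_bracket br ?\<sigma> Q (current_ext_bracket br ?\<sigma> R P)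
      + current_ext_bracket br ?\<sigma> R (current_ext_bracket br ?\<sigma> P Q) = 0"
      by (cases P; cases Q; cases R)
        (simp add: E space BJ zero_prod_def sigma_N_cocycle [OF bil sq c p w a] del: One_nat_def)
  qed
qed

section \<open>Closed tensors of degree zero\<close>

definition form_sign :: "'s form \<Rightarrow> 's form" where
  "form_sign \<phi> = (\<lambda>Xs. (-1) ^ length Xs *\<^sub>R \<phi> Xs)"

definition cone_sign :: "'g::real_vector \<times> 'g \<times> real \<times> real \<Rightarrow> 'g \<times> 'g \<times> real \<times> real" where
  "cone_sign = (\<lambda>(x, y, s, t). (x, - y, - s, t))"

lemma linear_form_sign: "linear (form_sign :: 's form \<Rightarrow> 's form)"
proof -
  have sc: "(c *\<^sub>R \<phi>) Xs = c *\<^sub>R \<phi> Xs" for c Xs and \<phi> :: "'s form"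
    by (simp add: scaleR_fun_def)
  have "form_sign (\<phi> + \<psi>) Xs = form_sign \<phi> Xs + form_sign \<psi> Xs"
    "form_sign (c *\<^sub>R \<phi>) Xs = c *\<^sub>R form_sign \<phi> Xs" for \<phi> \<psi> :: "'s form" and c Xs
    by (simp_all add: form_sign_def plus_fun_apply scaleR_add_right sc mult.commute)
  then show ?thesis
    by (intro linearI ext) (simp_all add: plus_fun_apply sc)
qed

lemma linear_cone_sign: "linear cone_sign"
  by (intro linearI) (auto simp: cone_sign_def)

lemma dg_tensor_de_Rham_cone_ext:
  assumes L: "lie_algebra UNIV br" "coadjoint_cocycle br \<alpha>"
    and D: "linear D" "\<And>k \<phi>. \<phi> \<in> Omega S k \<Longrightarrow> D \<phi> = ext_d S \<phi>"
  shows "dg_tensor (de_Rham S) (cone_ext br \<alpha>) D form_sign cone_sign"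
proof (rule dg_tensor.intro)
  show "subspace (part (de_Rham S) i)" for i
    by (simp add: de_Rham_def subspace_Omega subspace_def[of "{0}"])
  have "dgla (cone_ext br \<alpha>)"
    using L by (rule dgla_cone_ext)
  then show "linear (diff (cone_ext br \<alpha>))" "bilinear (mult (cone_ext br \<alpha>))"
    unfolding dgla_def by blast+
  show "bilinear (mult (de_Rham S))"
    by (simp add: de_Rham_def bilinear_wedge)
  show "diff (de_Rham S) \<phi> = D \<phi>" if "\<phi> \<in> part (de_Rham S) i" for i \<phi>
    using that D(2) [of \<phi> "nat i"] D(2) [OF Omega_0] by (simp add: de_Rham_def split: if_splits)
  show "form_sign \<phi> = ksign i *\<^sub>R \<phi>" if "\<phi> \<in> part (de_Rham S) i" for i \<phi>
  proof (cases "i < 0")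
    case True
    then have "\<phi> = 0"
      using that by (simp add: de_Rham_def)
    then show ?thesis
      by (simp add: linear_0 [OF linear_form_sign])
  next
    case False
    then have \<phi>: "\<phi> \<in> Omega S (nat i)"
      using that by (simp add: de_Rham_def)
    show ?thesis
    proof
      fix Xs
      have "(ksign i *\<^sub>R \<phi>) Xs = ksign i *\<^sub>R \<phi> Xs"
        by (simp add: scaleR_fun_def)
      moreover have "(-1) ^ nat i = ksign i"
        using False by (simp add: ksign_def even_nat_iff uminus_power_if)
      ultimately show "form_sign \<phi> Xs = (ksign i *\<^sub>R \<phi>) Xs"
        using Omega_degree [OF \<phi>, of Xs] by (cases "length Xs = nat i") (simp_all add: form_sign_def)
    qed
  qed
  show "cone_sign a = ksign j *\<^sub>R a" if "a \<in> part (cone_ext br \<alpha>) j" for j a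
    using that by (auto simp: cone_ext_def cone_sign_def ksign_def zero_prod_def split: if_splits)
qed (rule D linear_form_sign linear_cone_sign)+

text \<open>The closed elements that complete \<open>f \<otimes> L(x)\<close> and \<open>\<beta> \<otimes> c\<^sub>1\<close>. The first added term cancels
\<open>df \<otimes> L(x)\<close>, the second cancels \<open>d\<beta> \<otimes> c\<^sub>1\<close>, and \<open>d d = 0\<close> takes care of what remains.\<close>

definition current_tensor ::
  "'s manifold \<Rightarrow> ('s \<Rightarrow> real) \<Rightarrow> 'g::real_vector \<Rightarrow> ('s form, 'g \<times> 'g \<times> real \<times> real) tensor" where
  "current_tensor S f x = form0 f \<otimes> (x, 0, 0, 0) + ext_d S (form0 f) \<otimes> (0, x, 0, 0)"

definition central_tensor ::
  "'s manifold \<Rightarrow> 's form \<Rightarrow> ('s form, 'g::real_vector \<times> 'g \<times> real \<times> real) tensor" where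
  "central_tensor S \<beta> = \<beta> \<otimes> (0, 0, 1, 0) - ext_d S \<beta> \<otimes> (0, 0, 0, 1)"

locale current_dgla =
  fixes S :: "'s manifold" and br :: "'g::real_vector \<Rightarrow> 'g \<Rightarrow> 'g" and \<alpha> :: "'g \<Rightarrow> 'g \<Rightarrow> real"
  assumes L: "lie_algebra UNIV br" and c: "coadjoint_cocycle br \<alpha>"
begin

abbreviation "F \<equiv> de_Rham S"
abbreviation "A \<equiv> cone_ext br \<alpha>"
abbreviation "T \<equiv> tensor_dg F A"
abbreviation "H \<equiv> span (homogeneous_tensors F A)"

lemma
  shows diff_linear_comb: "t \<in> H \<Longrightarrow> t' \<in> H \<Longrightarrow> diff T (k *\<^sub>R t + t') = k *\<^sub>R diff T t + diff T t'"
    and diff_pure: "\<phi> \<in> part F i \<Longrightarrow> a \<in> part A j \<Longrightarrow>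
      diff T (\<phi> \<otimes> a) = diff F \<phi> \<otimes> a + ksign i *\<^sub>R (\<phi> \<otimes> diff A a)"
    and mult_linear_comb_left: "t \<in> H \<Longrightarrow> t' \<in> H \<Longrightarrow> t'' \<in> H \<Longrightarrow>
      mult T (k *\<^sub>R t + t') t'' = k *\<^sub>R mult T t t'' + mult T t' t''"
    and mult_linear_comb_right: "t \<in> H \<Longrightarrow> t' \<in> H \<Longrightarrow> t'' \<in> H \<Longrightarrow>
      mult T t'' (k *\<^sub>R t + t') = k *\<^sub>R mult T t'' t + mult T t'' t'"
    and mult_pure: "\<phi> \<in> part F i \<Longrightarrow> a \<in> part A j \<Longrightarrow> \<psi> \<in> part F l \<Longrightarrow> b \<in> part A m \<Longrightarrow>
      mult T (\<phi> \<otimes> a) (\<psi> \<otimes> b) = ksign (j * l) *\<^sub>R (mult F \<phi> \<psi> \<otimes> mult A a b)"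
    and pure_in_H: "\<phi> \<in> part F i \<Longrightarrow> a \<in> part A j \<Longrightarrow> \<phi> \<otimes> a \<in> H"
proof -
  obtain D where "linear D" "\<And>k \<phi>. \<phi> \<in> Omega S k \<Longrightarrow> D \<phi> = ext_d S \<phi>"
    using ext_d_linear_extension by blast
  then interpret dg_tensor F A D form_sign cone_sign
    using L c by (intro dg_tensor_de_Rham_cone_ext)
  show "t \<in> H \<Longrightarrow> t' \<in> H \<Longrightarrow> diff T (k *\<^sub>R t + t') = k *\<^sub>R diff T t + diff T t'"
    by (rule diff_linear_comb)
  show "\<phi> \<in> part F i \<Longrightarrow> a \<in> part A j \<Longrightarrow>
      diff T (\<phi> \<otimes> a) = diff F \<phi> \<otimes> a + ksign i *\<^sub>R (\<phi> \<otimes> diff A a)"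
    by (rule diff_pure)
  show "t \<in> H \<Longrightarrow> t' \<in> H \<Longrightarrow> t'' \<in> H \<Longrightarrow>
      mult T (k *\<^sub>R t + t') t'' = k *\<^sub>R mult T t t'' + mult T t' t''"
    by (rule mult_linear_comb_left)
  show "t \<in> H \<Longrightarrow> t' \<in> H \<Longrightarrow> t'' \<in> H \<Longrightarrow>
      mult T t'' (k *\<^sub>R t + t') = k *\<^sub>R mult T t'' t + mult T t'' t'"
    by (rule mult_linear_comb_right)
  show "\<phi> \<in> part F i \<Longrightarrow> a \<in> part A j \<Longrightarrow> \<psi> \<in> part F l \<Longrightarrow> b \<in> part A m \<Longrightarrow>
      mult T (\<phi> \<otimes> a) (\<psi> \<otimes> b) = ksign (j * l) *\<^sub>R (mult F \<phi> \<psi> \<otimes> mult A a b)"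
    by (rule mult_pure)
  show "\<phi> \<in> part F i \<Longrightarrow> a \<in> part A j \<Longrightarrow> \<phi> \<otimes> a \<in> H"
    by (rule pure_in_H)
qed

lemma part_F: "f \<in> C_inf S \<Longrightarrow> form0 f \<in> part F 0" "\<beta> \<in> Omega S 1 \<Longrightarrow> \<beta> \<in> part F 1"
  "\<gamma> \<in> Omega S 2 \<Longrightarrow> \<gamma> \<in> part F 2"
  by (simp_all add: de_Rham_def form0_in_Omega)

lemma part_A: "(x, 0, 0, 0) \<in> part A 0" "(0, y, r, 0) \<in> part A (- 1)" "(0, 0, 0, k) \<in> part A (- 2)"
  by (simp_all add: cone_ext_def)

lemma part_T_0: "part T 0 = span {\<phi> \<otimes> a |\<phi> a i j. \<phi> \<in> part F i \<and> a \<in> part A j \<and> i + j = 0}"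
  by (simp add: tensor_dg_def)

lemma part_T_0_subset: "part T 0 \<subseteq> H"
  unfolding part_T_0 homogeneous_tensors_def by (rule span_mono) blast

lemma pure_in_part_T_0: "\<phi> \<in> part F i \<Longrightarrow> a \<in> part A j \<Longrightarrow> i + j = 0 \<Longrightarrow> \<phi> \<otimes> a \<in> part T 0"
  unfolding part_T_0 by (rule span_base) blast

lemma subspace_part_T_0: "subspace (part T 0)"
  unfolding part_T_0 by (rule subspace_span)

lemma current_tensor_in_part:
  assumes "f \<in> C_inf S"
  shows "current_tensor S f x \<in> part T 0"
  unfolding current_tensor_def
  by (intro subspace_add [OF subspace_part_T_0] pure_in_part_T_0 [OF part_F(1) part_A(1)]
      pure_in_part_T_0 [OF part_F(2) part_A(2)] d_form0_in_Omega assms) simp_all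

lemma central_tensor_in_part:
  assumes "\<beta> \<in> Omega S 1"
  shows "central_tensor S \<beta> \<in> part T 0"
  unfolding central_tensor_def
  by (intro subspace_diff [OF subspace_part_T_0] pure_in_part_T_0 [OF part_F(2) part_A(2)]
      pure_in_part_T_0 [OF part_F(3) part_A(3)] d_Omega1_in_Omega2 assms) simp_all

lemma diff_add: "t \<in> H \<Longrightarrow> t' \<in> H \<Longrightarrow> diff T (t + t') = diff T t + diff T t'"
  using diff_linear_comb [of t t' 1] by simp

lemma diff_0: "diff T 0 = 0"
  using diff_add [OF span_zero span_zero] by simp

lemma diff_minus: "t \<in> H \<Longrightarrow> t' \<in> H \<Longrightarrow> diff T (t - t') = diff T t - diff T t'"
  using diff_linear_comb [of t' t "-1"] by (simp add: algebra_simps)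

lemma zero_cone: "(0, 0, 0, 0) = (0 :: 'g \<times> 'g \<times> real \<times> real)"
  by (simp add: zero_prod_def)

lemma diff_F_A: "diff F \<phi> = ext_d S \<phi>" "diff A (x, y, r, k) = (y, 0, k, 0)"
  by (simp_all add: de_Rham_def cone_ext_def)

lemma ksign_simps: "ksign 0 = 1" "ksign 1 = -1" "ksign (- 1) = - 1" "ksign 2 = 1" "ksign (- 2) = 1"
  by (simp_all add: ksign_def)

lemma diff_current_tensor:
  assumes f: "f \<in> C_inf S"
  shows "diff T (current_tensor S f x) = 0"
proof -
  note 1 = part_F(1) [OF f] and 2 = part_F(2) [OF d_form0_in_Omega [OF f]]
  show ?thesis
    unfolding current_tensor_def diff_add [OF pure_in_H [OF 1 part_A(1)] pure_in_H [OF 2 part_A(2)]]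
      diff_pure [OF 1 part_A(1)] diff_pure [OF 2 part_A(2)] diff_F_A d_d_form0 [OF f] ksign_simps
    by (simp add: zero_cone)
qed

lemma diff_central_tensor:
  assumes \<beta>: "\<beta> \<in> Omega S 1"
  shows "diff T (central_tensor S \<beta>) = 0"
proof -
  note 1 = part_F(2) [OF \<beta>] and 2 = part_F(3) [OF d_Omega1_in_Omega2 [OF \<beta>]]
  show ?thesis
    unfolding central_tensor_def diff_minus [OF pure_in_H [OF 1 part_A(2)] pure_in_H [OF 2 part_A(3)]]
      diff_pure [OF 1 part_A(2)] diff_pure [OF 2 part_A(3)] diff_F_A d_d_Omega1 [OF \<beta>] ksign_simps
    by (simp add: zero_cone)
qed

definition generators :: "('s form, 'g \<times> 'g \<times> real \<times> real) tensor set" where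
  "generators = {current_tensor S f x |f x. f \<in> C_inf S} \<union> {central_tensor S \<beta> |\<beta>. \<beta> \<in> Omega S 1}"

text \<open>Induced by the map \<open>L(x) \<mapsto> - I(x)\<close>, \<open>c\<^sub>1 \<mapsto> c\<^sub>2\<close>, \<open>I(x) \<mapsto> 0\<close>, \<open>c\<^sub>2 \<mapsto> 0\<close> of the cone extension, which
inverts its differential up to the sign that the degree of the form introduces.\<close>

definition homotopy :: "('s form, 'g \<times> 'g \<times> real \<times> real) tensor \<Rightarrow> ('s form, 'g \<times> 'g \<times> real \<times> real) tensor" where
  "homotopy = tlift (\<lambda>\<phi> (x, y, r, k). \<phi> \<otimes> (0, - x, 0, r))"

lemma homotopy_pure: "homotopy (\<phi> \<otimes> (x, y, r, k)) = \<phi> \<otimes> (0, - x, 0, r)"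
proof -
  have K: "linear (\<lambda>(x :: 'g, y :: 'g, r :: real, k :: real). (0 :: 'g, - x, 0 :: real, r))" (is "linear ?K")
    by (intro linearI) auto
  have "bilinear (\<lambda>(\<phi> :: 's form) a. \<phi> \<otimes> ?K a)"
    unfolding bilinear_def
    by (intro conjI allI linearI)
      (simp_all add: linear_add [OF K] linear_scale [OF K] tensor_add_left tensor_add_right
        tensor_scale_left tensor_scale_right del: split_paired_All)
  from tlift_tensor [OF this] show ?thesis
    by (simp add: homotopy_def split_def)
qed

lemma linear_homotopy: "linear homotopy"
  unfolding homotopy_def by (rule linear_tlift)

lemma part_A_cases:
  assumes "a \<in> part A j"
  obtains x where "j = 0" "a = (x, 0, 0, 0)" | y r where "j = - 1" "a = (0, y, r, 0)"
    | k where "j = - 2" "a = (0, 0, 0, k)" | "a = 0"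
  using assms by (auto simp: cone_ext_def split: if_splits)

text \<open>Subtracting \<open>h(dt)\<close> removes the \<open>I\<close>- and \<open>c\<^sub>2\<close>-part of \<open>t\<close> and puts those in their place that closedness
dictates: \<open>f \<otimes> L(x)\<close> becomes \<open>current_tensor\<close>, \<open>\<phi> \<otimes> I(y)\<close> and \<open>\<gamma> \<otimes> c\<^sub>2\<close> become 0, and \<open>\<beta> \<otimes> c\<^sub>1\<close> becomes
\<open>central_tensor\<close>.\<close>

lemma retraction_pure:
  assumes \<phi>: "\<phi> \<in> part F i" and a: "a \<in> part A j" and ij: "i + j = 0"
  shows "\<phi> \<otimes> a - homotopy (diff T (\<phi> \<otimes> a)) \<in> span generators"
  using a
proof (cases rule: part_A_cases)
  case (1 x)
  then have "\<phi> \<in> Omega S 0"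
    using \<phi> ij by (simp add: de_Rham_def)
  then obtain f where f: "\<phi> = form0 f" "f \<in> C_inf S"
    using Omega0_eq Omega_C_inf by blast
  have "\<phi> \<otimes> a - homotopy (diff T (\<phi> \<otimes> a)) = current_tensor S f x"
    unfolding 1(2) f(1) diff_pure [OF part_F(1) [OF f(2)] part_A(1)] diff_F_A current_tensor_def
    by (simp add: zero_cone homotopy_pure tensor_neg_right [of _ "(0, x, 0, 0)", simplified])
  then show ?thesis
    using f(2) by (auto simp: generators_def intro: span_base)
next
  case (2 y r)
  then have "\<phi> \<in> Omega S 1"
    using \<phi> ij by (simp add: de_Rham_def)
  note \<phi>' = this part_F(2) [OF this]
  have "\<phi> \<otimes> a - homotopy (diff T (\<phi> \<otimes> a)) = r *\<^sub>R central_tensor S \<phi>"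
  proof -
    have e: "(0, y, r, 0) = (0, y, 0, 0) + r *\<^sub>R (0 :: 'g, 0 :: 'g, 1 :: real, 0 :: real)"
      "(0, 0, 0, r) = r *\<^sub>R (0 :: 'g, 0 :: 'g, 0 :: real, 1 :: real)"
      "(0, - y, 0, 0) = - (0 :: 'g, y, 0 :: real, 0 :: real)"
      by simp_all
    have "homotopy (diff T (\<phi> \<otimes> a)) = ext_d S \<phi> \<otimes> (0, 0, 0, r) - \<phi> \<otimes> (0, - y, 0, 0)"
      unfolding 2(2) diff_pure [OF \<phi>'(2) part_A(2)] diff_F_A ksign_simps
      by (simp add: linear_diff [OF linear_homotopy] homotopy_pure)
    then show ?thesis
      unfolding 2(2) central_tensor_def e
      by (simp only: tensor_add_right tensor_scale_right tensor_neg_right scaleR_diff_right) simp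
  qed
  then show ?thesis
    using \<phi>'(1) by (auto simp: generators_def intro: span_base span_scale)
next
  case (3 k)
  then have "\<phi> \<in> Omega S 2"
    using \<phi> ij by (simp add: de_Rham_def)
  note \<phi>' = part_F(3) [OF this]
  have "\<phi> \<otimes> a - homotopy (diff T (\<phi> \<otimes> a)) = 0"
    unfolding 3(2) diff_pure [OF \<phi>' part_A(3)] diff_F_A ksign_simps
    by (simp add: linear_add [OF linear_homotopy] homotopy_pure zero_cone)
  then show ?thesis
    by (simp add: span_zero)
next
  case 4
  then show ?thesis
    by (simp add: diff_0 linear_0 [OF linear_homotopy] span_zero)
qed

text \<open>By linearity \<open>t - h(dt)\<close> lies in the span of the generators for every \<open>t\<close> of degree 0, and for closed \<open>t\<close>
it is \<open>t\<close>.\<close>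

lemma SA_eq_span: "SA S A = span generators"
proof
  have "t \<in> part T 0 \<and> t - homotopy (diff T t) \<in> span generators" if "t \<in> part T 0" for t
    using that unfolding part_T_0
  proof (induction rule: span_induct_alt)
    case base
    show ?case
      by (simp only: span_zero diff_0 linear_0 [OF linear_homotopy] diff_self simp_thms)
  next
    case (step k x y)
    then obtain \<phi> a i j where x: "x = \<phi> \<otimes> a" "\<phi> \<in> part F i" "a \<in> part A j" "i + j = 0"
      by blast
    have xy: "x \<in> part T 0" "y \<in> part T 0"
      using step(2) pure_in_part_T_0 [OF x(2-4)] unfolding x(1) part_T_0 by blast+
    then have "x \<in> H" "y \<in> H"
      using part_T_0_subset by blast+
    then have "homotopy (diff T (k *\<^sub>R x + y)) = k *\<^sub>R homotopy (diff T x) + homotopy (diff T y)"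
      by (simp only: diff_linear_comb linear_add [OF linear_homotopy] linear_scale [OF linear_homotopy])
    then have eq: "k *\<^sub>R x + y - homotopy (diff T (k *\<^sub>R x + y))
        = k *\<^sub>R (x - homotopy (diff T x)) + (y - homotopy (diff T y))"
      by (simp add: algebra_simps)
    moreover have "k *\<^sub>R (x - homotopy (diff T x)) + (y - homotopy (diff T y)) \<in> span generators"
      using step retraction_pure [OF x(2-4)] unfolding x(1) by (blast intro: span_add span_scale)
    moreover have "k *\<^sub>R x + y \<in> part T 0"
      using xy subspace_part_T_0 by (simp add: subspace_add subspace_scale)
    ultimately show ?case
      by (simp only: eq part_T_0 simp_thms)
  qed
  then show "SA S A \<subseteq> span generators"
    unfolding SA_def using linear_0 [OF linear_homotopy] by fastforce
  have "subspace (SA S A)"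
    unfolding SA_def subspace_def
    using part_T_0_subset subspace_part_T_0 diff_0 diff_add diff_linear_comb [OF _ span_zero]
    by (auto simp: subspace_0 subspace_add subspace_scale subset_iff)
  moreover have "generators \<subseteq> SA S A"
    unfolding generators_def SA_def
    using current_tensor_in_part diff_current_tensor central_tensor_in_part diff_central_tensor by blast
  ultimately show "span generators \<subseteq> SA S A"
    by (simp add: span_minimal)
qed

end


section \<open>The graph of the isomorphism\<close>

context current_dgla
begin

definition graph_generators ::
  "(('s form, 'g \<times> 'g \<times> real \<times> real) tensor \<times> ('s \<Rightarrow> 'g) \<times> 's form) set" where
  "graph_generators = {(current_tensor S f x, current f x, 0) |f x. f \<in> C_inf S}
    \<union> {(central_tensor S \<beta>, 0, \<beta>) |\<beta>. \<beta> \<in> Omega S 1}"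

lemma fst_graph: "fst ` span graph_generators = SA S A"
proof -
  have "fst ` graph_generators = generators"
    unfolding graph_generators_def generators_def by force
  then show ?thesis
    by (simp add: SA_eq_span linear_span_image [OF linear_fst, symmetric])
qed

lemma snd_graph: "snd ` span graph_generators = current_ext_space S"
proof -
  let ?C = "{(current f x, 0) |f x. f \<in> C_inf S} \<union> {(0, \<beta>) |\<beta>. \<beta> \<in> Omega S 1} :: (('s \<Rightarrow> 'g) \<times> 's form) set"
  have "snd ` graph_generators = ?C"
    unfolding graph_generators_def by force
  then have "snd ` span graph_generators = span ?C"
    by (simp add: linear_span_image [OF linear_snd, symmetric])
  also have "span ?C = current_ext_space S"
  proof
    show "span ?C \<subseteq> current_ext_space S"
    proof (rule span_minimal)
      show "?C \<subseteq> current_ext_space S"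
        unfolding current_ext_space_def using current_in_C_inf_map C_inf_map_0 Omega_0 by blast
      show "subspace (current_ext_space S :: (('s \<Rightarrow> 'g) \<times> 's form) set)"
        unfolding current_ext_space_def by (intro subspace_Times subspace_C_inf_map subspace_Omega)
    qed
    have u: "(u, 0) \<in> span ?C" if "u \<in> C_inf_map S" for u
      using that
    proof (induction rule: C_inf_map_induct)
      case zero
      have "((0, 0) :: ('s \<Rightarrow> 'g) \<times> 's form) = 0" by (simp add: zero_prod_def)
      then show ?case by (simp only: span_zero)
    next
      case (add f x u)
      have "(current f x, 0) \<in> span ?C"
        using add(1) by (intro span_base) blast
      from span_add [OF this add(3)] show ?case
        by (simp only: add_Pair add_0)
    qed
    have "(u, \<beta>) \<in> span ?C" if "u \<in> C_inf_map S" "\<beta> \<in> Omega S 1" for u \<beta>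
    proof -
      have "(0, \<beta>) \<in> span ?C"
        using that(2) by (intro span_base) blast
      from span_add [OF u [OF that(1)] this] show ?thesis
        by (simp only: add_Pair add_0 add_0_right)
    qed
    then show "current_ext_space S \<subseteq> span ?C"
      unfolding current_ext_space_def by blast
  qed
  finally show ?thesis .
qed

lemma linear_form0_comp:
  fixes l :: "'g \<Rightarrow> real"
  assumes "linear l"
  shows "linear (\<lambda>u :: 's \<Rightarrow> 'g. form0 (\<lambda>s. l (u s)))"
proof -
  have "(\<lambda>s. l ((u + v) s)) = (\<lambda>s. l (u s)) + (\<lambda>s. l (v s))"
    "(\<lambda>s. l ((k *\<^sub>R u) s)) = k *\<^sub>R (\<lambda>s. l (u s))" for u v :: "'s \<Rightarrow> 'g" and k
    by (simp_all add: fun_eq_iff fun_apply scaleR_fun_def linear_add [OF assms] linear_scale [OF assms])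
  then show ?thesis
    by (intro linearI) (simp_all only: form0_add form0_scale)
qed

text \<open>The right hand side is a function of \<open>(u, \<beta>)\<close>, which makes the graph injective towards \<open>SA S A\<close>; varying
\<open>m\<close> and \<open>l\<close> recovers \<open>u\<close> and \<open>\<beta>\<close>, which makes it injective in the other direction. Both sides are
linear on the whole type since \<open>D\<close> is, so it suffices to compare them on the generators.\<close>

lemma rank_one_form_on_graph:
  assumes D: "linear D" "\<forall>k. \<forall>\<phi>\<in>Omega S k. D \<phi> = ext_d S \<phi>"
    and m: "linear m" and l: "linear l"
    and R: "(t, u, \<beta>) \<in> span graph_generators"
  shows "t (\<lambda>\<phi> a. m \<phi> * l a) = m (form0 (\<lambda>s. l (u s, 0, 0, 0))) + m (D (form0 (\<lambda>s. l (0, u s, 0, 0))))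
    + l (0, 0, 1, 0) * m \<beta> - l (0, 0, 0, 1) * m (D \<beta>)"
proof -
  let ?B = "\<lambda>\<phi> a. m \<phi> * l a"
  have B: "bilinear ?B"
    unfolding bilinear_def
    by (intro conjI allI linearI)
      (simp_all add: linear_add [OF m] linear_scale [OF m] linear_add [OF l] linear_scale [OF l] distrib_left distrib_right
        del: split_paired_All)
  have tB: "(\<phi> \<otimes> a) ?B = m \<phi> * l a" for \<phi> a
    unfolding tensor_def by (simp only: B if_True)
  have lin: "linear (\<lambda>x. l (x, 0, 0, 0))" "linear (\<lambda>x. l (0, x, 0, 0))"
  proof -
    have "linear (\<lambda>x :: 'g. (x, 0 :: 'g, 0 :: real, 0 :: real))" "linear (\<lambda>x :: 'g. (0 :: 'g, x, 0 :: real, 0 :: real))"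
      by (intro linearI; simp)+
    from this [THEN linear_compose, OF l]
    show "linear (\<lambda>x. l (x, 0, 0, 0))" "linear (\<lambda>x. l (0, x, 0, 0))"
      by (simp_all only: o_def)
  qed
  note l1 = linear_form0_comp [OF lin(1)] and l2 = linear_form0_comp [OF lin(2)]
  note l12 = linear_add [OF l1] linear_scale [OF l1] linear_0 [OF l1] linear_add [OF l2] linear_scale [OF l2] linear_0 [OF l2]
    linear_add [OF D(1)] linear_scale [OF D(1)] linear_0 [OF D(1)] linear_add [OF m] linear_scale [OF m] linear_0 [OF m]
  have cur: "form0 (\<lambda>s. l (current f x s, 0, 0, 0)) = l (x, 0, 0, 0) *\<^sub>R form0 f"
    "form0 (\<lambda>s. l (0, current f x s, 0, 0)) = l (0, x, 0, 0) *\<^sub>R form0 f" for f x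
  proof -
    have "(\<lambda>s. l (current f x s, 0, 0, 0)) = l (x, 0, 0, 0) *\<^sub>R f"
      "(\<lambda>s. l (0, current f x s, 0, 0)) = l (0, x, 0, 0) *\<^sub>R f"
      using linear_scale [OF lin(1)] linear_scale [OF lin(2)]
      by (simp_all add: fun_eq_iff current_def scaleR_fun_def)
    then show "form0 (\<lambda>s. l (current f x s, 0, 0, 0)) = l (x, 0, 0, 0) *\<^sub>R form0 f"
      "form0 (\<lambda>s. l (0, current f x s, 0, 0)) = l (0, x, 0, 0) *\<^sub>R form0 f"
      by (simp_all only: form0_scale)
  qed
  define \<Phi> where "\<Phi> = (\<lambda>(t, u, \<beta>). m (form0 (\<lambda>s. l (u s, 0, 0, 0))) + m (D (form0 (\<lambda>s. l (0, u s, 0, 0))))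
    + l (0, 0, 1, 0) * m \<beta> - l (0, 0, 0, 1) * m (D \<beta>) - t ?B)"
  have lin\<Phi>: "linear \<Phi>"
    by (intro linearI; clarify)
      (simp_all only: \<Phi>_def prod.case add_Pair scaleR_Pair l12, simp_all add: plus_fun_apply scaleR_fun_def algebra_simps)
  have "\<Phi> z = 0" if z: "z \<in> graph_generators" for z
  proof -
    consider f x where "z = (current_tensor S f x, current f x, 0)" "f \<in> C_inf S"
      | \<beta> where "z = (central_tensor S \<beta>, 0, \<beta>)" "\<beta> \<in> Omega S 1"
      using z unfolding graph_generators_def by blast
    then show ?thesis
    proof cases
      case 1
      then show ?thesis
        using D(2) [rule_format, OF form0_in_Omega [OF 1(2)]]
        by (simp only: \<Phi>_def prod.case cur l12 current_tensor_def plus_fun_apply tB) simp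
    next
      case 2
      then show ?thesis
        using D(2) [rule_format, OF 2(2)]
        by (simp only: \<Phi>_def prod.case l12 central_tensor_def minus_apply tB) simp
    qed
  qed
  then have "\<Phi> (t, u, \<beta>) = 0"
    using linear_eq_0_on_span [OF lin\<Phi> _ R] by blast
  then show ?thesis
    by (simp add: \<Phi>_def)
qed

lemma SA_subset_tensors: "SA S A \<subseteq> span {\<phi> \<otimes> a |\<phi> a. True}"
proof -
  have "part T 0 \<subseteq> span {\<phi> \<otimes> a |\<phi> a. True}"
    unfolding part_T_0 by (rule span_mono) blast
  then show ?thesis
    unfolding SA_def by blast
qed

lemma graph_injective:
  shows graph_fst_0: "(0, w) \<in> span graph_generators \<Longrightarrow> w = 0"
    and graph_snd_0: "(t, 0) \<in> span graph_generators \<Longrightarrow> t = 0"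
proof -
  obtain D where D: "linear D" "\<And>k \<phi>. \<phi> \<in> Omega S k \<Longrightarrow> D \<phi> = ext_d S \<phi>"
    using ext_d_linear_extension by blast
  have "\<forall>k. \<forall>\<phi>\<in>Omega S k. D \<phi> = ext_d S \<phi>"
    using D(2) by blast
  note R = rank_one_form_on_graph [OF D(1) this]
  have f0: "form0 (\<lambda>s. 0) = 0"
    by (simp add: form0_def fun_eq_iff zero_fun_apply)
  show "w = 0" if "(0, w) \<in> span graph_generators"
  proof -
    obtain u \<beta> where w: "w = (u, \<beta>)" by fastforce
    have ev: "linear (\<lambda>\<phi> :: 's form. \<phi> Xs s)" for Xs s
      by (intro linearI) (simp_all add: plus_fun_apply scaleR_fun_def)
    have "u s = 0" for s
    proof (rule linear_functionals_separate)
      fix l :: "'g \<Rightarrow> real" assume l: "linear l"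
      \<comment> \<open>The \<open>L\<close>-part of the tensor, evaluated as a 0-form at \<open>s\<close>.\<close>
      have l': "linear (\<lambda>a :: 'g \<times> 'g \<times> real \<times> real. l (fst a))"
        using linear_compose [OF linear_fst l] by (simp add: o_def)
      show "l (u s) = 0"
        using R [OF ev [of "[]" s] l' that [unfolded w]]
        by (simp add: zero_fun_apply linear_0 [OF l] f0 linear_0 [OF D(1)]) (simp add: form0_def)
    qed
    moreover have "\<beta> Xs s = 0" for Xs s
    proof -
      \<comment> \<open>The coefficient of \<open>c\<^sub>1\<close>.\<close>
      have l': "linear (\<lambda>a :: 'g \<times> 'g \<times> real \<times> real. fst (snd (snd a)))"
        by (intro linearI) simp_all
      show ?thesis
        using R [OF ev [of Xs s] l' that [unfolded w]]
        by (simp add: zero_fun_apply f0 linear_0 [OF D(1)])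
    qed
    ultimately show ?thesis
      by (simp add: w zero_prod_def fun_eq_iff zero_fun_apply)
  qed
  show "t = 0" if t: "(t, 0) \<in> span graph_generators"
  proof (rule rank_one_forms_separate_tensors)
    have "t \<in> SA S A"
      unfolding fst_graph [symmetric] using t by force
    then show "t \<in> span {\<phi> \<otimes> a |\<phi> a. True}"
      using SA_subset_tensors by blast
    fix m :: "'s form \<Rightarrow> real" and l :: "'g \<times> 'g \<times> real \<times> real \<Rightarrow> real"
    assume m: "linear m" and l: "linear l"
    have "l (0, 0, 0, 0) = 0"
      using linear_0 [OF l] by (simp add: zero_cone)
    then show "t (\<lambda>\<phi> a. m \<phi> * l a) = 0"
      using R [OF m l t [unfolded zero_prod_def]]
      by (simp add: zero_fun_apply f0 linear_0 [OF D(1)] linear_0 [OF m])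
  qed
qed

lemma mult_F_A: "mult F \<phi> \<psi> = wedge \<phi> \<psi>"
  "mult A (x, y, r, k) (x', y', r', k') = (br x x', br x y' + br y x', \<alpha> x y' - \<alpha> x' y, \<alpha> y y' + \<alpha> y' y)"
  by (simp_all add: de_Rham_def cone_ext_def)

lemma bilinear_br: "bilinear br"
  using L by (simp add: lie_algebra_def bilinear_def linear_iff)

lemma bilinear_\<alpha>: "bilinear \<alpha>"
  using c by (simp add: coadjoint_cocycle_def)

lemma generators_in_tensors:
  "f \<in> C_inf S \<Longrightarrow> current_tensor S f x \<in> H" "\<beta> \<in> Omega S 1 \<Longrightarrow> central_tensor S \<beta> \<in> H"
  using part_T_0_subset current_tensor_in_part central_tensor_in_part by blast+

lemma mult_add_left: "t \<in> H \<Longrightarrow> t' \<in> H \<Longrightarrow> t'' \<in> H \<Longrightarrow> mult T (t + t') t'' = mult T t t'' + mult T t' t''"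
  using mult_linear_comb_left [of t t' t'' 1] by simp

lemma mult_add_right: "t \<in> H \<Longrightarrow> t' \<in> H \<Longrightarrow> t'' \<in> H \<Longrightarrow> mult T t'' (t + t') = mult T t'' t + mult T t'' t'"
  using mult_linear_comb_right [of t t' t'' 1] by simp

lemma mult_diff_left: "t \<in> H \<Longrightarrow> t' \<in> H \<Longrightarrow> t'' \<in> H \<Longrightarrow> mult T (t - t') t'' = mult T t t'' - mult T t' t''"
  using mult_linear_comb_left [of t' t t'' "-1"] by (simp add: algebra_simps)

lemma mult_diff_right: "t \<in> H \<Longrightarrow> t' \<in> H \<Longrightarrow> t'' \<in> H \<Longrightarrow> mult T t'' (t - t') = mult T t'' t - mult T t'' t'"
  using mult_linear_comb_right [of t' t t'' "-1"] by (simp add: algebra_simps)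

text \<open>The two mixed products contribute \<open>(f dg + g df) \<otimes> I([x, y])\<close>, which is the \<open>I\<close>-part that belongs to
\<open>f g \<otimes> L([x, y])\<close>, and the coefficient of \<open>c\<^sub>1\<close>. In the product of \<open>df \<otimes> I(x)\<close> and \<open>dg \<otimes> I(y)\<close> the
Koszul sign is -1, so the coefficient of \<open>c\<^sub>2\<close> is minus the differential of that of \<open>c\<^sub>1\<close>.\<close>

lemma mult_current_current:
  assumes f: "f \<in> C_inf S" and g: "g \<in> C_inf S"
  shows "mult T (current_tensor S f x) (current_tensor S g y) = current_tensor S (f * g) (br x y)
    + central_tensor S (\<alpha> x y *\<^sub>R wedge (form0 f) (ext_d S (form0 g)) - \<alpha> y x *\<^sub>R wedge (form0 g) (ext_d S (form0 f)))"
proof -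
  let ?df = "ext_d S (form0 f)" and ?dg = "ext_d S (form0 g)"
  let ?fdg = "wedge (form0 f) ?dg" and ?gdf = "wedge (form0 g) ?df"
  note df = d_form0_in_Omega [OF f] and dg = d_form0_in_Omega [OF g]
  note 1 = part_F(1) [OF f] and 2 = part_F(2) [OF df] and 3 = part_F(1) [OF g] and 4 = part_F(2) [OF dg]
  note H = pure_in_H [OF 1 part_A(1)] pure_in_H [OF 2 part_A(2)] pure_in_H [OF 3 part_A(1)] pure_in_H [OF 4 part_A(2)]
  note b0 = bilinear_lzero [OF bilinear_br] bilinear_rzero [OF bilinear_br]
    bilinear_lzero [OF bilinear_\<alpha>] bilinear_rzero [OF bilinear_\<alpha>]
  have e: "(0, z, r, 0) = (0, z, 0, 0) + r *\<^sub>R (0 :: 'g, 0 :: 'g, 1 :: real, 0 :: real)"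
    "(0, 0, 0, r) = r *\<^sub>R (0 :: 'g, 0 :: 'g, 0 :: real, 1 :: real)" for z r
    by simp_all
  have "mult T (current_tensor S f x) (current_tensor S g y)
    = form0 (f * g) \<otimes> (br x y, 0, 0, 0) + ?fdg \<otimes> (0, br x y, \<alpha> x y, 0)
      + ?gdf \<otimes> (0, br x y, - \<alpha> y x, 0) - wedge ?df ?dg \<otimes> (0, 0, 0, \<alpha> x y + \<alpha> y x)"
    unfolding current_tensor_def mult_add_left [OF H(1,2) span_add [OF H(3,4)]]
      mult_add_right [OF H(3,4) H(1)] mult_add_right [OF H(3,4) H(2)]
      mult_pure [OF 1 part_A(1) 3 part_A(1)] mult_pure [OF 1 part_A(1) 4 part_A(2)]
      mult_pure [OF 2 part_A(2) 3 part_A(1)] mult_pure [OF 2 part_A(2) 4 part_A(2)]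
      mult_F_A wedge_form0_form0 wedge_form0_right [of ?df] b0
    by (simp add: ksign_simps)
  also have "\<dots> = form0 (f * g) \<otimes> (br x y, 0, 0, 0) + (?fdg + ?gdf) \<otimes> (0, br x y, 0, 0)
      + ((\<alpha> x y *\<^sub>R ?fdg - \<alpha> y x *\<^sub>R ?gdf) \<otimes> (0, 0, 1, 0)
      - ((\<alpha> x y + \<alpha> y x) *\<^sub>R wedge ?df ?dg) \<otimes> (0, 0, 0, 1))"
    unfolding e(1) [of "br x y" "\<alpha> x y"] e(1) [of "br x y" "- \<alpha> y x"] e(2) [of "\<alpha> x y + \<alpha> y x"]
    by (simp only: tensor_add_left tensor_add_right tensor_scale_left tensor_scale_right tensor_diff_left)
      (simp only: scaleR_minus_left diff_conv_add_uminus add.assoc add.commute add.left_commute)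
  also have "(\<alpha> x y + \<alpha> y x) *\<^sub>R wedge ?df ?dg = ext_d S (\<alpha> x y *\<^sub>R ?fdg - \<alpha> y x *\<^sub>R ?gdf)"
  proof -
    note fdg = Omega_smooth_valued [OF wedge_form0_in_Omega [OF f dg]]
      and gdf = Omega_smooth_valued [OF wedge_form0_in_Omega [OF g df]]
    have "ext_d S (\<alpha> x y *\<^sub>R ?fdg + (- \<alpha> y x) *\<^sub>R ?gdf) = \<alpha> x y *\<^sub>R ext_d S ?fdg + (- \<alpha> y x) *\<^sub>R ext_d S ?gdf"
      by (simp only: ext_d_add [OF subspace_scale [OF subspace_smooth_valued fdg] subspace_scale [OF subspace_smooth_valued gdf]]
          ext_d_scale [OF fdg] ext_d_scale [OF gdf])
    then show ?thesis
      unfolding d_wedge_form0 [OF f g] d_wedge_form0 [OF g f] wedge_d_form0_anti [OF f g]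
      by (simp add: algebra_simps)
  qed
  finally show ?thesis
    unfolding current_tensor_def central_tensor_def d_form0_mult [OF f g] .
qed

lemma
  assumes \<beta>: "\<beta> \<in> Omega S 1"
  shows mult_central_left: "\<psi> \<in> part F l \<Longrightarrow> b \<in> part A j \<Longrightarrow> mult T (central_tensor S \<beta>) (\<psi> \<otimes> b) = 0"
    and mult_central_right: "\<psi> \<in> part F l \<Longrightarrow> b \<in> part A j \<Longrightarrow> mult T (\<psi> \<otimes> b) (central_tensor S \<beta>) = 0"
proof -
  assume \<psi>: "\<psi> \<in> part F l" and b: "b \<in> part A j"
  note 1 = part_F(2) [OF \<beta>] and 2 = part_F(3) [OF d_Omega1_in_Omega2 [OF \<beta>]]
  note H = pure_in_H [OF 1 part_A(2)] pure_in_H [OF 2 part_A(3)] pure_in_H [OF \<psi> b]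
  obtain x y r k where xy: "b = (x, y, r, k)" by (cases b)
  note b0 = bilinear_lzero [OF bilinear_br] bilinear_rzero [OF bilinear_br]
    bilinear_lzero [OF bilinear_\<alpha>] bilinear_rzero [OF bilinear_\<alpha>]
  have "mult A (0, 0, r', k') b = 0" "mult A b (0, 0, r', k') = 0" for r' k'
    by (simp_all add: xy mult_F_A b0 zero_cone)
  then show "mult T (central_tensor S \<beta>) (\<psi> \<otimes> b) = 0" "mult T (\<psi> \<otimes> b) (central_tensor S \<beta>) = 0"
    unfolding central_tensor_def mult_diff_left [OF H] mult_diff_right [OF H]
      mult_pure [OF 1 part_A(2) \<psi> b] mult_pure [OF 2 part_A(3) \<psi> b]
      mult_pure [OF \<psi> b 1 part_A(2)] mult_pure [OF \<psi> b 2 part_A(3)]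
    by simp_all
qed

lemma mult_central_current:
  assumes \<beta>: "\<beta> \<in> Omega S 1" and f: "f \<in> C_inf S"
  shows "mult T (central_tensor S \<beta>) (current_tensor S f x) = 0"
    "mult T (current_tensor S f x) (central_tensor S \<beta>) = 0"
proof -
  note 1 = part_F(1) [OF f] and 2 = part_F(2) [OF d_form0_in_Omega [OF f]]
  note H = pure_in_H [OF 1 part_A(1)] pure_in_H [OF 2 part_A(2)] generators_in_tensors(2) [OF \<beta>]
  show "mult T (central_tensor S \<beta>) (current_tensor S f x) = 0"
    "mult T (current_tensor S f x) (central_tensor S \<beta>) = 0"
    unfolding current_tensor_def mult_add_left [OF H] mult_add_right [OF H]
      mult_central_left [OF \<beta> 1 part_A(1)] mult_central_left [OF \<beta> 2 part_A(2)]
      mult_central_right [OF \<beta> 1 part_A(1)] mult_central_right [OF \<beta> 2 part_A(2)]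
    by simp_all
qed

lemma mult_central_central:
  assumes \<beta>: "\<beta> \<in> Omega S 1" and \<gamma>: "\<gamma> \<in> Omega S 1"
  shows "mult T (central_tensor S \<beta>) (central_tensor S \<gamma>) = 0"
proof -
  note 1 = part_F(2) [OF \<gamma>] and 2 = part_F(3) [OF d_Omega1_in_Omega2 [OF \<gamma>]]
  note H = pure_in_H [OF 1 part_A(2)] pure_in_H [OF 2 part_A(3)] generators_in_tensors(2) [OF \<beta>]
  show ?thesis
    unfolding central_tensor_def [of S \<gamma>] mult_diff_right [OF H]
      mult_central_left [OF \<beta> 1 part_A(2)] mult_central_left [OF \<beta> 2 part_A(3)]
    by simp
qed

lemma graph_subset: "(t, w) \<in> span graph_generators \<Longrightarrow> t \<in> H \<and> w \<in> current_ext_space S"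
proof -
  assume tw: "(t, w) \<in> span graph_generators"
  have "t \<in> SA S A"
    unfolding fst_graph [symmetric] using tw by force
  moreover have "w \<in> current_ext_space S"
    unfolding snd_graph [symmetric] using tw by force
  ultimately show ?thesis
    using part_T_0_subset unfolding SA_def by blast
qed

text \<open>Both brackets are bilinear, hence only pairs of generators have to be compared: for two currents the
brackets agree by \<open>mult_current_current\<close> and \<open>sigma_N_current\<close>, and all others vanish.\<close>

lemma graph_closed_under_bracket:
  assumes p: "bilinear p" "\<And>x y. p x y = p y x" and w: "bilinear \<omega>" "\<And>x y. \<omega> x y = - \<omega> y x"
    and a: "\<And>x y. \<alpha> x y = p x y + \<omega> x y"
    and 1: "(t, v) \<in> span graph_generators" and 2: "(t', v') \<in> span graph_generators"
  shows "(mult T t t', current_ext_bracket br (sigma_N S p \<omega>) v v') \<in> span graph_generators"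
proof -
  let ?\<sigma> = "sigma_N S p \<omega>" and ?R = "span graph_generators"
  let ?b = "current_ext_bracket br ?\<sigma>"
  let ?V = "current_ext_space S :: (('s \<Rightarrow> 'g) \<times> 's form) set"
  have W: "lie_algebra ?V ?b"
    by (rule lie_algebra_current_ext [OF L c p w a])
  have subV: "subspace ?V"
    using W by (simp add: lie_algebra_def)
  have bl: "?b (k *\<^sub>R v + v') v'' = k *\<^sub>R ?b v v'' + ?b v' v''"
    and br: "?b v'' (k *\<^sub>R v + v') = k *\<^sub>R ?b v'' v + ?b v'' v'"
    if "v \<in> ?V" "v' \<in> ?V" "v'' \<in> ?V" for k v v' v''
    using W that subspace_scale [OF subV that(1), of k] unfolding lie_algebra_def by simp_all
  have E: "?b (u, \<beta>) (v, \<beta>') = (pointwise br u v, ?\<sigma> u v)" for u v \<beta> \<beta>'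
    by (simp add: current_ext_bracket_def pointwise_def)
  have R0: "(0, 0, 0) \<in> ?R"
    using span_zero [of graph_generators] by (simp add: zero_prod_def)
  note pw0 = bilinear_lzero [OF bilinear_pointwise [OF bilinear_br]] bilinear_rzero [OF bilinear_pointwise [OF bilinear_br]]
  note \<sigma>0 = sigma_N_zero_left [OF p(1) w(1)]
  have \<sigma>0': "?\<sigma> u 0 = 0" if "u \<in> C_inf_map S" for u
    using \<sigma>0 [OF that] sigma_N_anti [OF p(2) w C_inf_map_0 that] by simp
  have gen: "(mult T t t', ?b v v') \<in> ?R"
    if g: "(t, v) \<in> graph_generators" and g': "(t', v') \<in> graph_generators" for t v t' v'
  proof -
    consider f x where "t = current_tensor S f x" "v = (current f x, 0)" "f \<in> C_inf S"
      | \<beta> where "t = central_tensor S \<beta>" "v = (0, \<beta>)" "\<beta> \<in> Omega S 1"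
      using g unfolding graph_generators_def by blast
    note t = this
    consider f x where "t' = current_tensor S f x" "v' = (current f x, 0)" "f \<in> C_inf S"
      | \<beta> where "t' = central_tensor S \<beta>" "v' = (0, \<beta>)" "\<beta> \<in> Omega S 1"
      using g' unfolding graph_generators_def by blast
    note t' = this
    show ?thesis
    proof (cases rule: t)
      case 1
      note f = 1
      show ?thesis
      proof (cases rule: t')
        case (1 g y)
        let ?s = "\<alpha> x y *\<^sub>R wedge (form0 f) (ext_d S (form0 g)) - \<alpha> y x *\<^sub>R wedge (form0 g) (ext_d S (form0 f))"
        have "?s \<in> Omega S 1"
          using f(3) 1(3) by (intro Omega_diff Omega_scale wedge_form0_in_Omega d_form0_in_Omega)
        then have "(central_tensor S ?s, 0, ?s) \<in> ?R"
          by (intro span_base) (simp add: graph_generators_def)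
        moreover have "(current_tensor S (f * g) (br x y), current (f * g) (br x y), 0) \<in> ?R"
          using C_inf_mult [OF f(3) 1(3)] by (intro span_base) (auto simp: graph_generators_def)
        ultimately have "(current_tensor S (f * g) (br x y) + central_tensor S ?s, current (f * g) (br x y), ?s) \<in> ?R"
          using span_add by fastforce
        then show ?thesis
          unfolding f(1,2) 1(1,2) E mult_current_current [OF f(3) 1(3)] pointwise_current [OF bilinear_br]
            sigma_N_current [OF p w a f(3) 1(3)] .
      next
        case (2 \<beta>)
        show ?thesis
          unfolding f(1,2) 2(1,2) E mult_central_current(2) [OF 2(3) f(3)] pw0
            \<sigma>0' [OF current_in_C_inf_map [OF f(3)]] by (rule R0)
      qed
    next
      case 2
      note \<beta> = 2
      show ?thesis
      proof (cases rule: t')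
        case (1 g y)
        show ?thesis
          unfolding \<beta>(1,2) 1(1,2) E mult_central_current(1) [OF \<beta>(3) 1(3)] pw0
            \<sigma>0 [OF current_in_C_inf_map [OF 1(3)]] by (rule R0)
      next
        case (2 \<gamma>)
        show ?thesis
          unfolding \<beta>(1,2) 2(1,2) E mult_central_central [OF \<beta>(3) 2(3)] pw0
            \<sigma>0 [OF C_inf_map_0] by (rule R0)
      qed
    qed
  qed
  have z: "mult T 0 t = 0" "mult T t 0 = 0" if "t \<in> H" for t
    using mult_add_left [OF span_zero span_zero that] mult_add_right [OF span_zero span_zero that] by simp_all
  have z': "?b 0 v = 0" "?b v 0 = 0" if "v \<in> ?V" for v
    using bl [OF subspace_0 [OF subV] subspace_0 [OF subV] that, of 1]
      br [OF subspace_0 [OF subV] subspace_0 [OF subV] that, of 1] by simp_all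
  have Rcomb: "(k *\<^sub>R t + t', k *\<^sub>R v + v') \<in> ?R" if "(t, v) \<in> ?R" "(t', v') \<in> ?R" for k t t' v v'
    using span_add [OF span_scale [OF that(1), of k] that(2)] by simp
  have left: "(mult T (fst q) t', ?b (snd q) v') \<in> ?R \<and> q \<in> ?R"
    if q: "q \<in> ?R" and g': "(t', v') \<in> graph_generators" for q t' v'
    using q
  proof (induction rule: span_induct_alt)
    case base
    have "t' \<in> H" "v' \<in> ?V"
      using graph_subset [OF span_base [OF g']] by blast+
    then show ?case
      using R0 by (simp add: z z' span_zero) (simp add: zero_prod_def)
  next
    case (step k q q')
    obtain t\<^sub>1 v\<^sub>1 where q\<^sub>1: "q = (t\<^sub>1, v\<^sub>1)" by (cases q)
    obtain t\<^sub>2 v\<^sub>2 where q\<^sub>2: "q' = (t\<^sub>2, v\<^sub>2)" by (cases q')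
    note q = q\<^sub>1 q\<^sub>2
    have *: "t\<^sub>1 \<in> H" "v\<^sub>1 \<in> ?V" "t\<^sub>2 \<in> H" "v\<^sub>2 \<in> ?V" "t' \<in> H" "v' \<in> ?V"
      using graph_subset span_base step g' unfolding q by blast+
    have "(k *\<^sub>R mult T t\<^sub>1 t' + mult T t\<^sub>2 t', k *\<^sub>R ?b v\<^sub>1 v' + ?b v\<^sub>2 v') \<in> ?R"
      using step gen g' unfolding q by (intro Rcomb) auto
    moreover have "(k *\<^sub>R t\<^sub>1 + t\<^sub>2, k *\<^sub>R v\<^sub>1 + v\<^sub>2) \<in> ?R"
      using step unfolding q by (intro Rcomb) (auto intro: span_base)
    ultimately show ?case
      by (simp add: q mult_linear_comb_left [OF *(1,3,5)] bl [OF *(2,4,6)])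
  qed
  have right: "(mult T t (fst q), ?b v (snd q)) \<in> ?R \<and> q \<in> ?R" if q: "q \<in> ?R" for q
    using q
  proof (induction rule: span_induct_alt)
    case base
    have "t \<in> H" "v \<in> ?V"
      using graph_subset [OF 1] by blast+
    then show ?case
      using R0 by (simp add: z z' span_zero) (simp add: zero_prod_def)
  next
    case (step k q q')
    obtain t\<^sub>1 v\<^sub>1 where q\<^sub>1: "q = (t\<^sub>1, v\<^sub>1)" by (cases q)
    obtain t\<^sub>2 v\<^sub>2 where q\<^sub>2: "q' = (t\<^sub>2, v\<^sub>2)" by (cases q')
    note q = q\<^sub>1 q\<^sub>2
    have *: "t\<^sub>1 \<in> H" "v\<^sub>1 \<in> ?V" "t\<^sub>2 \<in> H" "v\<^sub>2 \<in> ?V" "t \<in> H" "v \<in> ?V"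
      using graph_subset span_base step 1 unfolding q by blast+
    have "(mult T t t\<^sub>1, ?b v v\<^sub>1) \<in> ?R"
      using left [OF 1] step(1) unfolding q by simp
    then have "(k *\<^sub>R mult T t t\<^sub>1 + mult T t t\<^sub>2, k *\<^sub>R ?b v v\<^sub>1 + ?b v v\<^sub>2) \<in> ?R"
      using step unfolding q by (intro Rcomb) auto
    moreover have "(k *\<^sub>R t\<^sub>1 + t\<^sub>2, k *\<^sub>R v\<^sub>1 + v\<^sub>2) \<in> ?R"
      using step unfolding q by (intro Rcomb) (auto intro: span_base)
    ultimately show ?case
      by (simp add: q mult_linear_comb_right [OF *(1,3,5)] br [OF *(2,4,6)])
  qed
  show ?thesis
    using right [OF 2] by simp
qed

end

theorem proposition2p3:
  fixes S :: "'s manifold"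
    and br :: "'g::real_vector \<Rightarrow> 'g \<Rightarrow> 'g"
    and \<alpha> p \<omega> :: "'g \<Rightarrow> 'g \<Rightarrow> real"
  assumes "smooth_manifold S"
    and "lie_algebra UNIV br"
    and "coadjoint_cocycle br \<alpha>"
    and "bilinear p" and "\<And>x y. p x y = p y x"
    and "bilinear \<omega>" and "\<And>x y. \<omega> x y = - \<omega> y x"
    and "\<And>x y. \<alpha> x y = p x y + \<omega> x y"
  shows "lie_isomorphic
    (SA S (cone_ext br \<alpha>)) (SA_bracket S (cone_ext br \<alpha>))
    (current_ext_space S) (current_ext_bracket br (sigma_N S p \<omega>))"
proof -
  interpret current_dgla S br \<alpha>
    using assms(2,3) by unfold_locales
  show ?thesis
  proof (rule lie_isomorphic_if_graph)
    show "lie_algebra (current_ext_space S) (current_ext_bracket br (sigma_N S p \<omega>))"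
      using assms by (intro lie_algebra_current_ext)
    show "subspace (span graph_generators)"
      by (rule subspace_span)
    show "SA S A = fst ` span graph_generators"
      by (rule fst_graph [symmetric])
    show "current_ext_space S = snd ` span graph_generators"
      by (rule snd_graph [symmetric])
    show "w = 0" if "(0, w) \<in> span graph_generators" for w
      using that by (rule graph_fst_0)
    show "t = 0" if "(t, 0) \<in> span graph_generators" for t
      using that by (rule graph_snd_0)
    show "(mult T t t', current_ext_bracket br (sigma_N S p \<omega>) w w') \<in> span graph_generators"
      if "(t, w) \<in> span graph_generators" "(t', w') \<in> span graph_generators" for t w t' w'
      using assms(4-8) that by (intro graph_closed_under_bracket)
  qed
qed

end
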